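(* Let $m\geq1$. The space $\mathcal Ov^1(m)$ of normalized overlapping intervals admits the structure of a finite regular CW complex such that the map $p_m:\mathcal Ov^1(m)\to\mathcal Cact^1(m)$ is cellular, where $\mathcal Cact^1(m)$ carries Kaufmann's regular CW structure.
   Context: $\mathbb I=[-1,1]$. A little interval is an orientation-preserving affine-linear embedding $\mathbb I\to\mathbb I$, identified with its image $[x,y]$. $\mathcal Ov(m)$ is the quotient of $\{\text{little intervals}\}^m\times\mathfrak S_m$ by $((L_i),\sigma)\sim((J_i),\tau)$ iff $L_i=J_i$ for all $i$ and, for all $i,j$ with $\mathring L_i\cap\mathring L_j\ne\emptyset$, $\sigma^{-1}(i)<\sigma^{-1}(j)\iff\tau^{-1}(i)<\tau^{-1}(j)$ ($\sigma^{-1}(i)$ is the $\sigma$-height of $i$). b/w trees: a planted tree is a finite rooted tree, edges directed away from the root, with a linear order on outgoing edges at each vertex; $u$ is above $v$ if $u\ne v$ and the root-to-$u$ path passes through $v$, directly above if there is an edge $v\to u$; if $v$ has outgoing edges to $u_1,u_2$ with that to $u_1$ first, $u_1$ is left of $u_2$, $u_2$ right of $u_1$. A b/w tree ($\in\mathcal T_m$) is a planted tree with vertices colored black/white, edges joining different colors, black root, all non-root univalent vertices white, white vertices labelled bijectively by $1,\dots,m$; $|w|$ denotes the number of outgoing edges of a vertex $w$. $T$ is compatible with $\sigma\in\mathfrak S_m$ if along each directed path from the root the white labels form a subsequence of $(\sigma(1),\dots,\sigma(m))$. $\alpha(v)$ = number of white vertices above $v$ for black $v$, plus one for white $v$. For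 white $i$: $\lambda(i),\rho(i)$ the white vertices to the left/right of $i$; $\lambda^+(i)$ the $w\in\lambda(i)$ with $\sigma^{-1}(w)>\sigma^{-1}(i)$ such that every $w'$ right of $w$ and left of $i$ has $\sigma^{-1}(w')>\sigma^{-1}(i)$; $\rho^+(i)$ symmetric. $\mathcal Ov^1(m,\sigma,T)\subseteq\mathcal Ov(m)$ ($T$ compatible with $\sigma$) is the set of $[(L_i=[x_i,y_i]),\sigma]$ for which there exist intervals $[x_v,y_v]$ for black $v$ with: $[x_v,y_v]=\mathbb I$ at the root; for white $i$ directly above black $v$, with $a_i=x_v+\frac2m\sum_{\lambda(i)\setminus\lambda^+(i)}\alpha(j)$, $b_i=x_v+\frac2m\sum_{\lambda(i)}\alpha(j)$, $c_i=y_v-\frac2m\sum_{\rho(i)}\alpha(j)$, $d_i=y_v-\frac2m\sum_{\rho(i)\setminus\rho^+(i)}\alpha(j)$: $a_i\le x_i\le b_i$, $c_i\le y_i\le d_i$; for the black vertices $v_1,\dots,v_k$ directly above a white $i$ in left-to-right order, each $[x_{v_j},y_{v_j}]$ has length $2\alpha(v_j)/m$, lies in $[b_i,c_i]$, and lies left of $[x_{v_{j+1}},y_{v_{j+1}}]$ meeting it in at most one point. $\mathcal Ov^1(m)=\bigcup_{\sigma,T}\mathcal Ov^1(m,\sigma,T)$ with the subspace topology. Normalized cacti: $\mathcal Cact^1(m)$ is the space of $m$-tuples $(P_1,\dots,P_m)$ of finite unions of closed arcs of $S^1=\mathbb R/\mathbb Z$ (basepoint $0$), each of total length $1/m$, with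 pairwise disjoint interiors, covering $S^1$, such that the sequence of labels of arcs met traversing $S^1$ from $0$ contains no sublist $(i,j,i,j)$, $i\ne j$; it is topologized as the subspace of based maps $g:S^1\to(S^1)^m$, $\pi_i g(s)=m\cdot\mathrm{length}(P_i\cap[0,s])$ mod $1$. The cactus is $g(S^1)$, its lobe $i$ is $g(P_i)$; its underlying b/w tree has a white vertex per lobe, black vertices the global root $g(0)$ and the points lying on at least two lobes, and an edge between a black $v$ and white $i$ iff $v\in g(P_i)$, rooted at $g(0)$, planar order from the traversal. Kaufmann's CW structure: the open cells are indexed by $T\in\mathcal T_m$, the open cell of $T$ being the cacti with underlying tree $T$, identified with the interior of $\Delta^{|w_1|}\times\dots\times\Delta^{|w_m|}$ via $m$ times the lengths of the arcs of each lobe between consecutive black vertices starting from its local root; closed cells are the corresponding products of simplices, faces given by arc lengths becoming $0$. The map $p_m$: for $[(L_i),\sigma]\in\mathcal Ov^1(m)$, $p_m[(L_i),\sigma]$ is the normalized cactus whose $P_i$ is the image under $\mathbb I\to S^1$, $s\mapsto(s+1)/2$ mod $1$, of the closure of the set of $s\in\mathbb I$ such that, among all $j$ with $s\in L_j$, $i$ has the largest $\sigma$-height $\sigma^{-1}(j)$. This is a well-defined continuous surjection. *)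

theory Defs
  imports "HOL-Analysis.Analysis"
begin

definition quotient_topology :: "'a topology \<Rightarrow> ('a \<Rightarrow> 'b) \<Rightarrow> 'b topology" where
  "quotient_topology X f =
     topology (\<lambda>U. U \<subseteq> f ` topspace X \<and> openin X {x \<in> topspace X. f x \<in> U})"

definition disc :: "nat \<Rightarrow> (nat \<Rightarrow> real) set" where
  "disc n = {x \<in> PiE {..<n} (\<lambda>_. UNIV). (\<Sum>i<n. (x i)\<^sup>2) \<le> 1}"

definition odisc :: "nat \<Rightarrow> (nat \<Rightarrow> real) set" where
  "odisc n = {x \<in> PiE {..<n} (\<lambda>_. UNIV). (\<Sum>i<n. (x i)\<^sup>2) < 1}"

definition sphere_bd :: "nat \<Rightarrow> (nat \<Rightarrow> real) set" where
  "sphere_bd n = {x \<in> PiE {..<n} (\<lambda>_. UNIV). (\<Sum>i<n. (x i)\<^sup>2) = 1}"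

definition disc_top :: "nat \<Rightarrow> (nat \<Rightarrow> real) topology" where
  "disc_top n = subtopology (product_topology (\<lambda>_. euclideanreal) {..<n}) (disc n)"

text \<open>A finite regular CW structure on X: a finite set C of pairs (open cell, dimension);
  the open cells partition X (X Hausdorff); each n-cell has a characteristic map from the
  closed n-disc which is an embedding (regularity), maps the open disc onto the open cell
  and the boundary sphere into the union of cells of lower dimension.  (For finitely many
  cells closure-finiteness and the weak topology condition are automatic.)\<close>
definition regular_CW_complex :: "'a topology \<Rightarrow> ('a set \<times> nat) set \<Rightarrow> bool" where
  "regular_CW_complex X C \<longleftrightarrow>
     Hausdorff_space X \<and> finite C \<and>
     \<Union> (fst ` C) = topspace X \<and>
     (\<forall>c\<in>C. \<forall>c'\<in>C. c \<noteq> c' \<longrightarrow> fst c \<inter> fst c' = {}) \<and>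
     (\<forall>(e, n) \<in> C. \<exists>\<Phi>. embedding_map (disc_top n) X \<Phi> \<and> \<Phi> ` odisc n = e \<and>
        \<Phi> ` sphere_bd n \<subseteq> \<Union> {e'. \<exists>k<n. (e', k) \<in> C})"

definition skeleton :: "('a set \<times> nat) set \<Rightarrow> nat \<Rightarrow> 'a set" where
  "skeleton C n = \<Union> {e. \<exists>k\<le>n. (e, k) \<in> C}"

definition cellular_map ::
  "'a topology \<Rightarrow> ('a set \<times> nat) set \<Rightarrow> 'b topology \<Rightarrow> (nat \<Rightarrow> 'b set) \<Rightarrow> ('a \<Rightarrow> 'b) \<Rightarrow> bool" where
  "cellular_map X C Y skelY f \<longleftrightarrow>
     continuous_map X Y f \<and> (\<forall>n. f ` skeleton C n \<subseteq> skelY n)"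

text \<open>A little interval is given by its image [x,y], -1 <= x < y <= 1, encoded as (x,y).
  A configuration is a tuple L of m little intervals, indexed by {1..m} (extensional),
  together with a permutation sigma of {1..m}.  The sigma-height of i is inv sigma i.\<close>
definition little_intervals :: "nat \<Rightarrow> (nat \<Rightarrow> real \<times> real) set" where
  "little_intervals m = {L \<in> PiE {1..m} (\<lambda>_. UNIV).
       \<forall>i\<in>{1..m}. -1 \<le> fst (L i) \<and> fst (L i) < snd (L i) \<and> snd (L i) \<le> 1}"

definition perms :: "nat \<Rightarrow> (nat \<Rightarrow> nat) set" where
  "perms m = {\<sigma>. \<sigma> permutes {1..m}}"

definition conf :: "nat \<Rightarrow> ((nat \<Rightarrow> real \<times> real) \<times> (nat \<Rightarrow> nat)) set" where
  "conf m = little_intervals m \<times> perms m"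

definition conf_top :: "nat \<Rightarrow> ((nat \<Rightarrow> real \<times> real) \<times> (nat \<Rightarrow> nat)) topology" where
  "conf_top m = prod_topology
      (subtopology (product_topology (\<lambda>_. euclidean) {1..m}) (little_intervals m))
      (discrete_topology (perms m))"

definition height :: "(nat \<Rightarrow> nat) \<Rightarrow> nat \<Rightarrow> nat" where
  "height \<sigma> i = inv \<sigma> i"

definition interiors_meet :: "real \<times> real \<Rightarrow> real \<times> real \<Rightarrow> bool" where
  "interiors_meet I J \<longleftrightarrow> fst I < snd J \<and> fst J < snd I"

definition ov_rel :: "nat \<Rightarrow> ((nat \<Rightarrow> real \<times> real) \<times> (nat \<Rightarrow> nat)) \<Rightarrow>
                       ((nat \<Rightarrow> real \<times> real) \<times> (nat \<Rightarrow> nat)) \<Rightarrow> bool" where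
  "ov_rel m c c' \<longleftrightarrow> fst c = fst c' \<and>
     (\<forall>i\<in>{1..m}. \<forall>j\<in>{1..m}. interiors_meet (fst c i) (fst c j) \<longrightarrow>
        (height (snd c) i < height (snd c) j \<longleftrightarrow> height (snd c') i < height (snd c') j))"

definition ov_class :: "nat \<Rightarrow> ((nat \<Rightarrow> real \<times> real) \<times> (nat \<Rightarrow> nat)) \<Rightarrow>
                         ((nat \<Rightarrow> real \<times> real) \<times> (nat \<Rightarrow> nat)) set" where
  "ov_class m c = {c' \<in> conf m. ov_rel m c c'}"

definition Ov_top :: "nat \<Rightarrow> ((nat \<Rightarrow> real \<times> real) \<times> (nat \<Rightarrow> nat)) set topology" where
  "Ov_top m = quotient_topology (conf_top m) (ov_class m)"

text \<open>A planted tree is encoded by its set A of vertex addresses (lists of child indices,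
  root = []), prefix closed and closed under left siblings.  Edge v -> v@[k].  Colour is
  given by parity of depth (black = even, so the root is black and edges join different
  colours).  lab labels the white vertices bijectively by 1..m.\<close>
definition whites :: "nat list set \<Rightarrow> nat list set" where
  "whites A = {v \<in> A. odd (length v)}"

definition blacks :: "nat list set \<Rightarrow> nat list set" where
  "blacks A = {v \<in> A. even (length v)}"

definition bw_tree :: "nat \<Rightarrow> nat list set \<Rightarrow> (nat list \<Rightarrow> nat) \<Rightarrow> bool" where
  "bw_tree m A lab \<longleftrightarrow> finite A \<and> [] \<in> A \<and>
     (\<forall>v k. v @ [k] \<in> A \<longrightarrow> v \<in> A) \<and>
     (\<forall>v k. v @ [Suc k] \<in> A \<longrightarrow> v @ [k] \<in> A) \<and>
     (\<forall>v \<in> blacks A. v \<noteq> [] \<longrightarrow> v @ [0] \<in> A) \<and>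
     bij_betw lab (whites A) {1..m}"

definition above :: "nat list \<Rightarrow> nat list \<Rightarrow> bool" where
  "above u v \<longleftrightarrow> (\<exists>w. w \<noteq> [] \<and> u = v @ w)"

definition compatible :: "nat list set \<Rightarrow> (nat list \<Rightarrow> nat) \<Rightarrow> (nat \<Rightarrow> nat) \<Rightarrow> bool" where
  "compatible A lab \<sigma> \<longleftrightarrow>
     (\<forall>u\<in>whites A. \<forall>v\<in>whites A. above u v \<longrightarrow> height \<sigma> (lab v) < height \<sigma> (lab u))"

definition alpha :: "nat list set \<Rightarrow> nat list \<Rightarrow> nat" where
  "alpha A v = card {u \<in> whites A. above u v} + (if odd (length v) then 1 else 0)"

definition lam :: "nat list set \<Rightarrow> nat list \<Rightarrow> nat list set" where
  "lam A i = {butlast i @ [j] | j. j < last i \<and> butlast i @ [j] \<in> A}"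

definition rho :: "nat list set \<Rightarrow> nat list \<Rightarrow> nat list set" where
  "rho A i = {butlast i @ [j] | j. j > last i \<and> butlast i @ [j] \<in> A}"

definition lam_plus :: "nat list set \<Rightarrow> (nat list \<Rightarrow> nat) \<Rightarrow> (nat \<Rightarrow> nat) \<Rightarrow> nat list \<Rightarrow> nat list set" where
  "lam_plus A lab \<sigma> i = {butlast i @ [j] | j. j < last i \<and> butlast i @ [j] \<in> A \<and>
      height \<sigma> (lab (butlast i @ [j])) > height \<sigma> (lab i) \<and>
      (\<forall>j'. j < j' \<and> j' < last i \<longrightarrow> height \<sigma> (lab (butlast i @ [j'])) > height \<sigma> (lab i))}"

definition rho_plus :: "nat list set \<Rightarrow> (nat list \<Rightarrow> nat) \<Rightarrow> (nat \<Rightarrow> nat) \<Rightarrow> nat list \<Rightarrow> nat list set" where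
  "rho_plus A lab \<sigma> i = {butlast i @ [j] | j. j > last i \<and> butlast i @ [j] \<in> A \<and>
      height \<sigma> (lab (butlast i @ [j])) > height \<sigma> (lab i) \<and>
      (\<forall>j'. last i < j' \<and> j' < j \<longrightarrow> height \<sigma> (lab (butlast i @ [j'])) > height \<sigma> (lab i))}"

text \<open>The configuration (L, sigma) satisfies the conditions of Ov^1(m, sigma, T) for
  T = (A, lab), with black intervals [xb v, yb v].\<close>
definition ov1_cond :: "nat \<Rightarrow> (nat \<Rightarrow> nat) \<Rightarrow> nat list set \<Rightarrow> (nat list \<Rightarrow> nat) \<Rightarrow>
                         (nat \<Rightarrow> real \<times> real) \<Rightarrow> bool" where
  "ov1_cond m \<sigma> A lab L \<longleftrightarrow>
    (\<exists>xb yb :: nat list \<Rightarrow> real. xb [] = -1 \<and> yb [] = 1 \<and>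
      (\<forall>i\<in>whites A.
         let v = butlast i;
             a = xb v + 2 / real m * (\<Sum>j\<in>lam A i - lam_plus A lab \<sigma> i. real (alpha A j));
             b = xb v + 2 / real m * (\<Sum>j\<in>lam A i. real (alpha A j));
             c = yb v - 2 / real m * (\<Sum>j\<in>rho A i. real (alpha A j));
             d = yb v - 2 / real m * (\<Sum>j\<in>rho A i - rho_plus A lab \<sigma> i. real (alpha A j))
         in a \<le> fst (L (lab i)) \<and> fst (L (lab i)) \<le> b \<and>
            c \<le> snd (L (lab i)) \<and> snd (L (lab i)) \<le> d \<and>
            (\<forall>k. i @ [k] \<in> A \<longrightarrow>
               yb (i @ [k]) - xb (i @ [k]) = 2 * real (alpha A (i @ [k])) / real m \<and>
               b \<le> xb (i @ [k]) \<and> yb (i @ [k]) \<le> c \<and>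
               (i @ [Suc k] \<in> A \<longrightarrow> yb (i @ [k]) \<le> xb (i @ [Suc k])))))"

definition Ov1 :: "nat \<Rightarrow> ((nat \<Rightarrow> real \<times> real) \<times> (nat \<Rightarrow> nat)) set set" where
  "Ov1 m = {ov_class m (L, \<sigma>) | L \<sigma> A lab.
      (L, \<sigma>) \<in> conf m \<and> bw_tree m A lab \<and> compatible A lab \<sigma> \<and> ov1_cond m \<sigma> A lab L}"

definition Ov1_top :: "nat \<Rightarrow> ((nat \<Rightarrow> real \<times> real) \<times> (nat \<Rightarrow> nat)) set topology" where
  "Ov1_top m = subtopology (Ov_top m) (Ov1 m)"

text \<open>S^1 = R/Z is represented by [0,1) (basepoint 0); t in R represents frac t.\<close>
definition circ_arc :: "real \<Rightarrow> real \<Rightarrow> real set" where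
  "circ_arc a b = frac ` {a..b}"

definition circ_interior :: "real set \<Rightarrow> real set" where
  "circ_interior S = {t \<in> {0..<1}. \<exists>e>0. \<forall>u. \<bar>u - t\<bar> < e \<longrightarrow> frac u \<in> S}"

definition finite_union_of_arcs :: "real set \<Rightarrow> bool" where
  "finite_union_of_arcs S \<longleftrightarrow> (\<exists>F. finite F \<and> (\<forall>(a, b)\<in>F. a < b \<and> b \<le> a + 1) \<and>
       S = (\<Union>(a, b)\<in>F. circ_arc a b))"

definition Cact1 :: "nat \<Rightarrow> (nat \<Rightarrow> real set) set" where
  "Cact1 m = {P. (\<forall>i. i \<notin> {1..m} \<longrightarrow> P i = {}) \<and>
     (\<forall>i\<in>{1..m}. finite_union_of_arcs (P i) \<and> measure lborel (P i) = 1 / real m) \<and>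
     (\<forall>i\<in>{1..m}. \<forall>j\<in>{1..m}. i \<noteq> j \<longrightarrow> circ_interior (P i) \<inter> circ_interior (P j) = {}) \<and>
     (\<Union>i\<in>{1..m}. P i) = {0..<1} \<and>
     \<not> (\<exists>i\<in>{1..m}. \<exists>j\<in>{1..m}. \<exists>s1 s2 s3 s4. i \<noteq> j \<and>
          0 \<le> s1 \<and> s1 < s2 \<and> s2 < s3 \<and> s3 < s4 \<and> s4 < 1 \<and>
          s1 \<in> circ_interior (P i) \<and> s2 \<in> circ_interior (P j) \<and>
          s3 \<in> circ_interior (P i) \<and> s4 \<in> circ_interior (P j))}"

text \<open>The based map g : S^1 -> (S^1)^m, coordinates in [0,1) = R/Z.\<close>
definition gmap :: "nat \<Rightarrow> (nat \<Rightarrow> real set) \<Rightarrow> real \<Rightarrow> nat \<Rightarrow> real" where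
  "gmap m P s = (\<lambda>i. if i \<in> {1..m} then frac (real m * measure lborel (P i \<inter> {0..s})) else 0)"

definition circ_dist :: "real \<Rightarrow> real \<Rightarrow> real" where
  "circ_dist a b = \<bar>a - b - of_int (round (a - b))\<bar>"

text \<open>Uniform distance of the based maps (the compact-open topology on maps from the
  compact space S^1 to the metric space (S^1)^m).\<close>
definition cact_dist :: "nat \<Rightarrow> (nat \<Rightarrow> real set) \<Rightarrow> (nat \<Rightarrow> real set) \<Rightarrow> real" where
  "cact_dist m P Q = Sup {circ_dist (gmap m P s i) (gmap m Q s i) | s i. s \<in> {0..<1} \<and> i \<in> {1..m}}"

definition Cact_top :: "nat \<Rightarrow> (nat \<Rightarrow> real set) topology" where
  "Cact_top m = Metric_space.mtopology (Cact1 m) (cact_dist m)"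

text \<open>Black vertices of the underlying b/w tree: g(0) and the points on at least two lobes.\<close>
definition cact_blacks :: "nat \<Rightarrow> (nat \<Rightarrow> real set) \<Rightarrow> (nat \<Rightarrow> real) set" where
  "cact_blacks m P = insert (gmap m P 0)
     {v. \<exists>i\<in>{1..m}. \<exists>j\<in>{1..m}. i \<noteq> j \<and> v \<in> gmap m P ` P i \<and> v \<in> gmap m P ` P j}"

text \<open>Dimension of the Kaufmann cell containing P: the cell of the tree T is a product of
  simplices of dimensions |w_1|,...,|w_m|; the sum of these is the number of edges
  white -> black, i.e. the number of non-root black vertices.\<close>
definition kaufmann_dim :: "nat \<Rightarrow> (nat \<Rightarrow> real set) \<Rightarrow> nat" where
  "kaufmann_dim m P = card (cact_blacks m P) - 1"

definition kaufmann_skeleton :: "nat \<Rightarrow> nat \<Rightarrow> (nat \<Rightarrow> real set) set" where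
  "kaufmann_skeleton m n = {P \<in> Cact1 m. kaufmann_dim m P \<le> n}"

definition cact_of :: "nat \<Rightarrow> ((nat \<Rightarrow> real \<times> real) \<times> (nat \<Rightarrow> nat)) \<Rightarrow> nat \<Rightarrow> real set" where
  "cact_of m c = (\<lambda>i. if i \<in> {1..m} then
      (\<lambda>s. frac ((s + 1) / 2)) `
        closure {s \<in> {-1..1}. s \<in> {fst (fst c i)..snd (fst c i)} \<and>
           (\<forall>j\<in>{1..m}. s \<in> {fst (fst c j)..snd (fst c j)} \<longrightarrow> height (snd c) j \<le> height (snd c) i)}
      else {})"

definition p_map :: "nat \<Rightarrow> ((nat \<Rightarrow> real \<times> real) \<times> (nat \<Rightarrow> nat)) set \<Rightarrow> nat \<Rightarrow> real set" where
  "p_map m q = cact_of m (SOME c. c \<in> q)"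

end

(* Record a configuration by its sorted endpoints -1 = e_0 < ... < e_r = 1 and, for every elementary
   segment (e_k, e_(k+1)), by the label of the highest interval over it.  A normalized configuration
   is one in which the segments with a given label have total length 2/m (and no two labels cross).
   Hence fixing the weak order of the endpoints and the heights of overlapping intervals leaves free
   only the segment lengths, which range over a product of m open simplices; allowing lengths to
   vanish gives the closed cell.  That the closed cell stays in Ov1 is seen by transporting the
   intervals of all vertices of the tree along the monotone map that changes the segment lengths:
   each such interval is a union of complete lobes, so its length does not change.
   The dimension of a cell is r - m.  The black vertices of the cactus lie in the image of the r + 1
   endpoints, and the first and last endpoint of each lobe have the same image, so at most
   r + 1 - m points remain; this makes p_m cellular. *)
theory Submission
  imports Defs "HOL-Library.Sublist"
begin

section \<open>Quotient topologies, discs and products of simplices\<close>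

text \<open>The same class can satisfy the inequalities for several trees and permutations, so trees
  do not index the cells; they only witness membership in \<open>Ov1\<close>. A tree serves two
  purposes. It yields the tree-free conditions \<open>normal\<close>, from which the cactus and the
  dimension count are obtained. And it carries membership along a deformation: tree and permutation
  stay fixed while the positions move, even in a limit where endpoints merge and the order type
  changes. The constant \<open>2 / m\<close> is the share of one lobe in the length 2 of
  \<open>[-1, 1]\<close>. A disc is compact, so a continuous injection of it into a Hausdorff space
  is an embedding; what has to be shown is that the quotient is Hausdorff. That, and the continuity
  of \<open>p_map\<close>, rest on one observation: near a class the height comparisons of
  overlapping intervals persist and new ones may appear. Visibility is well behaved only off the
  endpoints, where it does not depend on the representative; hence the finite exceptional sets
  throughout.\<close>

lemma istopology_quotient:
  "istopology (\<lambda>U. U \<subseteq> f ` topspace X \<and> openin X {x \<in> topspace X. f x \<in> U})"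
  unfolding istopology_def
proof (intro conjI allI impI)
  fix S T
  assume *: "S \<subseteq> f ` topspace X \<and> openin X {x \<in> topspace X. f x \<in> S}"
    "T \<subseteq> f ` topspace X \<and> openin X {x \<in> topspace X. f x \<in> T}"
  have "{x \<in> topspace X. f x \<in> S \<inter> T} = {x \<in> topspace X. f x \<in> S} \<inter> {x \<in> topspace X. f x \<in> T}" by auto
  with * show "S \<inter> T \<subseteq> f ` topspace X" "openin X {x \<in> topspace X. f x \<in> S \<inter> T}" by auto
next
  fix K assume *: "\<forall>U\<in>K. U \<subseteq> f ` topspace X \<and> openin X {x \<in> topspace X. f x \<in> U}"
  have "{x \<in> topspace X. f x \<in> \<Union> K} = (\<Union>U\<in>K. {x \<in> topspace X. f x \<in> U})" by auto
  with * show "\<Union> K \<subseteq> f ` topspace X" "openin X {x \<in> topspace X. f x \<in> \<Union> K}" by auto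
qed

lemma openin_quotient_topology:
  "openin (quotient_topology X f) U \<longleftrightarrow> U \<subseteq> f ` topspace X \<and> openin X {x \<in> topspace X. f x \<in> U}"
  unfolding quotient_topology_def by (simp add: topology_inverse'[OF istopology_quotient])

lemma topspace_quotient_topology: "topspace (quotient_topology X f) = f ` topspace X"
proof
  have "{x \<in> topspace X. f x \<in> f ` topspace X} = topspace X" by auto
  then have "openin (quotient_topology X f) (f ` topspace X)" by (simp add: openin_quotient_topology)
  then show "f ` topspace X \<subseteq> topspace (quotient_topology X f)" by (rule openin_subset)
  show "topspace (quotient_topology X f) \<subseteq> f ` topspace X"
    using openin_topspace[of "quotient_topology X f"] unfolding openin_quotient_topology by blast
qed

lemma continuous_map_into_quotient: "continuous_map X (quotient_topology X f) f"
  unfolding continuous_map_alt by (auto simp: openin_quotient_topology topspace_quotient_topology Pi_iff vimage_def Int_def conj_commute)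

lemma openin_prod_discrete:
  assumes "W \<subseteq> topspace X \<times> S" "\<And>s. s \<in> S \<Longrightarrow> openin X {x \<in> topspace X. (x, s) \<in> W}"
  shows "openin (prod_topology X (discrete_topology S)) W"
proof -
  have "W = (\<Union>s\<in>S. {x \<in> topspace X. (x, s) \<in> W} \<times> {s})" using assms(1) by auto
  also have "openin (prod_topology X (discrete_topology S)) \<dots>"
    using assms(2) by (intro openin_Union ballI) (auto simp: openin_prod_Times_iff)
  finally show ?thesis .
qed

section \<open>Discs and the gauge of a convex body\<close>

lemma continuous_on_Max:
  fixes f :: "'k \<Rightarrow> 'a::topological_space \<Rightarrow> real"
  assumes "finite K" "K \<noteq> {}" "\<And>k. k \<in> K \<Longrightarrow> continuous_on A (f k)"
  shows "continuous_on A (\<lambda>u. Max ((\<lambda>k. f k u) ` K))"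
  using assms
proof (induction K rule: finite_ne_induct)
  case (insert k K)
  then show ?case by (simp add: continuous_on_max)
qed simp

text \<open>Points of \<open>disc n\<close> are extensional: the coordinates from \<open>n\<close>
  on are constantly \<open>undefined\<close>. So the inclusion into the full product is continuous,
  and continuity on the disc can be checked by \<open>continuous_on UNIV\<close>.\<close>

lemma continuous_map_disc_top:
  assumes "continuous_on UNIV (f :: (nat \<Rightarrow> real) \<Rightarrow> real)"
  shows "continuous_map (disc_top n) euclideanreal f"
proof -
  have "continuous_map (product_topology (\<lambda>_. euclideanreal) {..<n}) (product_topology (\<lambda>_. euclideanreal) UNIV) id"
    unfolding continuous_map_componentwise_UNIV
  proof
    fix k
    show "continuous_map (product_topology (\<lambda>_. euclideanreal) {..<n}) euclideanreal (\<lambda>x. id x k)"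
    proof (cases "k < n")
      case True
      then show ?thesis using continuous_map_product_projection[of k "{..<n}" "\<lambda>_. euclideanreal"] by simp
    next
      case False
      have "continuous_map (product_topology (\<lambda>_. euclideanreal) {..<n}) euclideanreal (\<lambda>x. undefined)" by simp
      then show ?thesis by (rule continuous_map_eq) (use False in \<open>auto simp: PiE_def extensional_def\<close>)
    qed
  qed
  then have "continuous_map (disc_top n) euclidean id"
    unfolding euclidean_product_topology disc_top_def by (rule continuous_map_from_subtopology)
  moreover have "continuous_map euclidean euclideanreal f" using assms by simp
  ultimately have "continuous_map (disc_top n) euclideanreal (f \<circ> id)" by (rule continuous_map_compose)
  then show ?thesis by simp
qed

lemma topspace_disc_top: "topspace (disc_top n) = disc n"
  by (auto simp: disc_top_def disc_def)

lemma compact_disc_top: "compact_space (disc_top n)"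
proof -
  let ?X = "product_topology (\<lambda>_. euclideanreal) {..<n}"
  have "compactin ?X (PiE {..<n} (\<lambda>_. {-1..1}))"
    by (simp add: compactin_PiE)
  moreover have "closedin ?X (disc n)"
  proof -
    have "continuous_map ?X euclideanreal (\<lambda>x. \<Sum>i<n. (x i)\<^sup>2)"
      by (intro continuous_intros continuous_map_product_projection) auto
    from closedin_continuous_map_preimage[OF this, of "{..1}"] show ?thesis
      by (simp add: disc_def)
  qed
  moreover have "disc n \<subseteq> PiE {..<n} (\<lambda>_. {-1..1})"
  proof
    fix x assume x: "x \<in> disc n"
    have "\<bar>x i\<bar> \<le> 1" if "i < n" for i
    proof -
      have "(x i)\<^sup>2 \<le> (\<Sum>i<n. (x i)\<^sup>2)" using that by (intro member_le_sum) auto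
      also have "\<dots> \<le> 1" using x by (simp add: disc_def)
      finally show ?thesis by (simp add: abs_square_le_1)
    qed
    then show "x \<in> PiE {..<n} (\<lambda>_. {-1..1})" using x by (auto simp: disc_def PiE_iff abs_le_iff)
  qed
  ultimately have "compactin ?X (disc n)" by (metis closed_compactin)
  then show ?thesis unfolding disc_top_def by (rule compact_space_subtopology)
qed

text \<open>The radial homeomorphism between the disc and \<open>{u. \<rho> u \<le> 1}\<close>, in this direction so that continuity at the
  origin follows from the linear bound on \<open>\<rho>\<close>.\<close>

lemma gauge_disc:
  fixes \<rho> :: "(nat \<Rightarrow> real) \<Rightarrow> real" and n :: nat
  assumes cont: "continuous_on UNIV \<rho>"
    and hom: "\<And>c u. 0 \<le> c \<Longrightarrow> \<rho> (\<lambda>j. c * u j) = c * \<rho> u"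
    and nonneg: "\<And>u. 0 \<le> \<rho> u"
    and bound: "\<And>u j. j < n \<Longrightarrow> \<bar>u j\<bar> \<le> C * \<rho> u"
    and dep: "\<And>u v. (\<And>j. j < n \<Longrightarrow> u j = v j) \<Longrightarrow> \<rho> u = \<rho> v"
  obtains h where "\<And>j. continuous_on UNIV (\<lambda>s. h s j)"
    "\<And>s s'. s \<in> PiE {..<n} (\<lambda>_. UNIV) \<Longrightarrow> s' \<in> PiE {..<n} (\<lambda>_. UNIV) \<Longrightarrow>
       (\<And>j. j < n \<Longrightarrow> h s j = h s' j) \<Longrightarrow> s = s'"
    "\<And>s. \<rho> (h s) = sqrt (\<Sum>i<n. (s i)\<^sup>2)"
    "\<And>u. \<exists>s\<in>PiE {..<n} (\<lambda>_. UNIV). \<forall>j<n. h s j = u j"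
proof -
  define nrm where "nrm s = sqrt (\<Sum>i<n. (s i)\<^sup>2)" for s :: "nat \<Rightarrow> real"
  \<comment> \<open>The factor turns the Euclidean norm of \<open>s\<close> into the gauge of its
    image. If \<open>\<rho> s = 0\<close>, division by zero gives 0, the right value, because the
    coordinates below \<open>n\<close> vanish there.\<close>
  define h where "h s = (\<lambda>j. if j < n then s j * (nrm s / \<rho> s) else 0)" for s
  have nrm_nonneg: "0 \<le> nrm s" for s by (simp add: nrm_def sum_nonneg)
  have nrm_le: "\<bar>s j\<bar> \<le> nrm s" if "j < n" for s j
  proof -
    have "(s j)\<^sup>2 \<le> (\<Sum>i<n. (s i)\<^sup>2)" using that by (intro member_le_sum) auto
    then have "sqrt ((s j)\<^sup>2) \<le> nrm s" unfolding nrm_def by (rule real_sqrt_le_mono)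
    then show ?thesis by simp
  qed
  have nrm_scale: "nrm s = c * nrm u" if "\<And>j. j < n \<Longrightarrow> s j = c * u j" "0 \<le> c" for s u c
  proof -
    have "(\<Sum>i<n. (s i)\<^sup>2) = c\<^sup>2 * (\<Sum>i<n. (u i)\<^sup>2)"
      using that(1) by (simp add: power_mult_distrib sum_distrib_left)
    then show ?thesis using that(2) by (simp add: nrm_def real_sqrt_mult)
  qed
  have rho0: "s j = 0" if "\<rho> s = 0" "j < n" for s j using bound[OF that(2), of s] that(1) by simp
  have nrm0: "nrm s = 0 \<longleftrightarrow> (\<forall>j<n. s j = 0)" for s
    using nrm_le[of _ s] by (auto simp: nrm_def)
  have rho0': "\<rho> s = 0" if "nrm s = 0" for s
  proof -
    have "\<rho> s = \<rho> (\<lambda>j. 0 * s j)" using that nrm0 by (intro dep) auto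
    then show ?thesis using hom[of 0 s] by simp
  qed
  have rho_h: "\<rho> (h s) = nrm s" for s
  proof -
    have "\<rho> (h s) = \<rho> (\<lambda>j. (nrm s / \<rho> s) * s j)" by (rule dep) (simp add: h_def)
    also have "\<dots> = (nrm s / \<rho> s) * \<rho> s" using nrm_nonneg nonneg by (intro hom) simp
    also have "\<dots> = nrm s" using rho0[of s] nrm0[of s] by (cases "\<rho> s = 0") auto
    finally show ?thesis .
  qed
  show thesis
  proof (rule that[of h])
    fix j
    show "continuous_on UNIV (\<lambda>s. h s j)"
    proof (cases "j < n")
      case False
      then show ?thesis by (simp add: h_def)
    next
      case j: True
      have cn: "continuous_on UNIV nrm" unfolding nrm_def by (intro continuous_intros continuous_on_product_coordinates)
      have cj: "continuous_on UNIV (\<lambda>s::nat \<Rightarrow> real. s j)" by (rule continuous_on_product_coordinates)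
      have "((\<lambda>s. s j * (nrm s / \<rho> s)) \<longlongrightarrow> s0 j * (nrm s0 / \<rho> s0)) (at s0)" for s0
      proof (cases "\<rho> s0 = 0")
        case False
        with cont cn cj show ?thesis by (intro tendsto_intros) (auto simp: continuous_on_def)
      next
        case True
        then have z: "s0 j = 0" "nrm s0 = 0" using rho0[OF True] nrm0 j by auto
        have b: "norm (s j * (nrm s / \<rho> s)) \<le> \<bar>C\<bar> * nrm s" for s
        proof (cases "\<rho> s = 0")
          case False
          then have p: "0 < \<rho> s" using nonneg[of s] by simp
          have "\<bar>s j\<bar> \<le> \<bar>C\<bar> * \<rho> s" using bound[OF j, of s] p
            by (meson abs_ge_self mult_right_mono less_imp_le order_trans)
          then have "\<bar>s j\<bar> * nrm s \<le> \<bar>C\<bar> * \<rho> s * nrm s" by (rule mult_right_mono[OF _ nrm_nonneg])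
          then show ?thesis using p nrm_nonneg[of s] by (simp add: abs_mult field_simps)
        qed (simp add: nrm_nonneg)
        have "((\<lambda>s. \<bar>C\<bar> * nrm s) \<longlongrightarrow> \<bar>C\<bar> * nrm s0) (at s0)"
          using cn by (intro tendsto_intros) (auto simp: continuous_on_def)
        then have "((\<lambda>s. \<bar>C\<bar> * nrm s) \<longlongrightarrow> 0) (at s0)" by (simp add: z)
        then have "((\<lambda>s. s j * (nrm s / \<rho> s)) \<longlongrightarrow> 0) (at s0)"
          by (rule Lim_null_comparison[rotated]) (use b in auto)
        then show ?thesis by (simp add: z)
      qed
      then show ?thesis using j by (simp add: h_def continuous_on_def)
    qed
  next
    show "\<rho> (h s) = sqrt (\<Sum>i<n. (s i)\<^sup>2)" for s using rho_h by (simp add: nrm_def)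
    show "s = s'" if s: "s \<in> PiE {..<n} (\<lambda>_. UNIV)" "s' \<in> PiE {..<n} (\<lambda>_. UNIV)"
      "\<And>j. j < n \<Longrightarrow> h s j = h s' j" for s s'
    proof -
      have r: "nrm s = nrm s'" using rho_h dep[of "h s" "h s'"] s(3) by metis
      have "s j = s' j" if j: "j < n" for j
      proof (cases "nrm s = 0")
        case True
        then show ?thesis using nrm0 r j by metis
      next
        case False
        then have p: "0 < nrm s" "0 < nrm s'" using nrm_nonneg[of s] r by auto
        then have q: "0 < \<rho> s" "0 < \<rho> s'" using nonneg[of s] nonneg[of s'] rho0[of s] rho0[of s'] nrm0
          by (metis less_eq_real_def less_irrefl)+
        \<comment> \<open>Equal images force \<open>s\<close> and \<open>s'\<close> to be
          proportional; since their norms agree, the factor is 1.\<close>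
        have sc: "s k = (\<rho> s / \<rho> s') * s' k" if "k < n" for k
        proof -
          have "s k * (nrm s / \<rho> s) = s' k * (nrm s' / \<rho> s')" using s(3)[of k] that by (simp add: h_def)
          then show ?thesis using p q r by (simp add: field_simps)
        qed
        have "nrm s = (\<rho> s / \<rho> s') * nrm s'" using sc q by (intro nrm_scale) auto
        then have "(\<rho> s / \<rho> s' - 1) * nrm s' = 0" using r by (simp add: left_diff_distrib)
        then have "\<rho> s / \<rho> s' = 1" using p by simp
        then show ?thesis using sc[OF j] by simp
      qed
      then show "s = s'" using s by (intro PiE_ext[OF s(1,2)]) auto
    qed
    fix u :: "nat \<Rightarrow> real"
    show "\<exists>s\<in>PiE {..<n} (\<lambda>_. UNIV). \<forall>j<n. h s j = u j"
    proof (cases "nrm u = 0")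
      case True
      have "(\<lambda>j\<in>{..<n}. 0) \<in> PiE {..<n} (\<lambda>_. UNIV :: real set)" by simp
      moreover have "\<forall>j<n. h (\<lambda>j\<in>{..<n}. 0) j = u j" using True nrm0 by (simp add: h_def)
      ultimately show ?thesis by blast
    next
      case False
      then have p: "0 < nrm u" using nrm_nonneg[of u] by simp
      then have q: "0 < \<rho> u" using nonneg[of u] rho0[of u] nrm0
        by (metis less_eq_real_def less_irrefl)
      \<comment> \<open>The inverse scaling: the norm of the preimage has to be the gauge of
        \<open>u\<close>.\<close>
      let ?c = "\<rho> u / nrm u"
      let ?s = "\<lambda>j\<in>{..<n}. ?c * u j"
      have n: "nrm ?s = ?c * nrm u" using p q by (intro nrm_scale) auto
      have "\<rho> ?s = \<rho> (\<lambda>j. ?c * u j)" by (rule dep) simp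
      also have "\<dots> = ?c * \<rho> u" using p q by (intro hom) simp
      finally have "\<rho> ?s = ?c * \<rho> u" .
      then have "\<forall>j<n. h ?s j = u j" using n p q by (simp add: h_def)
      moreover have "?s \<in> PiE {..<n} (\<lambda>_. UNIV)" by simp
      ultimately show ?thesis by blast
    qed
  qed
qed

text \<open>In each block \<open>S i\<close> one coordinate is determined by the others; the remaining \<open>n\<close> ones are free.  The gauge of
  the product of simplices around \<open>base\<close> is the maximum of the \<open>- u k / base k\<close>.\<close>

lemma simplex_product_disc:
  fixes S :: "'i \<Rightarrow> 'k set" and base :: "'k \<Rightarrow> real"
  assumes I: "finite I" "I \<noteq> {}" and S: "\<And>i. i \<in> I \<Longrightarrow> finite (S i) \<and> S i \<noteq> {}"
    and disj: "\<And>i j. i \<in> I \<Longrightarrow> j \<in> I \<Longrightarrow> i \<noteq> j \<Longrightarrow> S i \<inter> S j = {}"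
    and K: "K = (\<Union>i\<in>I. S i)" and n: "n = card K - card I"
    and pos: "\<And>k. k \<in> K \<Longrightarrow> 0 < base k"
  obtains T where "\<And>k. k \<in> K \<Longrightarrow> continuous_map (disc_top n) euclideanreal (\<lambda>s. T s k)"
    "\<And>s i. i \<in> I \<Longrightarrow> (\<Sum>k\<in>S i. T s k) = (\<Sum>k\<in>S i. base k)"
    "\<And>s k. s \<in> disc n \<Longrightarrow> k \<in> K \<Longrightarrow> 0 \<le> T s k"
    "\<And>s k. s \<in> odisc n \<Longrightarrow> k \<in> K \<Longrightarrow> 0 < T s k"
    "\<And>s. s \<in> sphere_bd n \<Longrightarrow> \<exists>k\<in>K. T s k = 0"
    "\<And>s s'. s \<in> disc n \<Longrightarrow> s' \<in> disc n \<Longrightarrow> (\<And>k. k \<in> K \<Longrightarrow> T s k = T s' k) \<Longrightarrow> s = s'"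
    "\<And>t. (\<And>k. k \<in> K \<Longrightarrow> 0 < t k) \<Longrightarrow> (\<And>i. i \<in> I \<Longrightarrow> (\<Sum>k\<in>S i. t k) = (\<Sum>k\<in>S i. base k)) \<Longrightarrow>
       \<exists>s\<in>odisc n. \<forall>k\<in>K. T s k = t k"
proof -
  have kf: "(SOME k. k \<in> S i) \<in> S i" if "i \<in> I" for i
    using S[OF that] by (simp add: some_in_eq)
  define kf where "kf i = (SOME k. k \<in> S i)" for i
  note kf = kf[folded kf_def]
  define F where "F = K - kf ` I"
  define lb where "lb k = (SOME i. i \<in> I \<and> k \<in> S i)" for k
  have lb: "lb k = i" if "i \<in> I" "k \<in> S i" for i k
  proof -
    have "lb k \<in> I \<and> k \<in> S (lb k)" unfolding lb_def by (rule someI[of _ i]) (use that in simp)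
    then show ?thesis using disj that by blast
  qed
  have finK: "finite K" "K \<noteq> {}" using I S K by auto
  have "inj_on kf I" by (rule inj_onI) (use kf disj in \<open>metis disjoint_iff\<close>)
  then have "card F = n"
    unfolding F_def n using kf K finK by (subst card_Diff_subset) (auto simp: card_image I)
  then obtain \<gamma> where \<gamma>: "bij_betw \<gamma> F {..<n}"
    using ex_bij_betw_finite_nat[of F] finK by (auto simp: F_def atLeast0LessThan)
  have \<gamma>n: "\<gamma> k < n" if "k \<in> F" for k using \<gamma> that bij_betwE by blast
  have SF: "k \<in> F" if "i \<in> I" "k \<in> S i" "k \<noteq> kf i" for i k
    using that kf lb unfolding F_def K by (metis DiffI UN_I imageE)
  \<comment> \<open>\<open>U u\<close> is the tangent vector with free coordinates \<open>u\<close>: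
    at the chosen index \<open>kf i\<close> of a block it takes the value that makes the block sum
    vanish.\<close>
  define U where "U u k = (if k \<in> F then u (\<gamma> k) else - (\<Sum>k'\<in>S (lb k) - {k}. u (\<gamma> k')))" for u :: "nat \<Rightarrow> real" and k
  have kfF: "kf i \<notin> F" if "i \<in> I" for i using that by (simp add: F_def)
  have U_kf: "U u (kf i) = - (\<Sum>k'\<in>S i - {kf i}. u (\<gamma> k'))" if "i \<in> I" for u i
    using kfF[OF that] lb[OF that kf[OF that]] by (simp add: U_def)
  have K_cases: "k \<in> F \<or> (\<exists>i\<in>I. k = kf i)" if "k \<in> K" for k
    using that by (auto simp: F_def)
  have U_scale: "U (\<lambda>j. c * u j) k = c * U u k" for c u k
    by (simp add: U_def sum_distrib_left)
  have U_sum: "(\<Sum>k\<in>S i. U u k) = 0" if i: "i \<in> I" for u i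
  proof -
    have "(\<Sum>k\<in>S i. U u k) = U u (kf i) + (\<Sum>k\<in>S i - {kf i}. U u k)"
      using S[OF i] kf[OF i] by (intro sum.remove) auto
    also have "(\<Sum>k\<in>S i - {kf i}. U u k) = (\<Sum>k\<in>S i - {kf i}. u (\<gamma> k))"
      using SF[OF i] by (intro sum.cong) (auto simp: U_def)
    finally show ?thesis by (simp add: U_kf i)
  qed
  have U_dep: "U u k = U v k" if uv: "\<And>j. j < n \<Longrightarrow> u j = v j" "k \<in> K" for u v k
  proof (cases "k \<in> F")
    case True
    then show ?thesis using uv \<gamma>n by (simp add: U_def)
  next
    case False
    then obtain i where i: "i \<in> I" "k = kf i" using K_cases uv(2) by blast
    have "(\<Sum>k'\<in>S i - {kf i}. u (\<gamma> k')) = (\<Sum>k'\<in>S i - {kf i}. v (\<gamma> k'))"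
      using SF[OF i(1)] \<gamma>n uv(1) by (intro sum.cong) auto
    then show ?thesis by (simp add: i U_kf)
  qed
  have U_cont: "continuous_on UNIV (\<lambda>u. U u k)" for k
    unfolding U_def by (cases "k \<in> F") (auto intro!: continuous_intros continuous_on_product_coordinates)
  have U_hit: "\<exists>u. \<forall>k\<in>K. U u k = v k" if v: "\<And>i. i \<in> I \<Longrightarrow> (\<Sum>k\<in>S i. v k) = 0" for v
  proof -
    let ?u = "\<lambda>j. v (inv_into F \<gamma> j)"
    have u: "?u (\<gamma> k) = v k" if "k \<in> F" for k
      using \<gamma> that by (simp add: bij_betw_def inv_into_f_f)
    have "U ?u k = v k" if "k \<in> K" for k
    proof (cases "k \<in> F")
      case True
      then show ?thesis using u by (simp add: U_def)
    next
      case False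
      then obtain i where i: "i \<in> I" "k = kf i" using K_cases \<open>k \<in> K\<close> by blast
      have "0 = v (kf i) + (\<Sum>k\<in>S i - {kf i}. v k)"
        using v[OF i(1)] S[OF i(1)] kf[OF i(1)] by (subst sum.remove[symmetric]) auto
      moreover have "(\<Sum>k\<in>S i - {kf i}. v k) = (\<Sum>k\<in>S i - {kf i}. ?u (\<gamma> k))"
        using SF[OF i(1)] u by (intro sum.cong) auto
      ultimately show ?thesis using U_kf[OF i(1), of ?u] i by simp
    qed
    then show ?thesis by blast
  qed
  define \<rho> where "\<rho> u = Max ((\<lambda>k. - U u k / base k) ` K)" for u
  have rho_ge: "- U u k \<le> \<rho> u * base k" if "k \<in> K" for u k
  proof -
    have "- U u k / base k \<le> \<rho> u" unfolding \<rho>_def using finK that by (intro Max_ge) auto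
    then show ?thesis unfolding pos_divide_le_eq[OF pos[OF that]] .
  qed
  have rho_eq: "\<exists>k\<in>K. - U u k = \<rho> u * base k" for u
  proof -
    have "\<rho> u \<in> (\<lambda>k. - U u k / base k) ` K" unfolding \<rho>_def using finK by (intro Max_in) auto
    then show ?thesis using pos by force
  qed
  have nonneg: "0 \<le> \<rho> u" for u
  proof (rule ccontr)
    assume "\<not> 0 \<le> \<rho> u"
    then have neg: "0 < U u k" if "k \<in> K" for k
      using rho_ge[OF that, of u] mult_neg_pos[of "\<rho> u" "base k"] pos[OF that] by linarith
    obtain i where i: "i \<in> I" using I by blast
    have "0 < (\<Sum>k\<in>S i. U u k)" using S[OF i] neg i K by (intro sum_pos) auto
    then show False using U_sum[OF i] by simp
  qed
  define M where "M = (\<Sum>k\<in>K. base k)"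
  have bound: "\<bar>U u k\<bar> \<le> M * \<rho> u" if k: "k \<in> K" for u k
  proof -
    obtain i where i: "i \<in> I" "k \<in> S i" using k K by blast
    have SK: "S i \<subseteq> K" using i K by blast
    have "base k \<le> M" unfolding M_def using k finK pos by (intro member_le_sum) (auto intro: less_imp_le)
    from mult_right_mono[OF this nonneg[of u]]
    have "\<rho> u * base k \<le> M * \<rho> u" by (simp add: mult.commute)
    then have 1: "- U u k \<le> M * \<rho> u" using rho_ge[OF k, of u] by linarith
    \<comment> \<open>The gauge controls coordinates only from below. The upper bound comes from the
      vanishing block sum: a coordinate is minus the sum of the others.\<close>
    have "U u k = - (\<Sum>k\<in>S i - {k}. U u k)"
      using U_sum[OF i(1), of u] S[OF i(1)] i(2) sum.remove[of "S i" k "U u"] by simp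
    also have "\<dots> = (\<Sum>k\<in>S i - {k}. - U u k)" by (simp add: sum_negf)
    also have "\<dots> \<le> (\<Sum>k\<in>S i - {k}. \<rho> u * base k)" using SK rho_ge by (intro sum_mono) auto
    also have "\<dots> = \<rho> u * (\<Sum>k\<in>S i - {k}. base k)" by (simp add: sum_distrib_left)
    also have "\<dots> \<le> \<rho> u * M"
    proof (rule mult_left_mono[OF _ nonneg])
      show "(\<Sum>k\<in>S i - {k}. base k) \<le> M" unfolding M_def
        using finK SK pos by (intro sum_mono2) (auto intro: less_imp_le)
    qed
    finally show ?thesis using 1 by (simp add: mult.commute abs_le_iff)
  qed
  have rho_cont: "continuous_on UNIV \<rho>"
    unfolding \<rho>_def using finK pos by (intro continuous_on_Max continuous_intros U_cont) force+
  have rho_hom: "\<rho> (\<lambda>j. c * u j) = c * \<rho> u" if "0 \<le> c" for c u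
  proof -
    have "(\<lambda>k. - U (\<lambda>j. c * u j) k / base k) ` K = (*) c ` ((\<lambda>k. - U u k / base k) ` K)"
      by (simp add: U_scale image_image)
    moreover have "mono ((*) c)" using that by (simp add: mono_def mult_left_mono)
    ultimately show ?thesis unfolding \<rho>_def using finK by (simp add: mono_Max_commute[symmetric])
  qed
  have rho_dep: "\<rho> u = \<rho> v" if "\<And>j. j < n \<Longrightarrow> u j = v j" for u v
  proof -
    have "(\<lambda>k. - U u k / base k) ` K = (\<lambda>k. - U v k / base k) ` K"
      by (rule image_cong) (use U_dep[OF that] in auto)
    then show ?thesis by (simp add: \<rho>_def)
  qed
  have U_coord: "u j = U u (inv_into F \<gamma> j)" "inv_into F \<gamma> j \<in> K" if "j < n" for u j
  proof -
    have "j \<in> \<gamma> ` F" using \<gamma> that by (simp add: bij_betw_def)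
    then show "u j = U u (inv_into F \<gamma> j)" "inv_into F \<gamma> j \<in> K"
      by (auto simp: U_def f_inv_into_f inv_into_into) (use inv_into_into[of j \<gamma> F] in \<open>auto simp: F_def\<close>)
  qed
  have coord_bound: "\<bar>u j\<bar> \<le> M * \<rho> u" if "j < n" for u j
    using bound[OF U_coord(2)[OF that], of u] by (simp flip: U_coord(1)[OF that])
  show thesis
  proof (rule gauge_disc[OF rho_cont rho_hom nonneg coord_bound rho_dep])
    fix h :: "(nat \<Rightarrow> real) \<Rightarrow> nat \<Rightarrow> real"
    assume h: "\<And>j. continuous_on UNIV (\<lambda>s. h s j)"
      "\<And>s s'. s \<in> PiE {..<n} (\<lambda>_. UNIV) \<Longrightarrow> s' \<in> PiE {..<n} (\<lambda>_. UNIV) \<Longrightarrow>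
         (\<And>j. j < n \<Longrightarrow> h s j = h s' j) \<Longrightarrow> s = s'"
      "\<And>s. \<rho> (h s) = sqrt (\<Sum>i<n. (s i)\<^sup>2)"
      "\<And>u. \<exists>s\<in>PiE {..<n} (\<lambda>_. UNIV). \<forall>j<n. h s j = u j"
    define T where "T s k = base k + U (h s) k" for s k
    have "continuous_on UNIV (\<lambda>s. U (h s) k)" for k
      unfolding U_def by (cases "k \<in> F") (auto intro!: continuous_intros h(1))
    then have T_cont: "continuous_on UNIV (\<lambda>s. T s k)" for k
      unfolding T_def by (intro continuous_intros)
    have T_ge: "base k * (1 - \<rho> (h s)) \<le> T s k" if "k \<in> K" for s k
      using rho_ge[OF that, of "h s"] by (simp add: T_def algebra_simps)
    show thesis
    proof (rule that[of T])
      show "continuous_map (disc_top n) euclideanreal (\<lambda>s. T s k)" for k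
        by (rule continuous_map_disc_top[OF T_cont])
      show "(\<Sum>k\<in>S i. T s k) = (\<Sum>k\<in>S i. base k)" if "i \<in> I" for s i
        using U_sum[OF that] by (simp add: T_def sum.distrib)
      show "0 \<le> T s k" if "s \<in> disc n" "k \<in> K" for s k
      proof -
        have "0 \<le> base k * (1 - \<rho> (h s))"
          using that pos[of k] by (intro mult_nonneg_nonneg) (auto simp: h(3) disc_def)
        then show ?thesis using T_ge[OF that(2), of s] by linarith
      qed
      show "0 < T s k" if "s \<in> odisc n" "k \<in> K" for s k
      proof -
        have "0 < base k * (1 - \<rho> (h s))"
          using that pos[of k] by (intro mult_pos_pos) (auto simp: h(3) odisc_def)
        then show ?thesis using T_ge[OF that(2), of s] by linarith
      qed
      show "\<exists>k\<in>K. T s k = 0" if "s \<in> sphere_bd n" for s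
      proof -
        have "\<rho> (h s) = 1" using that by (simp add: h(3) sphere_bd_def)
        then obtain k where "k \<in> K" "- U (h s) k = base k" using rho_eq[of "h s"] by auto
        then show ?thesis by (intro bexI[of _ k]) (auto simp: T_def)
      qed
      show "s = s'" if s: "s \<in> disc n" "s' \<in> disc n" and eq: "\<And>k. k \<in> K \<Longrightarrow> T s k = T s' k" for s s'
      proof -
        have U: "U (h s) k = U (h s') k" if "k \<in> K" for k using eq[OF that] by (simp add: T_def)
        have "h s j = h s' j" if "j < n" for j
          using U_coord[OF that] U by metis
        then show ?thesis using s by (intro h(2)) (auto simp: disc_def)
      qed
      show "\<exists>s\<in>odisc n. \<forall>k\<in>K. T s k = t k"
        if t: "\<And>k. k \<in> K \<Longrightarrow> 0 < t k" "\<And>i. i \<in> I \<Longrightarrow> (\<Sum>k\<in>S i. t k) = (\<Sum>k\<in>S i. base k)" for t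
      proof -
        obtain u where u: "\<And>k. k \<in> K \<Longrightarrow> U u k = t k - base k"
          using U_hit[of "\<lambda>k. t k - base k"] t(2) by (auto simp: sum_subtractf)
        obtain s where s: "s \<in> PiE {..<n} (\<lambda>_. UNIV)" "\<forall>j<n. h s j = u j" using h(4) by blast
        have U: "U (h s) k = t k - base k" if "k \<in> K" for k
          using U_dep[of "h s" u k] s u that by simp
        obtain k where k: "k \<in> K" "- U (h s) k = \<rho> (h s) * base k" using rho_eq by blast
        have "\<rho> (h s) * base k < 1 * base k" using k U[OF k(1)] t(1)[OF k(1)] by linarith
        then have "\<rho> (h s) < 1" using pos[OF k(1)] by (simp only: mult_less_cancel_right_pos)
        then have "s \<in> odisc n" using s(1) by (simp add: h(3) odisc_def)
        then show ?thesis using U by (intro bexI[of _ s]) (auto simp: T_def)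
      qed
    qed
  qed
qed

section \<open>Intervals attached to the vertices of a tree\<close>

text \<open>The set whose closure \<open>cact_of\<close> takes. As the intervals are closed,
  visibility at an endpoint can depend on the representative of a class; this is why later
  statements avoid \<open>ends\<close>.\<close>

definition visible :: "nat \<Rightarrow> ((nat \<Rightarrow> real \<times> real) \<times> (nat \<Rightarrow> nat)) \<Rightarrow> nat \<Rightarrow> real \<Rightarrow> bool" where
  "visible m c i z \<longleftrightarrow> i \<in> {1..m} \<and> z \<in> {fst (fst c i)..snd (fst c i)} \<and>
     (\<forall>j\<in>{1..m}. z \<in> {fst (fst c j)..snd (fst c j)} \<longrightarrow> height (snd c) j \<le> height (snd c) i)"

definition nch :: "nat list set \<Rightarrow> nat list \<Rightarrow> nat" where
  "nch A v = card {k. v @ [k] \<in> A}"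

text \<open>The boundaries of the blocks of the children of a black \<open>v\<close>, measured from
  its left end: each child takes \<open>2 / m\<close> for every white vertex of its subtree, itself
  included.\<close>

definition off :: "nat \<Rightarrow> nat list set \<Rightarrow> nat list \<Rightarrow> nat \<Rightarrow> real" where
  "off m A v k = 2 / real m * (\<Sum>j<k. real (alpha A (v @ [j])))"

text \<open>For a white vertex, \<open>lo\<close> and \<open>hi\<close> are the bounds
  \<open>b\<close> and \<open>c\<close> of \<open>ov1_cond\<close>, not the ends of its little
  interval. The little interval contains this block and may reach beyond it underneath higher
  siblings.\<close>

definition lo :: "nat \<Rightarrow> nat list set \<Rightarrow> (nat list \<Rightarrow> real) \<Rightarrow> nat list \<Rightarrow> real" where
  "lo m A xb v = (if even (length v) then xb v else xb (butlast v) + off m A (butlast v) (last v))"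

definition hi :: "nat \<Rightarrow> nat list set \<Rightarrow> (nat list \<Rightarrow> real) \<Rightarrow> nat list \<Rightarrow> real" where
  "hi m A xb v = (if even (length v) then xb v + off m A v (nch A v)
                  else xb (butlast v) + off m A (butlast v) (Suc (last v)))"

text \<open>With \<open>n\<close> the position of a white child of \<open>v\<close>, \<open>\<lambda>\<^sup>+\<close> consists of the children at positions from
  \<open>kl\<close> to \<open>n - 1\<close>, and \<open>\<rho>\<^sup>+\<close> of those at positions from \<open>n + 1\<close> to \<open>kr - 1\<close>.\<close>

definition kl :: "(nat \<Rightarrow> nat) \<Rightarrow> (nat list \<Rightarrow> nat) \<Rightarrow> nat list \<Rightarrow> nat \<Rightarrow> nat" where
  "kl \<sigma> lab v n = (LEAST k. \<forall>j. k \<le> j \<and> j < n \<longrightarrow> height \<sigma> (lab (v @ [j])) > height \<sigma> (lab (v @ [n])))"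

definition kr :: "nat list set \<Rightarrow> (nat \<Rightarrow> nat) \<Rightarrow> (nat list \<Rightarrow> nat) \<Rightarrow> nat list \<Rightarrow> nat \<Rightarrow> nat" where
  "kr A \<sigma> lab v n = (LEAST k. n < k \<and> (nch A v \<le> k \<or> \<not> height \<sigma> (lab (v @ [k])) > height \<sigma> (lab (v @ [n]))))"

lemma downward_closed_eq_lessThan:
  fixes K :: "nat set"
  assumes "finite K" "\<And>k. Suc k \<in> K \<Longrightarrow> k \<in> K"
  shows "K = {..<card K}"
proof -
  have down: "k \<in> K" if "k + d \<in> K" for k d
    using that by (induction d) (auto intro: assms(2))
  have "\<exists>n. K = {..<n}"
  proof (cases "K = {}")
    case False
    have "K = {..<Suc (Max K)}"
    proof
      show "K \<subseteq> {..<Suc (Max K)}" using assms(1) by (auto simp: less_Suc_eq_le)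
      show "{..<Suc (Max K)} \<subseteq> K"
      proof
        fix k assume "k \<in> {..<Suc (Max K)}"
        then have "k + (Max K - k) \<in> K" using Max_in[OF assms(1) False] by simp
        then show "k \<in> K" by (rule down)
      qed
    qed
    then show ?thesis by blast
  qed auto
  then show ?thesis by auto
qed

section \<open>Counting in a b/w tree\<close>

context
  fixes m A lab
  assumes tree: "bw_tree m A lab"
begin

lemma tree_finite: "finite A"
  and tree_root: "[] \<in> A"
  and tree_parent: "v @ [k] \<in> A \<Longrightarrow> v \<in> A"
  and tree_black_child: "v \<in> A \<Longrightarrow> even (length v) \<Longrightarrow> v \<noteq> [] \<Longrightarrow> v @ [0] \<in> A"
  and tree_lab: "bij_betw lab (whites A) {1..m}"
  using tree by (auto simp: bw_tree_def blacks_def)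

lemma child_iff: "v @ [k] \<in> A \<longleftrightarrow> k < nch A v"
proof -
  have "finite ((\<lambda>k. v @ [k]) -` A)"
    by (rule finite_vimageI) (auto simp: tree_finite inj_def)
  then have "finite {k. v @ [k] \<in> A}" by (simp add: vimage_def)
  moreover have "\<And>k. Suc k \<in> {k. v @ [k] \<in> A} \<Longrightarrow> k \<in> {k. v @ [k] \<in> A}"
    using tree by (auto simp: bw_tree_def)
  ultimately have "{k. v @ [k] \<in> A} = {..<nch A v}"
    unfolding nch_def by (rule downward_closed_eq_lessThan)
  then show ?thesis by blast
qed

lemma tree_prefix: "v @ w \<in> A \<Longrightarrow> v \<in> A"
proof (induction w rule: rev_induct)
  case (snoc k w)
  then show ?case using tree_parent[of "v @ w" k] by simp
qed simp

text \<open>Counting by prefixes treats both colours alike: the extra one in \<open>alpha\<close> of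
  a white vertex is the vertex itself.\<close>

lemma alpha_eq_card: "v \<in> A \<Longrightarrow> alpha A v = card {u \<in> whites A. prefix v u}"
proof -
  assume v: "v \<in> A"
  have fin: "finite {u \<in> whites A. above u v}" using tree_finite by (simp add: whites_def)
  have "{u \<in> whites A. prefix v u} = {u \<in> whites A. above u v} \<union> (if odd (length v) then {v} else {})"
    using v by (auto simp: above_def prefix_def whites_def)
  moreover have "v \<notin> {u \<in> whites A. above u v}" by (auto simp: above_def)
  ultimately show ?thesis using fin by (simp add: alpha_def)
qed

lemma alpha_black:
  assumes "even (length v)" "v \<in> A"
  shows "alpha A v = (\<Sum>k<nch A v. alpha A (v @ [k]))"
proof -
  have "{u \<in> whites A. prefix v u} = (\<Union>k\<in>{..<nch A v}. {u \<in> whites A. prefix (v @ [k]) u})"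
  proof (intro set_eqI iffI)
    fix u assume u: "u \<in> {u \<in> whites A. prefix v u}"
    then obtain w where w: "u = v @ w" by (auto simp: prefix_def)
    with u assms have "w \<noteq> []" by (auto simp: whites_def)
    then obtain k w' where "w = k # w'" by (cases w) auto
    with u w show "u \<in> (\<Union>k\<in>{..<nch A v}. {u \<in> whites A. prefix (v @ [k]) u})"
      using tree_prefix[of "v @ [k]" w'] child_iff[of v k] by (auto simp: whites_def)
  qed (auto simp: prefix_def)
  moreover have "card (\<Union>k\<in>{..<nch A v}. {u \<in> whites A. prefix (v @ [k]) u})
     = (\<Sum>k<nch A v. card {u \<in> whites A. prefix (v @ [k]) u})"
    by (rule card_UN_disjoint) (auto simp: whites_def tree_finite prefix_def)
  ultimately show ?thesis using assms child_iff by (simp add: alpha_eq_card)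
qed

lemma alpha_root: "alpha A [] = m"
  using bij_betw_same_card[OF tree_lab] by (simp add: alpha_eq_card[OF tree_root])

lemma off_Suc: "off m A v (Suc k) = off m A v k + 2 / real m * real (alpha A (v @ [k]))"
  by (simp add: off_def distrib_left)

lemma off_mono: "k \<le> l \<Longrightarrow> off m A v k \<le> off m A v l"
  unfolding off_def by (intro mult_left_mono sum_mono2) auto

lemma off_0: "off m A v 0 = 0"
  by (simp add: off_def)

lemma off_nch: "v \<in> A \<Longrightarrow> even (length v) \<Longrightarrow> off m A v (nch A v) = 2 / real m * real (alpha A v)"
  by (simp add: off_def alpha_black)

text \<open>Turns the distances that \<open>ov1_cond\<close> measures from the right end into
  offsets from the left end.\<close>

lemma off_upper_sum:
  assumes "k \<le> nch A v"
  shows "2 / real m * (\<Sum>j\<in>{k..<nch A v}. real (alpha A (v @ [j]))) = off m A v (nch A v) - off m A v k"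
proof -
  have "{..<nch A v} = {..<k} \<union> {k..<nch A v}" using assms by auto
  then have "(\<Sum>j<nch A v. real (alpha A (v @ [j])))
    = (\<Sum>j<k. real (alpha A (v @ [j]))) + (\<Sum>j\<in>{k..<nch A v}. real (alpha A (v @ [j])))"
    by (metis finite_atLeastLessThan finite_lessThan ivl_disj_int_one(2) sum.union_disjoint)
  then show ?thesis by (simp add: off_def distrib_left)
qed

lemma kl_le: "kl \<sigma> lab v n \<le> n"
  unfolding kl_def by (rule Least_le) auto

lemma kl_higher:
  assumes "kl \<sigma> lab v n \<le> j" "j < n"
  shows "height \<sigma> (lab (v @ [n])) < height \<sigma> (lab (v @ [j]))"
proof -
  have "\<forall>j. kl \<sigma> lab v n \<le> j \<and> j < n \<longrightarrow> height \<sigma> (lab (v @ [j])) > height \<sigma> (lab (v @ [n]))"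
    unfolding kl_def by (rule LeastI[where k = n]) auto
  with assms show ?thesis by blast
qed

lemma kl_iff:
  assumes "j < n"
  shows "kl \<sigma> lab v n \<le> j \<longleftrightarrow> (\<forall>j'. j \<le> j' \<and> j' < n \<longrightarrow> height \<sigma> (lab (v @ [n])) < height \<sigma> (lab (v @ [j'])))"
proof
  assume "\<forall>j'. j \<le> j' \<and> j' < n \<longrightarrow> height \<sigma> (lab (v @ [n])) < height \<sigma> (lab (v @ [j']))"
  then show "kl \<sigma> lab v n \<le> j" unfolding kl_def by (rule Least_le)
next
  assume "kl \<sigma> lab v n \<le> j"
  then show "\<forall>j'. j \<le> j' \<and> j' < n \<longrightarrow> height \<sigma> (lab (v @ [n])) < height \<sigma> (lab (v @ [j']))"
    by (auto intro: kl_higher)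
qed

lemma lam_eq: "v @ [n] \<in> A \<Longrightarrow> lam A (v @ [n]) = (\<lambda>j. v @ [j]) ` {..<n}"
  by (auto simp: lam_def child_iff)

lemma lam_diff: "v @ [n] \<in> A \<Longrightarrow> lam A (v @ [n]) - lam_plus A lab \<sigma> (v @ [n]) = (\<lambda>j. v @ [j]) ` {..<kl \<sigma> lab v n}"
proof -
  assume v: "v @ [n] \<in> A"
  have "lam_plus A lab \<sigma> (v @ [n]) = (\<lambda>j. v @ [j]) ` {j. j < n \<and> kl \<sigma> lab v n \<le> j}"
  proof -
    have "j < n \<and> height \<sigma> (lab (v @ [j])) > height \<sigma> (lab (v @ [n])) \<and>
      (\<forall>j'. j < j' \<and> j' < n \<longrightarrow> height \<sigma> (lab (v @ [j'])) > height \<sigma> (lab (v @ [n])))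
      \<longleftrightarrow> j < n \<and> kl \<sigma> lab v n \<le> j" for j
      using kl_iff[of j n \<sigma> v] by (cases "j < n") (auto simp: le_eq_less_or_eq)
    then show ?thesis using v by (auto simp: lam_plus_def child_iff intro!: kl_higher)
  qed
  then show ?thesis
    using lam_eq[OF v] kl_le[of \<sigma> v n] by (auto simp: image_iff)
qed

lemma kr_props:
  assumes "v @ [n] \<in> A"
  shows "n < kr A \<sigma> lab v n" "kr A \<sigma> lab v n \<le> nch A v"
    "n < j \<Longrightarrow> j < kr A \<sigma> lab v n \<Longrightarrow> height \<sigma> (lab (v @ [n])) < height \<sigma> (lab (v @ [j]))"
    "kr A \<sigma> lab v n < nch A v \<Longrightarrow> \<not> height \<sigma> (lab (v @ [n])) < height \<sigma> (lab (v @ [kr A \<sigma> lab v n]))"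
proof -
  let ?P = "\<lambda>k. n < k \<and> (nch A v \<le> k \<or> \<not> height \<sigma> (lab (v @ [k])) > height \<sigma> (lab (v @ [n])))"
  have P: "?P (nch A v)" using assms by (simp add: child_iff)
  have *: "?P (kr A \<sigma> lab v n)" unfolding kr_def by (rule LeastI[of ?P, OF P])
  show "n < kr A \<sigma> lab v n" using * by blast
  show le: "kr A \<sigma> lab v n \<le> nch A v" unfolding kr_def by (rule Least_le[of ?P, OF P])
  show "n < j \<Longrightarrow> j < kr A \<sigma> lab v n \<Longrightarrow> height \<sigma> (lab (v @ [n])) < height \<sigma> (lab (v @ [j]))"
    using not_less_Least[of j ?P] unfolding kr_def by blast
  show "kr A \<sigma> lab v n < nch A v \<Longrightarrow> \<not> height \<sigma> (lab (v @ [n])) < height \<sigma> (lab (v @ [kr A \<sigma> lab v n]))"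
    using * by linarith
qed

lemma rho_eq: "v @ [n] \<in> A \<Longrightarrow> rho A (v @ [n]) = (\<lambda>j. v @ [j]) ` {Suc n..<nch A v}"
  by (auto simp: rho_def child_iff)

lemma rho_diff:
  assumes v: "v @ [n] \<in> A"
  shows "rho A (v @ [n]) - rho_plus A lab \<sigma> (v @ [n]) = (\<lambda>j. v @ [j]) ` {kr A \<sigma> lab v n..<nch A v}"
proof -
  note kr = kr_props[OF v, where \<sigma> = \<sigma>]
  have "rho_plus A lab \<sigma> (v @ [n]) = (\<lambda>j. v @ [j]) ` {Suc n..<kr A \<sigma> lab v n}"
  proof -
    have "n < j \<and> j < nch A v \<and> height \<sigma> (lab (v @ [j])) > height \<sigma> (lab (v @ [n])) \<and>
      (\<forall>j'. n < j' \<and> j' < j \<longrightarrow> height \<sigma> (lab (v @ [j'])) > height \<sigma> (lab (v @ [n])))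
      \<longleftrightarrow> n < j \<and> j < kr A \<sigma> lab v n" for j
    proof (intro iffI conjI)
      assume *: "n < j \<and> j < nch A v \<and> height \<sigma> (lab (v @ [j])) > height \<sigma> (lab (v @ [n])) \<and>
        (\<forall>j'. n < j' \<and> j' < j \<longrightarrow> height \<sigma> (lab (v @ [j'])) > height \<sigma> (lab (v @ [n])))"
      then show "n < j" by blast
      show "j < kr A \<sigma> lab v n"
      proof (rule ccontr)
        assume "\<not> j < kr A \<sigma> lab v n"
        then have "kr A \<sigma> lab v n = j \<or> kr A \<sigma> lab v n < j" "kr A \<sigma> lab v n < nch A v" using * by auto
        with * kr(1) kr(4) show False by blast
      qed
    next
      assume "n < j \<and> j < kr A \<sigma> lab v n"
      then show "n < j" "j < nch A v" "height \<sigma> (lab (v @ [n])) < height \<sigma> (lab (v @ [j]))"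
        "\<forall>j'. n < j' \<and> j' < j \<longrightarrow> height \<sigma> (lab (v @ [j'])) > height \<sigma> (lab (v @ [n]))"
        using kr(2) by (auto intro!: kr(3))
    qed
    then show ?thesis by (auto simp: rho_plus_def child_iff)
  qed
  then show ?thesis
    using rho_eq[OF v] kr(1,2) by (auto simp: image_iff)
qed

lemma sum_children: "(\<Sum>j\<in>(\<lambda>j. v @ [j]) ` K. f j) = (\<Sum>j\<in>K. f (v @ [j]))"
  by (subst sum.reindex) (auto simp: inj_on_def)

end

text \<open>The conditions of \<open>ov1_cond\<close> with the right ends of the black intervals eliminated: the interval of a
  black vertex \<open>v\<close> is tiled by the blocks \<open>[lo w, hi w]\<close> of its white children \<open>w\<close>, so its length is forced.\<close>

locale ov1_tree =
  fixes m :: nat and \<sigma> :: "nat \<Rightarrow> nat" and A lab and L :: "nat \<Rightarrow> real \<times> real" and xb :: "nat list \<Rightarrow> real"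
  assumes m1: "1 \<le> m" and tree: "bw_tree m A lab" and comp: "compatible A lab \<sigma>"
    and root: "xb [] = -1"
    and white_fst: "v @ [n] \<in> A \<Longrightarrow> even (length v) \<Longrightarrow>
          xb v + off m A v (kl \<sigma> lab v n) \<le> fst (L (lab (v @ [n]))) \<and>
          fst (L (lab (v @ [n]))) \<le> xb v + off m A v n"
    and white_snd: "v @ [n] \<in> A \<Longrightarrow> even (length v) \<Longrightarrow>
          xb v + off m A v (Suc n) \<le> snd (L (lab (v @ [n]))) \<and>
          snd (L (lab (v @ [n]))) \<le> xb v + off m A v (kr A \<sigma> lab v n)"
    and black_in: "i @ [k] \<in> A \<Longrightarrow> odd (length i) \<Longrightarrow>
          lo m A xb i \<le> lo m A xb (i @ [k]) \<and> hi m A xb (i @ [k]) \<le> hi m A xb i"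
    and black_ord: "i @ [Suc k] \<in> A \<Longrightarrow> odd (length i) \<Longrightarrow>
          hi m A xb (i @ [k]) \<le> lo m A xb (i @ [Suc k])"

lemma odd_length_snocE:
  assumes "odd (length i)" obtains v n where "i = v @ [n]" "even (length v)"
  using assms by (cases i rule: rev_exhaust) auto

text \<open>The body of the quantifier in \<open>ov1_cond\<close>, named so that it can be used one
  vertex at a time.\<close>

definition white_cond where
  "white_cond m \<sigma> A lab L xb yb i \<longleftrightarrow>
    (let v = butlast i;
         a = xb v + 2 / real m * (\<Sum>j\<in>lam A i - lam_plus A lab \<sigma> i. real (alpha A j));
         b = xb v + 2 / real m * (\<Sum>j\<in>lam A i. real (alpha A j));
         c = yb v - 2 / real m * (\<Sum>j\<in>rho A i. real (alpha A j));
         d = yb v - 2 / real m * (\<Sum>j\<in>rho A i - rho_plus A lab \<sigma> i. real (alpha A j))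
     in a \<le> fst (L (lab i)) \<and> fst (L (lab i)) \<le> b \<and>
        c \<le> snd (L (lab i)) \<and> snd (L (lab i)) \<le> d \<and>
        (\<forall>k. i @ [k] \<in> A \<longrightarrow>
           yb (i @ [k]) - xb (i @ [k]) = 2 * real (alpha A (i @ [k])) / real m \<and>
           b \<le> xb (i @ [k]) \<and> yb (i @ [k]) \<le> c \<and>
           (i @ [Suc k] \<in> A \<longrightarrow> yb (i @ [k]) \<le> xb (i @ [Suc k]))))"

lemma ov1_cond_iff:
  "ov1_cond m \<sigma> A lab L \<longleftrightarrow>
    (\<exists>xb yb. xb [] = -1 \<and> yb [] = 1 \<and> (\<forall>i\<in>whites A. white_cond m \<sigma> A lab L xb yb i))"
  unfolding ov1_cond_def white_cond_def ..

lemma ov1_cond_imp_tree: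
  assumes m1: "1 \<le> m" and tree: "bw_tree m A lab" and comp: "compatible A lab \<sigma>"
    and cond: "ov1_cond m \<sigma> A lab L"
  shows "\<exists>xb. ov1_tree m \<sigma> A lab L xb"
proof -
  obtain xb yb where root: "xb [] = -1" "yb [] = 1" and
    C0: "\<And>i. i \<in> whites A \<Longrightarrow> white_cond m \<sigma> A lab L xb yb i"
    using cond by (auto simp: ov1_cond_iff)
  have C: "white_cond m \<sigma> A lab L xb yb (v @ [n])" if "v @ [n] \<in> A" "even (length v)" for v n
    using that by (intro C0) (simp add: whites_def)
  \<comment> \<open>At the root the forced length is \<open>2 * alpha / m = 2\<close>, which is the
    length of \<open>[-1, 1]\<close>.\<close>
  have yb: "yb v = xb v + off m A v (nch A v)" if v: "v \<in> A" "even (length v)" for v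
  proof (cases v rule: rev_exhaust)
    case Nil
    then show ?thesis using off_nch[OF tree v] alpha_root[OF tree] root m1 by simp
  next
    case (snoc i k)
    with v obtain w n where i: "i = w @ [n]" "even (length w)"
      by (metis even_Suc length_append_singleton odd_length_snocE)
    have "w @ [n] \<in> A" using v(1) snoc i tree_parent[OF tree] by metis
    from C[OF this i(2)] v(1) snoc i
    have "yb v - xb v = 2 * real (alpha A v) / real m" by (simp add: white_cond_def Let_def)
    then show ?thesis using off_nch[OF tree v] by simp
  qed
  have v_in: "v \<in> A" if "v @ [n] \<in> A" for v n using that tree_parent[OF tree] by blast
  have C': "xb v + off m A v (kl \<sigma> lab v n) \<le> fst (L (lab (v @ [n]))) \<and>
     fst (L (lab (v @ [n]))) \<le> xb v + off m A v n \<and>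
     xb v + off m A v (Suc n) \<le> snd (L (lab (v @ [n]))) \<and>
     snd (L (lab (v @ [n]))) \<le> xb v + off m A v (kr A \<sigma> lab v n) \<and>
     (\<forall>k. (v@[n]) @ [k] \<in> A \<longrightarrow>
         xb v + off m A v n \<le> xb ((v@[n]) @ [k]) \<and> yb ((v@[n]) @ [k]) \<le> xb v + off m A v (Suc n) \<and>
         ((v@[n]) @ [Suc k] \<in> A \<longrightarrow> yb ((v@[n]) @ [k]) \<le> xb ((v@[n]) @ [Suc k])))"
    if v: "v @ [n] \<in> A" "even (length v)" for v n
  proof -
    have n: "Suc n \<le> nch A v" using child_iff[OF tree] v by auto
    note kr = kr_props[OF tree v(1), where \<sigma> = \<sigma>]
    from C[OF v] show ?thesis
      unfolding white_cond_def Let_def butlast_snoc lam_diff[OF tree v(1)] rho_diff[OF tree v(1)]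
      unfolding lam_eq[OF tree v(1)] rho_eq[OF tree v(1)]
        sum_children[OF tree] off_upper_sum[OF tree n] off_upper_sum[OF tree kr(2)]
        yb[OF v_in[OF v(1)] v(2)] off_def[symmetric]
      by auto
  qed
  have "ov1_tree m \<sigma> A lab L xb"
  proof
    fix i k assume a: "i @ [k] \<in> A" "odd (length i)"
    then obtain v n where i: "i = v @ [n]" "even (length v)" using odd_length_snocE by blast
    with a tree_parent[OF tree] have vn: "v @ [n] \<in> A" by metis
    show "lo m A xb i \<le> lo m A xb (i @ [k]) \<and> hi m A xb (i @ [k]) \<le> hi m A xb i"
      using C'[OF vn i(2)] yb[of "i @ [k]"] a i by (auto simp: lo_def hi_def)
  next
    fix i k assume a: "i @ [Suc k] \<in> A" "odd (length i)"
    then obtain v n where i: "i = v @ [n]" "even (length v)" using odd_length_snocE by blast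
    with a tree_parent[OF tree] have vn: "v @ [n] \<in> A" by metis
    have "i @ [k] \<in> A" using a child_iff[OF tree] by auto
    then show "hi m A xb (i @ [k]) \<le> lo m A xb (i @ [Suc k])"
      using C'[OF vn i(2)] yb[of "i @ [k]"] a i by (auto simp: lo_def hi_def)
  qed (use m1 tree comp root C' in auto)
  then show ?thesis by blast
qed

section \<open>The nested intervals of a tree and the label seen over a point\<close>

context ov1_tree
begin

abbreviation "l \<equiv> lo m A xb"
abbreviation "h \<equiv> hi m A xb"

text \<open>The way back to \<open>Ov1\<close>: the right ends of the black intervals are recovered
  from the tiling.\<close>

lemma ov1_cond: "ov1_cond m \<sigma> A lab L"
  unfolding ov1_cond_iff
proof (rule exI[of _ xb], rule exI[of _ "\<lambda>v. xb v + off m A v (nch A v)"], intro conjI ballI)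
  show "xb [] = -1" by (rule root)
  show "xb [] + off m A [] (nch A []) = 1"
    using off_nch[OF tree tree_root[OF tree]] alpha_root[OF tree] root m1 by simp
next
  fix i assume "i \<in> whites A"
  then obtain v n where i: "i = v @ [n]" "even (length v)" "v @ [n] \<in> A"
    by (auto simp: whites_def elim: odd_length_snocE)
  have v: "v \<in> A" using i tree_parent[OF tree] by blast
  have n: "Suc n \<le> nch A v" using child_iff[OF tree] i by auto
  note kr = kr_props[OF tree i(3), where \<sigma> = \<sigma>]
  have odd: "odd (length (v @ [n]))" using i by simp
  have B: "xb v + off m A v n \<le> xb ((v@[n]) @ [k]) \<and>
      xb ((v@[n]) @ [k]) + off m A ((v@[n]) @ [k]) (nch A ((v@[n]) @ [k])) \<le> xb v + off m A v (Suc n)"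
    if "(v @ [n]) @ [k] \<in> A" for k
    using black_in[OF that odd] i by (simp add: lo_def hi_def)
  have B': "xb ((v@[n]) @ [k]) + off m A ((v@[n]) @ [k]) (nch A ((v@[n]) @ [k])) \<le> xb ((v@[n]) @ [Suc k])"
    if "(v @ [n]) @ [k] \<in> A" "(v @ [n]) @ [Suc k] \<in> A" for k
    using black_ord[OF that(2) odd] i by (simp add: lo_def hi_def)
  have D: "off m A ((v@[n]) @ [k]) (nch A ((v@[n]) @ [k])) = 2 * real (alpha A ((v@[n]) @ [k])) / real m"
    if "(v @ [n]) @ [k] \<in> A" for k
    using off_nch[OF tree that] i by simp
  show "white_cond m \<sigma> A lab L xb (\<lambda>v. xb v + off m A v (nch A v)) i"
    unfolding white_cond_def Let_def i(1) butlast_snoc lam_diff[OF tree i(3)] rho_diff[OF tree i(3)]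
    unfolding lam_eq[OF tree i(3)] rho_eq[OF tree i(3)]
        sum_children[OF tree] off_upper_sum[OF tree n] off_upper_sum[OF tree kr(2)]
        off_def[symmetric]
    using white_fst[OF i(3,2)] white_snd[OF i(3,2)] B B'
    by (simp del: append_assoc add: D)
qed

lemma parent: "v @ [k] \<in> A \<Longrightarrow> v \<in> A"
  by (rule tree_parent[OF tree])

lemma hi_lo: "v \<in> A \<Longrightarrow> h v = l v + 2 / real m * real (alpha A v)"
  by (cases v rule: rev_exhaust)
     (auto simp: lo_def hi_def off_Suc[OF tree] off_nch[OF tree] off_0[OF tree])

lemma lo_le_hi: "v \<in> A \<Longrightarrow> l v \<le> h v"
  by (simp add: hi_lo)

lemma child_in: "v @ [k] \<in> A \<Longrightarrow> l v \<le> l (v @ [k]) \<and> h (v @ [k]) \<le> h v"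
proof (cases "even (length v)")
  case True
  assume "v @ [k] \<in> A"
  then have "Suc k \<le> nch A v" using child_iff[OF tree] by auto
  then show ?thesis
    using True off_mono[OF tree, of 0 k v] off_mono[OF tree, of "Suc k" "nch A v" v]
    by (simp add: lo_def hi_def off_0[OF tree])
qed (use black_in in auto)

lemma sibling_ord:
  assumes "v @ [k'] \<in> A" "k < k'"
  shows "h (v @ [k]) \<le> l (v @ [k'])"
proof (cases "even (length v)")
  case True
  then show ?thesis using off_mono[OF tree, of "Suc k" k' v] assms by (simp add: lo_def hi_def)
next
  case False
  show ?thesis using assms(2,1)
  proof (induction k' rule: less_Suc_induct)
    case (1 i)
    then show ?case using black_ord False by blast
  next
    case (2 i j k)
    have j: "v @ [j] \<in> A" using 2 child_iff[OF tree] by auto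
    show ?case using 2(3)[OF j] 2(4)[OF 2(5)] lo_le_hi[OF j] by linarith
  qed
qed

lemma prefix_in: "u \<in> A \<Longrightarrow> prefix v u \<Longrightarrow> v \<in> A \<and> l v \<le> l u \<and> h u \<le> h v"
proof (induction u rule: rev_induct)
  case (snoc k u)
  show ?case
  proof (cases "v = u @ [k]")
    case False
    then have "prefix v u" using snoc.prems by simp
    then show ?thesis using snoc parent child_in by fastforce
  qed (use snoc in auto)
qed auto

text \<open>Together with \<open>prefix_in\<close> this makes the intervals a laminar family:
  incomparable addresses part at two children of a common vertex, and these are ordered along the
  line.\<close>

lemma parallel_ord:
  assumes "u \<in> A" "w \<in> A" "\<not> prefix u w" "\<not> prefix w u"
  shows "h u \<le> l w \<or> h w \<le> l u"
proof -
  have "u \<parallel> w" using assms by (auto simp: parallel_def)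
  then obtain as b bs c cs where d: "b \<noteq> c" "u = as @ b # bs" "w = as @ c # cs"
    using parallel_decomp by blast
  have u: "prefix (as @ [b]) u" and w: "prefix (as @ [c]) w" using d by (auto simp: prefix_def)
  from prefix_in[OF assms(1) u] prefix_in[OF assms(2) w] d(1)
    sibling_ord[of as b c] sibling_ord[of as c b]
  show ?thesis by (metis linorder_less_linear order_trans)
qed

definition crit :: "real set" where "crit = l ` A \<union> h ` A"

lemma finite_crit: "finite crit"
  using tree_finite[OF tree] by (simp add: crit_def)

lemma root_interval: "l [] = -1" "h [] = 1"
  using hi_lo[OF tree_root[OF tree]] root alpha_root[OF tree] m1 by (simp_all add: lo_def)

lemma off_locate:
  assumes "0 \<le> x" "x < off m A v N"
  shows "\<exists>k<N. off m A v k \<le> x \<and> x < off m A v (Suc k)"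
  using assms
proof (induction N)
  case 0 then show ?case by (simp add: off_0[OF tree])
next
  case (Suc N)
  then show ?case by (cases "x < off m A v N") (auto intro: less_SucI)
qed

text \<open>A deepest vertex whose interval contains \<open>z\<close> is white, because the blocks
  of its children tile the interval of a black vertex and \<open>z\<close> is on no block boundary.
  By \<open>parallel_ord\<close> all other vertices around \<open>z\<close> lie on the path to
  it.\<close>

lemma locate:
  assumes z: "-1 < z" "z < 1" "z \<notin> crit"
  obtains i where "i \<in> whites A" "\<And>v. v \<in> A \<Longrightarrow> l v < z \<and> z < h v \<longleftrightarrow> prefix v i"
proof -
  define S where "S = {v \<in> A. l v < z \<and> z < h v}"
  have fin: "finite S" using tree_finite[OF tree] by (simp add: S_def)
  have "[] \<in> S" using z tree_root[OF tree] root_interval by (simp add: S_def)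
  then have "Max (length ` S) \<in> length ` S" using fin by (intro Max_in) auto
  then obtain i where i: "i \<in> S" and "length i = Max (length ` S)" by auto
  then have mx: "length v \<le> length i" if "v \<in> S" for v using that fin by simp
  have iA: "i \<in> A" "l i < z" "z < h i" using i by (auto simp: S_def)
  have "odd (length i)"
  proof (rule ccontr)
    assume "\<not> odd (length i)"
    then have ev: "even (length i)" by simp
    obtain k where k: "k < nch A i" "off m A i k \<le> z - xb i" "z - xb i < off m A i (Suc k)"
      using off_locate[of "z - xb i" i "nch A i"] iA ev by (auto simp: lo_def hi_def)
    have kA: "i @ [k] \<in> A" using k child_iff[OF tree] by blast
    have "z \<noteq> l (i @ [k])" using z kA by (auto simp: crit_def)
    then have "i @ [k] \<in> S" using k kA ev by (auto simp: S_def lo_def hi_def)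
    from mx[OF this] show False by simp
  qed
  then have iw: "i \<in> whites A" using iA by (simp add: whites_def)
  have "l v < z \<and> z < h v \<longleftrightarrow> prefix v i" if v: "v \<in> A" for v
  proof
    assume "prefix v i"
    from prefix_in[OF iA(1) this] iA show "l v < z \<and> z < h v" by auto
  next
    assume vz: "l v < z \<and> z < h v"
    then have "v \<in> S" using v by (simp add: S_def)
    have "prefix v i \<or> prefix i v" using parallel_ord[OF v iA(1)] vz iA by force
    moreover have "length v \<le> length i" using mx \<open>v \<in> S\<close> by blast
    ultimately show "prefix v i" by (auto simp: prefix_def)
  qed
  with iw show thesis using that by blast
qed

lemma prefix_height:
  assumes "u \<in> whites A" "i \<in> whites A" "prefix u i"
  shows "height \<sigma> (lab u) \<le> height \<sigma> (lab i)"
proof (cases "u = i")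
  case False
  then have "above i u" using assms by (auto simp: above_def prefix_def)
  then show ?thesis using comp assms by (auto simp: compatible_def intro: less_imp_le)
qed simp

text \<open>An interval over \<open>z\<close> belongs to a white vertex \<open>w\<close> whose parent lies on the path to \<open>i\<close>.  Either \<open>w\<close> itself is on
  that path, and compatibility applies, or the interval reaches over the block of a sibling on the
  path, which is then in \<open>\<lambda>\<^sup>+\<close> or \<open>\<rho>\<^sup>+\<close> of \<open>w\<close>.\<close>

lemma locate_vis:
  assumes z: "z \<notin> crit" and i: "i \<in> whites A" "\<And>v. v \<in> A \<Longrightarrow> l v < z \<and> z < h v \<longleftrightarrow> prefix v i"
  shows "visible m (L, \<sigma>) (lab i) z"
  unfolding visible_def fst_conv snd_conv
proof (intro conjI ballI impI)
  show "lab i \<in> {1..m}" using tree_lab[OF tree] i bij_betwE by metis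
  obtain v n where v: "i = v @ [n]" "even (length v)" "v @ [n] \<in> A"
    using i by (auto simp: whites_def elim: odd_length_snocE)
  have "l i < z \<and> z < h i" using i by (simp add: whites_def)
  then show "z \<in> {fst (L (lab i))..snd (L (lab i))}"
    using white_fst[OF v(3,2)] white_snd[OF v(3,2)] v by (auto simp: lo_def hi_def)
next
  fix j assume j: "j \<in> {1..m}" and zj: "z \<in> {fst (L j)..snd (L j)}"
  have "j \<in> lab ` whites A" using j tree_lab[OF tree] by (simp add: bij_betw_def)
  then obtain w where w: "w \<in> whites A" "j = lab w" by blast
  obtain p n where p: "w = p @ [n]" "even (length p)" "p @ [n] \<in> A"
    using w by (auto simp: whites_def elim: odd_length_snocE)
  have pA: "p \<in> A" using p parent by blast
  have zin: "xb p + off m A p (kl \<sigma> lab p n) \<le> z" "z \<le> xb p + off m A p (kr A \<sigma> lab p n)"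
    using zj white_fst[OF p(3,2)] white_snd[OF p(3,2)] w p by auto
  note kr = kr_props[OF tree p(3), where \<sigma> = \<sigma>]
  have "l p \<le> z" "z \<le> h p"
    using zin off_mono[OF tree, of 0 "kl \<sigma> lab p n" p] off_mono[OF tree kr(2), of p] p
    by (auto simp: lo_def hi_def off_0[OF tree])
  moreover have "z \<noteq> l p" "z \<noteq> h p" using z pA by (auto simp: crit_def)
  ultimately have "prefix p i" using i(2)[OF pA] by auto
  then obtain r where r: "i = p @ r" by (auto simp: prefix_def)
  moreover have "r \<noteq> []" using i r p by (auto simp: whites_def)
  ultimately obtain k rs where k: "i = (p @ [k]) @ rs" by (cases r) auto
  have u: "prefix (p @ [k]) i" using k by (auto simp: prefix_def)
  have uA: "p @ [k] \<in> A" using tree_prefix[OF tree] k i by (auto simp: whites_def)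
  have uw: "p @ [k] \<in> whites A" using uA p by (simp add: whites_def)
  have zu: "xb p + off m A p k < z" "z < xb p + off m A p (Suc k)"
    using i(2)[OF uA] u p by (auto simp: lo_def hi_def)
  have "height \<sigma> j \<le> height \<sigma> (lab (p @ [k]))"
  proof (rule linorder_cases[of k n])
    assume "k < n"
    have "kl \<sigma> lab p n \<le> k"
    proof (rule ccontr)
      assume "\<not> kl \<sigma> lab p n \<le> k"
      then have "off m A p (Suc k) \<le> off m A p (kl \<sigma> lab p n)" by (intro off_mono[OF tree]) auto
      with zin zu show False by linarith
    qed
    from kl_higher[OF tree this \<open>k < n\<close>] show ?thesis using w p by simp
  next
    assume "n < k"
    have "k < kr A \<sigma> lab p n"
    proof (rule ccontr)
      assume "\<not> k < kr A \<sigma> lab p n"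
      then have "off m A p (kr A \<sigma> lab p n) \<le> off m A p k" by (intro off_mono[OF tree]) auto
      with zin zu show False by linarith
    qed
    from kr(3)[OF \<open>n < k\<close> this] show ?thesis using w p by simp
  qed (use w p in simp)
  also have "\<dots> \<le> height \<sigma> (lab i)" by (rule prefix_height[OF uw i(1) u])
  finally show "height \<sigma> j \<le> height \<sigma> (lab i)" .
qed

text \<open>The block of the first child of the root starts at -1 and that of the last child ends at
  1; their little intervals contain these blocks.\<close>

lemma m_ge_fst_root: "\<exists>i\<in>{1..m}. fst (L i) \<le> -1" "\<exists>i\<in>{1..m}. 1 \<le> snd (L i)"
proof -
  have "off m A [] (nch A []) = 2"
    using off_nch[OF tree tree_root[OF tree]] alpha_root[OF tree] m1 by simp
  then have N: "0 < nch A []" by (auto intro!: gr0I simp: off_0[OF tree])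
  have a: "[] @ [0] \<in> A" "[] @ [nch A [] - 1] \<in> A"
    using N by (simp_all add: child_iff[OF tree] del: append_Nil)
  have lab: "lab ([] @ [0]) \<in> {1..m}" "lab ([] @ [nch A [] - 1]) \<in> {1..m}"
    using a tree_lab[OF tree] by (auto simp: whites_def bij_betw_def)
  have "fst (L (lab ([] @ [0]))) \<le> -1"
    using white_fst[OF a(1)] root by (auto simp: off_0[OF tree])
  then show "\<exists>i\<in>{1..m}. fst (L i) \<le> -1" using lab by blast
  have "1 \<le> snd (L (lab ([] @ [nch A [] - 1])))"
    using white_snd[OF a(2)] root N \<open>off m A [] (nch A []) = 2\<close> by auto
  then show "\<exists>i\<in>{1..m}. 1 \<le> snd (L i)" using lab by blast
qed

end

section \<open>Segments between consecutive endpoints\<close>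

definition en :: "real set \<Rightarrow> nat \<Rightarrow> real" where
  "en E k = sorted_list_of_set E ! k"

lemma en_less: "finite E \<Longrightarrow> i < j \<Longrightarrow> j < card E \<Longrightarrow> en E i < en E j"
  unfolding en_def
  using sorted_wrt_nth_less[OF strict_sorted_list_of_set[of E]] by simp

lemma en_mono: "finite E \<Longrightarrow> i \<le> j \<Longrightarrow> j < card E \<Longrightarrow> en E i \<le> en E j"
  using en_less[of E i j] by (cases "i = j") auto

lemma en_image: "finite E \<Longrightarrow> en E ` {..<card E} = E"
  unfolding en_def using set_conv_nth[of "sorted_list_of_set E"] by (auto simp: image_iff)

lemma en_in: "finite E \<Longrightarrow> k < card E \<Longrightarrow> en E k \<in> E"
  using en_image by blast

lemma en_obtain:
  assumes "finite E" "x \<in> E" obtains k where "k < card E" "x = en E k"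
  using en_image[OF assms(1)] assms(2) by auto

lemma en_gap:
  assumes "finite E" "x \<in> E" "Suc k < card E"
  shows "x \<le> en E k \<or> en E (Suc k) \<le> x"
proof -
  obtain j where "j < card E" "x = en E j" using en_obtain assms by metis
  then show ?thesis using en_mono[OF assms(1), of j k] en_mono[OF assms(1), of "Suc k" j] assms(3)
    by (cases "j \<le> k") auto
qed

lemma en_locate:
  assumes E: "finite E" "a \<in> E" "b \<in> E" and z: "a < z" "z < b" "z \<notin> E"
  obtains k where "Suc k < card E" "en E k < z" "z < en E (Suc k)"
proof -
  obtain i where i: "i < card E" "a = en E i" using en_obtain E by metis
  obtain j where j: "j < card E" "b = en E j" using en_obtain E by metis
  define K where "K = {k. k < card E \<and> en E k < z}"
  have Kiff: "k \<in> K \<longleftrightarrow> k < card E \<and> en E k < z" for k by (simp add: K_def)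
  have "finite K" "i \<in> K" using i z by (auto simp: K_def)
  then have M: "Max K \<in> K" "\<And>k. k \<in> K \<Longrightarrow> k \<le> Max K" using Max_in by auto
  have "Max K < j"
  proof (rule ccontr)
    assume "\<not> Max K < j"
    then have "b \<le> en E (Max K)" using en_mono[OF E(1), of j "Max K"] M j by (auto simp: Kiff)
    then show False using M z by (auto simp: Kiff)
  qed
  then have s: "Suc (Max K) < card E"
    using j by simp
  moreover have "\<not> en E (Suc (Max K)) < z" using M(2)[of "Suc (Max K)"] s by (auto simp: Kiff)
  moreover have "en E (Suc (Max K)) \<noteq> z" using en_in[OF E(1) s] z by auto
  ultimately show thesis using that[of "Max K"] M(1) by (auto simp: Kiff)
qed

lemma en_unique:
  assumes "\<And>i j. i < j \<Longrightarrow> j < N \<Longrightarrow> f i < f j" "f ` {..<N} = E"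
  shows "card E = N" "k < N \<Longrightarrow> en E k = (f k :: real)"
proof -
  have "sorted_wrt (<) (map f [0..<N])"
    using assms(1) by (auto simp: sorted_wrt_iff_nth_less)
  then have "sorted_list_of_set (set (map f [0..<N])) = map f [0..<N]"
    by (rule sorted_list_of_set.idem_if_sorted_distinct[OF strict_sorted_imp_sorted])
       (use assms(1) in \<open>auto simp: distinct_map inj_on_def, metis linorder_neqE_nat less_irrefl\<close>)
  moreover have "set (map f [0..<N]) = E" using assms(2) by (simp add: atLeast0LessThan)
  ultimately have *: "sorted_list_of_set E = map f [0..<N]" by simp
  then have "length (sorted_list_of_set E) = N" by simp
  then show "card E = N" by simp
  show "k < N \<Longrightarrow> en E k = f k" by (simp add: en_def *)
qed

lemma avoid_finite:
  assumes "finite S" "(a::real) < b"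
  obtains z where "a < z" "z < b" "z \<notin> S"
proof -
  have "infinite ({a<..<b} - S)" using assms by (simp add: infinite_Ioo)
  then obtain z where "z \<in> {a<..<b} - S" by (metis finite.emptyI ex_in_conv)
  then show thesis using that by auto
qed

text \<open>Endpoints are named by a label and a side (\<open>True\<close> for the right end), so
  that the endpoint orders of different configurations can be compared on one fixed index
  set.\<close>

definition coord :: "(nat \<Rightarrow> real \<times> real) \<Rightarrow> nat \<times> bool \<Rightarrow> real" where
  "coord L a = (if snd a then snd (L (fst a)) else fst (L (fst a)))"

text \<open>As this is a set, coinciding endpoints count once; its cardinality drops when a segment
  collapses.\<close>

definition ends :: "nat \<Rightarrow> (nat \<Rightarrow> real \<times> real) \<Rightarrow> real set" where
  "ends m L = coord L ` ({1..m} \<times> UNIV)"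

lemma finite_ends: "finite (ends m L)"
  by (simp add: ends_def)

lemma ends_I: "i \<in> {1..m} \<Longrightarrow> fst (L i) \<in> ends m L" "i \<in> {1..m} \<Longrightarrow> snd (L i) \<in> ends m L"
proof -
  assume i: "i \<in> {1..m}"
  have "coord L (i, False) \<in> ends m L" "coord L (i, True) \<in> ends m L"
    using i by (auto simp: ends_def)
  then show "fst (L i) \<in> ends m L" "snd (L i) \<in> ends m L" by (auto simp: coord_def)
qed

abbreviation nE :: "nat \<Rightarrow> (nat \<Rightarrow> real \<times> real) \<Rightarrow> nat" where
  "nE m L \<equiv> card (ends m L)"

abbreviation endpt :: "nat \<Rightarrow> (nat \<Rightarrow> real \<times> real) \<Rightarrow> nat \<Rightarrow> real" where
  "endpt m L \<equiv> en (ends m L)"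

definition mid :: "nat \<Rightarrow> (nat \<Rightarrow> real \<times> real) \<Rightarrow> nat \<Rightarrow> real" where
  "mid m L k = (endpt m L k + endpt m L (Suc k)) / 2"

text \<open>The midpoint is a sample point: visibility does not change inside a segment
  (\<open>vis_cong\<close>).\<close>

definition segs :: "nat \<Rightarrow> ((nat \<Rightarrow> real \<times> real) \<times> (nat \<Rightarrow> nat)) \<Rightarrow> nat \<Rightarrow> nat set" where
  "segs m c i = {k. Suc k < nE m (fst c) \<and> visible m c i (mid m (fst c) k)}"

text \<open>What remains of membership in \<open>Ov1\<close> when the tree is forgotten: every point
  is covered, all lobes have the same length, and no two labels cross. Points of \<open>ends\<close>
  are left out because visibility there depends on the representative.\<close>

definition normal :: "nat \<Rightarrow> ((nat \<Rightarrow> real \<times> real) \<times> (nat \<Rightarrow> nat)) \<Rightarrow> bool" where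
  "normal m c \<longleftrightarrow> 1 \<le> m \<and> c \<in> conf m \<and> -1 \<in> ends m (fst c) \<and> 1 \<in> ends m (fst c) \<and>
     (\<forall>z. -1 < z \<and> z < 1 \<and> z \<notin> ends m (fst c) \<longrightarrow> (\<exists>i. visible m c i z)) \<and>
     (\<forall>i\<in>{1..m}. (\<Sum>k\<in>segs m c i. endpt m (fst c) (Suc k) - endpt m (fst c) k) = 2 / real m) \<and>
     (\<forall>i j z1 z2 z3 z4. z1 < z2 \<and> z2 < z3 \<and> z3 < z4 \<and> {z1, z2, z3, z4} \<inter> ends m (fst c) = {} \<and>
        visible m c i z1 \<and> visible m c j z2 \<and> visible m c i z3 \<and> visible m c j z4 \<longrightarrow> i = j)"

lemma conf_bounds:
  assumes "c \<in> conf m" "i \<in> {1..m}"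
  shows "-1 \<le> fst (fst c i)" "fst (fst c i) < snd (fst c i)" "snd (fst c i) \<le> 1"
  using assms by (auto simp: conf_def little_intervals_def)

lemma vis_unique:
  assumes "c \<in> conf m" "visible m c i z" "visible m c j z"
  shows "i = j"
proof -
  have "snd c permutes {1..m}" using assms(1) by (auto simp: conf_def perms_def)
  then have "bij (inv (snd c))" by (intro bij_imp_bij_inv permutes_bij)
  moreover have "height (snd c) i = height (snd c) j" using assms(2,3) by (auto simp: visible_def intro!: antisym)
  ultimately show ?thesis by (auto simp: height_def bij_def inj_def)
qed

lemma seg_mem:
  assumes "Suc k < nE m L" "endpt m L k < z" "z < endpt m L (Suc k)" "j \<in> {1..m}"
  shows "z \<in> {fst (L j)..snd (L j)} \<longleftrightarrow> fst (L j) \<le> endpt m L k \<and> endpt m L (Suc k) \<le> snd (L j)"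
  using en_gap[OF finite_ends ends_I(1)[OF assms(4), of L] assms(1)]
    en_gap[OF finite_ends ends_I(2)[OF assms(4), of L] assms(1)] assms(2,3) by auto

lemma seg_not_end:
  assumes "Suc k < nE m L" "endpt m L k < z" "z < endpt m L (Suc k)"
  shows "z \<notin> ends m L"
  using en_gap[OF finite_ends _ assms(1), of z] assms(2,3) by auto

lemma vis_cong:
  assumes "Suc k < nE m (fst c)" "endpt m (fst c) k < z" "z < endpt m (fst c) (Suc k)"
    "endpt m (fst c) k < z'" "z' < endpt m (fst c) (Suc k)"
  shows "visible m c i z \<longleftrightarrow> visible m c i z'"
  using seg_mem[OF assms(1-3)] seg_mem[OF assms(1,4,5)] unfolding visible_def by blast

lemma mid_between:
  assumes "Suc k < nE m L" shows "endpt m L k < mid m L k" "mid m L k < endpt m L (Suc k)"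
  using en_less[OF finite_ends, of k "Suc k" m L] assms by (auto simp: mid_def)

lemma vis_segs:
  assumes "Suc k < nE m (fst c)" "endpt m (fst c) k < z" "z < endpt m (fst c) (Suc k)"
  shows "visible m c i z \<longleftrightarrow> k \<in> segs m c i"
  using vis_cong[OF assms mid_between[OF assms(1)]] assms(1) by (simp add: segs_def)

lemma segs_disjoint: "c \<in> conf m \<Longrightarrow> i \<noteq> j \<Longrightarrow> segs m c i \<inter> segs m c j = {}"
  using vis_unique[of c m i _ j] by (auto simp: segs_def)

lemma finite_segs: "finite (segs m c i)"
  by (rule finite_subset[of _ "{..<nE m (fst c)}"]) (auto simp: segs_def)

lemma segs_index: "k \<in> segs m c i \<Longrightarrow> Suc k < nE m (fst c) \<and> i \<in> {1..m}"
  by (auto simp: segs_def visible_def)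

text \<open>The deformation of the line that gives the \<open>k\<close>-th segment the length \<open>t k\<close>.  It is only evaluated at points
  of \<open>E\<close>, so a step function does instead of a piecewise linear one.\<close>

definition push :: "real set \<Rightarrow> (nat \<Rightarrow> real) \<Rightarrow> real \<Rightarrow> real" where
  "push E t z = -1 + (\<Sum>k\<in>{k. Suc k < card E \<and> en E (Suc k) \<le> z}. t k)"

lemma finite_push_idx: "finite {k. Suc k < n \<and> P k}"
  by (rule finite_subset[of _ "{..<n}"]) auto

lemma push_diff:
  assumes "x \<le> y"
  shows "push E t y - push E t x = (\<Sum>k\<in>{k. Suc k < card E \<and> x < en E (Suc k) \<and> en E (Suc k) \<le> y}. t k)"
proof -
  have "{k. Suc k < card E \<and> en E (Suc k) \<le> y}
    = {k. Suc k < card E \<and> en E (Suc k) \<le> x} \<union> {k. Suc k < card E \<and> x < en E (Suc k) \<and> en E (Suc k) \<le> y}"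
    using assms by auto
  then show ?thesis unfolding push_def
    by (simp add: sum.union_disjoint finite_push_idx disjoint_iff)
qed

lemma push_mono:
  assumes "\<And>k. Suc k < card E \<Longrightarrow> 0 \<le> t k" "x \<le> y"
  shows "push E t x \<le> push E t y"
proof -
  have "0 \<le> push E t y - push E t x"
    unfolding push_diff[OF assms(2)] using assms(1) by (intro sum_nonneg) auto
  then show ?thesis by simp
qed

lemma push_en:
  assumes "finite E" "k < card E"
  shows "push E t (en E k) = -1 + (\<Sum>j<k. t j)"
proof -
  have "{j. Suc j < card E \<and> en E (Suc j) \<le> en E k} = {..<k}"
    using assms en_less[OF assms(1), of k] en_mono[OF assms(1), of _ k]
    by (force simp: not_le[symmetric] Suc_le_eq)
  then show ?thesis by (simp add: push_def)
qed

text \<open>With the lengths that the segments already have, nothing moves;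
  \<open>push_vertex\<close> then computes the actual length of a vertex interval.\<close>

lemma push_id:
  assumes "finite E" "x \<in> E" "en E 0 = -1"
  shows "push E (\<lambda>k. en E (Suc k) - en E k) x = x"
proof -
  obtain k where k: "k < card E" "x = en E k" using en_obtain assms by metis
  show ?thesis using assms(3) k(1) by (simp add: k(2) push_en[OF assms(1)] sum_lessThan_telescope)
qed

lemma en_0:
  assumes "finite E" "x \<in> E" "\<And>y. y \<in> E \<Longrightarrow> x \<le> y"
  shows "en E 0 = x"
proof -
  obtain k where k: "k < card E" "x = en E k" using en_obtain assms by metis
  then have "en E 0 \<le> x" using en_mono[OF assms(1), of 0 k] by simp
  moreover have "x \<le> en E 0" using k by (intro assms(3) en_in[OF assms(1)]) auto
  ultimately show ?thesis by simp
qed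

lemma en_last:
  assumes "finite E" "x \<in> E" "\<And>y. y \<in> E \<Longrightarrow> y \<le> x"
  shows "en E (card E - 1) = x"
proof -
  obtain k where k: "k < card E" "x = en E k" using en_obtain assms by metis
  then have "x \<le> en E (card E - 1)" using en_mono[OF assms(1), of k "card E - 1"] by simp
  moreover have "en E (card E - 1) \<le> x" using k by (intro assms(3) en_in[OF assms(1)]) auto
  ultimately show ?thesis by simp
qed

definition moved :: "nat \<Rightarrow> (nat \<Rightarrow> real \<times> real) \<Rightarrow> (nat \<Rightarrow> real) \<Rightarrow> nat \<Rightarrow> real \<times> real" where
  "moved m L t = (\<lambda>i\<in>{1..m}. (push (ends m L) t (fst (L i)), push (ends m L) t (snd (L i))))"

lemma ends_ge: "c \<in> conf m \<Longrightarrow> y \<in> ends m (fst c) \<Longrightarrow> -1 \<le> y \<and> y \<le> 1"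
  using conf_bounds[of c m] by (fastforce simp: ends_def coord_def split: if_splits)

section \<open>Configurations with a tree are normal\<close>

locale ov1_conf = ov1_tree +
  assumes conf: "(L, \<sigma>) \<in> conf m"
begin

abbreviation "E \<equiv> ends m L"

lemma E_ends: "-1 \<in> E" "1 \<in> E"
proof -
  obtain i where i: "i \<in> {1..m}" "fst (L i) \<le> -1" using m_ge_fst_root by blast
  then have "fst (L i) = -1" using conf_bounds(1)[OF conf i(1)] by simp
  then show "-1 \<in> E" using ends_I(1)[OF i(1), of L] by simp
  obtain i where i: "i \<in> {1..m}" "1 \<le> snd (L i)" using m_ge_fst_root by blast
  then have "snd (L i) = 1" using conf_bounds(3)[OF conf i(1)] by simp
  then show "1 \<in> E" using ends_I(2)[OF i(1), of L] by simp
qed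

lemma E_bounds: "y \<in> E \<Longrightarrow> -1 \<le> y \<and> y \<le> 1"
  using ends_ge[OF conf] by simp

text \<open>A black vertex other than the root has a white child, because non-root univalent
  vertices are white; hence no vertex interval degenerates to a point.\<close>

lemma alpha_pos: "v \<in> A \<Longrightarrow> 0 < alpha A v"
proof (cases "odd (length v)")
  case False
  assume v: "v \<in> A"
  show ?thesis
  proof (cases "v = []")
    case True
    then show ?thesis using alpha_root[OF tree] m1 by simp
  next
    case False
    then have "v @ [0] \<in> whites A"
      using tree_black_child[OF tree v] \<open>\<not> odd (length v)\<close> by (simp add: whites_def)
    then have "{u \<in> whites A. prefix v u} \<noteq> {}" by (auto simp: prefix_def)
    then show ?thesis using alpha_eq_card[OF tree v] tree_finite[OF tree] by (simp add: whites_def card_gt_0_iff)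
  qed
qed (simp add: alpha_def)

lemma lo_less_hi: "v \<in> A \<Longrightarrow> l v < h v"
  using alpha_pos m1 by (simp add: hi_lo)

lemma vertex_bounds: "v \<in> A \<Longrightarrow> -1 \<le> l v \<and> h v \<le> 1"
  using prefix_in[of v "[]"] root_interval by simp

lemma lab_inj: "i \<in> whites A \<Longrightarrow> j \<in> whites A \<Longrightarrow> lab i = lab j \<Longrightarrow> i = j"
  using tree_lab[OF tree] by (auto simp: bij_betw_def inj_on_def)

text \<open>Away from \<open>E\<close> the visible label, hence the innermost vertex, is locally constant; so the interval of a
  vertex can only begin and end in \<open>E\<close>.\<close>

lemma vertex_ends_aux:
  assumes x: "x \<notin> E" "-1 \<le> x" "x \<le> 1" and ab: "a < x" "x < b"
  obtains z z' where "a < z" "z < x" "x < z'" "z' < b"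
    "\<And>v. v \<in> A \<Longrightarrow> l v < z \<and> z < h v \<longleftrightarrow> l v < z' \<and> z' < h v"
proof -
  have "x \<noteq> -1" "x \<noteq> 1" using x E_ends by auto
  then have "-1 < x" "x < 1" using x by simp_all
  then obtain k where k: "Suc k < nE m L" "endpt m L k < x" "x < endpt m L (Suc k)"
    using en_locate[OF finite_ends E_ends] x by metis
  have eb: "-1 \<le> endpt m L k" "endpt m L (Suc k) \<le> 1"
    using E_bounds en_in[OF finite_ends, of k m L] en_in[OF finite_ends, of "Suc k" m L] k by auto
  obtain z where z: "a < z" "endpt m L k < z" "z < x" "z \<notin> crit"
    using avoid_finite[OF finite_crit, of "max a (endpt m L k)" x] ab k by auto
  obtain z' where z': "x < z'" "z' < b" "z' < endpt m L (Suc k)" "z' \<notin> crit"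
    using avoid_finite[OF finite_crit, of x "min b (endpt m L (Suc k))"] ab k by auto
  obtain i where i: "i \<in> whites A" "\<And>v. v \<in> A \<Longrightarrow> l v < z \<and> z < h v \<longleftrightarrow> prefix v i"
    using locate[of z] z z' eb by auto
  obtain i' where i': "i' \<in> whites A" "\<And>v. v \<in> A \<Longrightarrow> l v < z' \<and> z' < h v \<longleftrightarrow> prefix v i'"
    using locate[of z'] z z' eb by auto
  have "visible m (L, \<sigma>) (lab i) z" "visible m (L, \<sigma>) (lab i') z'"
    using locate_vis z z' i i' by auto
  moreover have "visible m (L, \<sigma>) (lab i) z \<longleftrightarrow> visible m (L, \<sigma>) (lab i) z'"
    using vis_cong[of k m "(L, \<sigma>)" z z'] k z z' by simp
  ultimately have "lab i = lab i'" using vis_unique[OF conf] by blast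
  then have "i = i'" using lab_inj i i' by blast
  with i i' show thesis using that[of z z'] z z' by blast
qed

lemma vertex_ends:
  assumes v: "v \<in> A" shows "l v \<in> E" "h v \<in> E"
proof -
  note b = vertex_bounds[OF v] lo_less_hi[OF v]
  show "l v \<in> E"
  proof (rule ccontr)
    assume "l v \<notin> E"
    then obtain z z' where "z < l v" "l v < z'" "z' < h v"
      and *: "\<And>v. v \<in> A \<Longrightarrow> l v < z \<and> z < h v \<longleftrightarrow> l v < z' \<and> z' < h v"
      by (rule vertex_ends_aux[of "l v" "l v - 1" "h v"]) (use b in auto)
    then show False using *[OF v] by simp
  qed
  show "h v \<in> E"
  proof (rule ccontr)
    assume "h v \<notin> E"
    then obtain z z' where "l v < z" "z < h v" "h v < z'"
      and *: "\<And>v. v \<in> A \<Longrightarrow> l v < z \<and> z < h v \<longleftrightarrow> l v < z' \<and> z' < h v"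
      by (rule vertex_ends_aux[of "h v" "l v" "h v + 1"]) (use b in auto)
    then show False using *[OF v] by simp
  qed
qed

text \<open>The white vertex is the innermost one around the midpoint. The right end may stand for
  the midpoint since no vertex interval begins or ends inside a segment; this form matches
  \<open>push\<close>, which counts a segment by its right end.\<close>

lemma seg_white:
  assumes k: "Suc k < nE m L"
  obtains i where "i \<in> whites A" "k \<in> segs m (L, \<sigma>) (lab i)"
    "\<And>v. v \<in> A \<Longrightarrow> l v < endpt m L (Suc k) \<and> endpt m L (Suc k) \<le> h v \<longleftrightarrow> prefix v i"
proof -
  let ?z = "mid m L k"
  note mb = mid_between[OF k]
  have eb: "-1 \<le> endpt m L k" "endpt m L (Suc k) \<le> 1"
    using E_bounds en_in[OF finite_ends, of k m L] en_in[OF finite_ends, of "Suc k" m L] k by auto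
  have nc: "?z \<notin> crit"
    using seg_not_end[OF k mb] vertex_ends by (auto simp: crit_def)
  obtain i where i: "i \<in> whites A" "\<And>v. v \<in> A \<Longrightarrow> l v < ?z \<and> ?z < h v \<longleftrightarrow> prefix v i"
    using locate[of ?z] eb mb nc by auto
  have "l v < endpt m L (Suc k) \<and> endpt m L (Suc k) \<le> h v \<longleftrightarrow> l v < ?z \<and> ?z < h v" if "v \<in> A" for v
    using vertex_ends[OF that] en_gap[OF finite_ends _ k] mb by (smt (verit, ccfv_threshold))
  with i locate_vis[OF nc i] that[of i] show thesis
    using k by (simp add: segs_def)
qed

text \<open>A lobe with a segment inside the interval of \<open>v\<close> belongs to a vertex at or
  above \<open>v\<close>, so it lies there as a whole. The deformed length thus depends only on the
  lobe totals of \<open>t\<close>.\<close>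

lemma push_vertex:
  assumes v: "v \<in> A"
  shows "push E t (h v) - push E t (l v) = (\<Sum>i\<in>{i \<in> whites A. prefix v i}. \<Sum>k\<in>segs m (L, \<sigma>) (lab i). t k)"
proof -
  have "{k. Suc k < nE m L \<and> l v < endpt m L (Suc k) \<and> endpt m L (Suc k) \<le> h v}
      = (\<Union>i\<in>{i \<in> whites A. prefix v i}. segs m (L, \<sigma>) (lab i))" (is "?K = ?U")
  proof (intro set_eqI iffI)
    fix k assume "k \<in> ?K"
    then show "k \<in> ?U" using seg_white[of k] v by (metis (mono_tags, lifting) UN_iff mem_Collect_eq)
  next
    fix k assume "k \<in> ?U"
    then obtain i where i: "i \<in> whites A" "prefix v i" "k \<in> segs m (L, \<sigma>) (lab i)" by blast
    then have k: "Suc k < nE m L" using segs_index by fastforce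
    then obtain j where j: "j \<in> whites A" "k \<in> segs m (L, \<sigma>) (lab j)"
      "\<And>v. v \<in> A \<Longrightarrow> l v < endpt m L (Suc k) \<and> endpt m L (Suc k) \<le> h v \<longleftrightarrow> prefix v j"
      using seg_white by blast
    then have "lab i = lab j" using segs_disjoint[OF conf] i by blast
    then have "i = j" using lab_inj i j by blast
    with i j k v show "k \<in> ?K" by blast
  qed
  moreover have "(\<Sum>k\<in>?U. t k) = (\<Sum>i\<in>{i \<in> whites A. prefix v i}. \<Sum>k\<in>segs m (L, \<sigma>) (lab i). t k)"
  proof (rule sum.UNION_disjoint)
    show "finite {i \<in> whites A. prefix v i}" using tree_finite[OF tree] by (simp add: whites_def)
    show "\<forall>i\<in>{i \<in> whites A. prefix v i}. \<forall>j\<in>{i \<in> whites A. prefix v i}. i \<noteq> j \<longrightarrow>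
      segs m (L, \<sigma>) (lab i) \<inter> segs m (L, \<sigma>) (lab j) = {}"
      using lab_inj segs_disjoint[OF conf] by blast
  qed (simp add: finite_segs)
  ultimately show ?thesis using push_diff[OF lo_le_hi[OF v]] by simp
qed

lemma en_E_0: "endpt m L 0 = -1"
  by (rule en_0[OF finite_ends E_ends(1)]) (use E_bounds in blast)

text \<open>The interval of \<open>i\<close> has length \<open>2 / m\<close> times the number of
  lobes in it, by \<open>hi_lo\<close>. Inductively the lobes strictly above \<open>i\<close> have
  length \<open>2 / m\<close> each, so this is also what is left for the lobe of
  \<open>i\<close>.\<close>

lemma seg_sum:
  assumes "i \<in> whites A"
  shows "(\<Sum>k\<in>segs m (L, \<sigma>) (lab i). endpt m L (Suc k) - endpt m L k) = 2 / real m"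
  using assms
proof (induction "alpha A i" arbitrary: i rule: less_induct)
  case less
  let ?s = "\<lambda>i. \<Sum>k\<in>segs m (L, \<sigma>) (lab i). endpt m L (Suc k) - endpt m L k"
  have iA: "i \<in> A" using less.prems by (simp add: whites_def)
  let ?W = "{u \<in> whites A. prefix i u}"
  have fin: "finite ?W" using tree_finite[OF tree] by (simp add: whites_def)
  have sub: "?s u = 2 / real m" if u: "u \<in> ?W - {i}" for u
  proof (rule less.hyps)
    have uA: "u \<in> A" using u by (simp add: whites_def)
    have "{w \<in> whites A. prefix u w} \<subset> ?W"
      using u less.prems by (auto simp: prefix_order.eq_iff dest: prefix_order.trans)
    then show "alpha A u < alpha A i"
      unfolding alpha_eq_card[OF tree uA] alpha_eq_card[OF tree iA] using fin by (rule psubset_card_mono[rotated])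
  qed (use u in simp)
  have "h i - l i = (\<Sum>u\<in>?W. ?s u)"
    using push_vertex[OF iA, of "\<lambda>k. endpt m L (Suc k) - endpt m L k"]
    by (simp add: push_id[OF finite_ends _ en_E_0] vertex_ends[OF iA])
  also have "\<dots> = ?s i + (\<Sum>u\<in>?W - {i}. ?s u)"
    using fin less.prems by (intro sum.remove) auto
  also have "(\<Sum>u\<in>?W - {i}. ?s u) = real (card ?W - 1) * (2 / real m)"
    using sub less.prems fin by simp
  finally have "2 / real m * real (card ?W) = ?s i + real (card ?W - 1) * (2 / real m)"
    using hi_lo[OF iA] alpha_eq_card[OF tree iA] by simp
  moreover have "card ?W \<ge> 1" using fin less.prems by (auto simp: Suc_le_eq card_gt_0_iff)
  moreover have "c * real w = x + real (w - 1) * c \<Longrightarrow> 1 \<le> w \<Longrightarrow> x = c" for c x w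
    by (simp add: of_nat_diff algebra_simps)
  ultimately show ?case by blast
qed

text \<open>As \<open>z2\<close> lies between two points of the interval of \<open>i\<close>, its
  innermost vertex \<open>j\<close> is \<open>i\<close> or above it; \<open>z3\<close>, between two
  points of the interval of \<open>j\<close>, gives the reverse.\<close>

lemma noncrossing_aux:
  assumes z: "z1 < z2" "z2 < z3" "z3 < z4" and i: "i \<in> whites A" and j: "j \<in> whites A"
    and zi: "\<And>v. v \<in> A \<Longrightarrow> l v < z1 \<and> z1 < h v \<longleftrightarrow> prefix v i" "\<And>v. v \<in> A \<Longrightarrow> l v < z3 \<and> z3 < h v \<longleftrightarrow> prefix v i"
    and zj: "\<And>v. v \<in> A \<Longrightarrow> l v < z2 \<and> z2 < h v \<longleftrightarrow> prefix v j" "\<And>v. v \<in> A \<Longrightarrow> l v < z4 \<and> z4 < h v \<longleftrightarrow> prefix v j"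
  shows "i = j"
proof -
  have A: "i \<in> A" "j \<in> A" using i j by (auto simp: whites_def)
  have "prefix j i"
    using zj[OF A(2)] zi(2)[OF A(2)] z by auto
  moreover have "prefix i j"
    using zi[OF A(1)] zj(1)[OF A(1)] z by auto
  ultimately show ?thesis by (simp add: prefix_order.eq_iff)
qed

lemma locate_seg:
  assumes z: "-1 < z" "z < 1" "z \<notin> E"
  obtains i where "i \<in> whites A" "visible m (L, \<sigma>) (lab i) z" "\<And>v. v \<in> A \<Longrightarrow> l v < z \<and> z < h v \<longleftrightarrow> prefix v i"
proof -
  have nc: "z \<notin> crit" using z vertex_ends by (auto simp: crit_def)
  show thesis using locate[OF z(1,2) nc] locate_vis[OF nc] that by metis
qed

lemma vis_bounds: "visible m (L, \<sigma>) i z \<Longrightarrow> z \<notin> E \<Longrightarrow> -1 < z \<and> z < 1"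
  using conf_bounds[OF conf, of i] E_ends by (auto simp: visible_def less_le)

lemma normal: "normal m (L, \<sigma>)"
  unfolding normal_def fst_conv
proof (intro conjI ballI allI impI)
  fix i assume "i \<in> {1..m}"
  then have "i \<in> lab ` whites A" using tree_lab[OF tree] by (simp add: bij_betw_def)
  then show "(\<Sum>k\<in>segs m (L, \<sigma>) i. endpt m L (Suc k) - endpt m L k) = 2 / real m"
    using seg_sum by auto
next
  fix i j z1 z2 z3 z4
  assume *: "z1 < z2 \<and> z2 < z3 \<and> z3 < z4 \<and> {z1, z2, z3, z4} \<inter> ends m L = {} \<and>
        visible m (L, \<sigma>) i z1 \<and> visible m (L, \<sigma>) j z2 \<and> visible m (L, \<sigma>) i z3 \<and> visible m (L, \<sigma>) j z4"
  have loc: "\<exists>u\<in>whites A. lab u = x \<and> (\<forall>v\<in>A. l v < z \<and> z < h v \<longleftrightarrow> prefix v u)"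
    if "visible m (L, \<sigma>) x z" "z \<notin> E" for x z
    using locate_seg[of z] vis_bounds[OF that] that vis_unique[OF conf that(1)] by metis
  obtain u1 where u1: "u1\<in>whites A" "lab u1 = i" "\<forall>v\<in>A. l v < z1 \<and> z1 < h v \<longleftrightarrow> prefix v u1"
    using loc[of i z1] * by auto
  obtain u2 where u2: "u2\<in>whites A" "lab u2 = j" "\<forall>v\<in>A. l v < z2 \<and> z2 < h v \<longleftrightarrow> prefix v u2"
    using loc[of j z2] * by auto
  obtain u3 where u3: "u3\<in>whites A" "lab u3 = i" "\<forall>v\<in>A. l v < z3 \<and> z3 < h v \<longleftrightarrow> prefix v u3"
    using loc[of i z3] * by auto
  obtain u4 where u4: "u4\<in>whites A" "lab u4 = j" "\<forall>v\<in>A. l v < z4 \<and> z4 < h v \<longleftrightarrow> prefix v u4"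
    using loc[of j z4] * by auto
  have "u1 = u3" "u2 = u4" using lab_inj u1 u2 u3 u4 by auto
  then have "u1 = u2"
    using noncrossing_aux[of z1 z2 z3 z4 u1 u2] * u1 u2 u3 u4 by blast
  then show "i = j" using u1 u2 by simp
next
  fix z assume "-1 < z \<and> z < 1 \<and> z \<notin> E"
  then show "\<exists>i. visible m (L, \<sigma>) i z" using locate_seg by metis
qed (use m1 conf E_ends in auto)

end

section \<open>Order types and deformations\<close>

lemma normal_conf: "normal m c \<Longrightarrow> c \<in> conf m"
  by (simp add: normal_def)

lemma normal_bounds: "normal m c \<Longrightarrow> y \<in> ends m (fst c) \<Longrightarrow> -1 \<le> y \<and> y \<le> 1"
  using ends_ge normal_conf by blast

lemma normal_e0: "normal m c \<Longrightarrow> endpt m (fst c) 0 = -1"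
  by (rule en_0[OF finite_ends]) (auto simp: normal_def dest: ends_ge)

lemma normal_elast: "normal m c \<Longrightarrow> endpt m (fst c) (nE m (fst c) - 1) = 1"
  by (rule en_last[OF finite_ends]) (auto simp: normal_def dest: ends_ge)

lemma normal_nE_pos: "normal m c \<Longrightarrow> 0 < nE m (fst c)"
  using finite_ends by (auto simp: normal_def card_gt_0_iff)

lemma segs_Union:
  assumes "normal m c"
  shows "(\<Union>i\<in>{1..m}. segs m c i) = {k. Suc k < nE m (fst c)}"
proof (intro set_eqI iffI)
  fix k assume k: "k \<in> {k. Suc k < nE m (fst c)}"
  then have k: "Suc k < nE m (fst c)" by simp
  note mb = mid_between[OF k]
  have "-1 \<le> endpt m (fst c) k" "endpt m (fst c) (Suc k) \<le> 1"
    using normal_bounds[OF assms en_in[OF finite_ends]] k by auto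
  then obtain i where "visible m c i (mid m (fst c) k)"
    using assms seg_not_end[OF k mb] mb unfolding normal_def by (meson order.strict_trans1 order.strict_trans2)
  then show "k \<in> (\<Union>i\<in>{1..m}. segs m c i)" using k by (auto simp: segs_def visible_def)
qed (auto simp: segs_def)

lemma sum_all_segs:
  assumes "normal m c"
  shows "(\<Sum>k\<in>{k. Suc k < nE m (fst c)}. f k) = (\<Sum>i\<in>{1..m}. \<Sum>k\<in>segs m c i. f k)"
  unfolding segs_Union[OF assms, symmetric]
  by (rule sum.UNION_disjoint) (use finite_segs segs_disjoint[OF normal_conf[OF assms]] in auto)

lemma normal_sum: "normal m c \<Longrightarrow> i \<in> {1..m} \<Longrightarrow> (\<Sum>k\<in>segs m c i. endpt m (fst c) (Suc k) - endpt m (fst c) k) = 2 / real m"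
  by (simp add: normal_def)

lemma normal_m: "normal m c \<Longrightarrow> 1 \<le> m"
  by (simp add: normal_def)

lemma segs_nonempty: "normal m c \<Longrightarrow> i \<in> {1..m} \<Longrightarrow> segs m c i \<noteq> {}"
  using normal_sum[of m c i] by auto

text \<open>Each label owns a segment. So the subtraction in \<open>nE m L - 1 - m\<close> is not
  truncated, on which the strict drop of dimension at the boundary relies.\<close>

lemma normal_nE:
  assumes "normal m c"
  shows "m < nE m (fst c)"
proof -
  have "m = (\<Sum>i\<in>{1..m}. 1)" by simp
  also have "\<dots> \<le> (\<Sum>i\<in>{1..m}. card (segs m c i))"
    using segs_nonempty[OF assms] by (intro sum_mono) (simp add: Suc_le_eq card_gt_0_iff finite_segs)
  also have "\<dots> = card (\<Union>i\<in>{1..m}. segs m c i)"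
    by (rule card_UN_disjoint[symmetric]) (use finite_segs segs_disjoint[OF normal_conf[OF assms]] in auto)
  also have "\<dots> = nE m (fst c) - 1"
  proof -
    have "{k. Suc k < nE m (fst c)} = {..<nE m (fst c) - 1}" by auto
    then show ?thesis unfolding segs_Union[OF assms] by simp
  qed
  finally show ?thesis using normal_nE_pos[OF assms] by linarith
qed

lemma push_total:
  assumes n: "normal m c" and t: "\<And>i. i \<in> {1..m} \<Longrightarrow> (\<Sum>k\<in>segs m c i. t k) = 2 / real m"
  shows "push (ends m (fst c)) t 1 = 1"
proof -
  have "en (ends m (fst c)) (Suc k) \<le> 1" if "Suc k < nE m (fst c)" for k
    using normal_bounds[OF n en_in[OF finite_ends that]] by simp
  then have "{k. Suc k < nE m (fst c) \<and> endpt m (fst c) (Suc k) \<le> 1} = {k. Suc k < nE m (fst c)}" by auto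
  then have "push (ends m (fst c)) t 1 = -1 + (\<Sum>i\<in>{1..m}. \<Sum>k\<in>segs m c i. t k)"
    using sum_all_segs[OF n] by (simp add: push_def)
  then show ?thesis using t normal_m[OF n] by simp
qed

lemma push_first:
  assumes "normal m c"
  shows "push (ends m (fst c)) t (-1) = -1"
  using push_en[OF finite_ends normal_nE_pos[OF assms], of t] normal_e0[OF assms] by simp

text \<open>Segments may collapse, but no little interval does: it contains all segments with its
  own label, and these keep the total length \<open>2 / m\<close>.\<close>

lemma moved_conf:
  assumes n: "normal m (L, \<sigma>)" and t: "\<And>i. i \<in> {1..m} \<Longrightarrow> (\<Sum>k\<in>segs m (L, \<sigma>) i. t k) = 2 / real m"
    and t0: "\<And>k. Suc k < nE m L \<Longrightarrow> 0 \<le> t k"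
  shows "(moved m L t, \<sigma>) \<in> conf m"
proof -
  let ?P = "push (ends m L) t"
  have P1: "?P 1 = 1" and P0: "?P (-1) = -1"
    using push_total[OF n t] push_first[OF n] by auto
  have "-1 \<le> ?P (fst (L i)) \<and> ?P (fst (L i)) < ?P (snd (L i)) \<and> ?P (snd (L i)) \<le> 1" if i: "i \<in> {1..m}" for i
  proof (intro conjI)
    have b: "-1 \<le> fst (L i)" "fst (L i) < snd (L i)" "snd (L i) \<le> 1"
      using conf_bounds[OF normal_conf[OF n] i] by auto
    show "-1 \<le> ?P (fst (L i))" using push_mono[of "ends m L" t, OF t0 b(1)] P0 by simp
    show "?P (snd (L i)) \<le> 1" using push_mono[of "ends m L" t, OF t0 b(3)] P1 by simp
    have "2 / real m \<le> ?P (snd (L i)) - ?P (fst (L i))"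
    proof -
      have "(\<Sum>k\<in>segs m (L, \<sigma>) i. t k) \<le> (\<Sum>k\<in>{k. Suc k < nE m L \<and> fst (L i) < endpt m L (Suc k) \<and> endpt m L (Suc k) \<le> snd (L i)}. t k)"
      proof (rule sum_mono2)
        show "segs m (L, \<sigma>) i \<subseteq> {k. Suc k < nE m L \<and> fst (L i) < endpt m L (Suc k) \<and> endpt m L (Suc k) \<le> snd (L i)}"
        proof
          fix k assume k: "k \<in> segs m (L, \<sigma>) i"
          then have s: "Suc k < nE m L" "visible m (L, \<sigma>) i (mid m L k)" by (auto simp: segs_def)
          note mb = mid_between[OF s(1)]
          have "mid m L k \<in> {fst (L i)..snd (L i)}" using s(2) by (simp add: visible_def)
          then show "k \<in> {k. Suc k < nE m L \<and> fst (L i) < endpt m L (Suc k) \<and> endpt m L (Suc k) \<le> snd (L i)}"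
            using seg_mem[OF s(1) mb i] mb s(1) by auto
        qed
      qed (use t0 finite_push_idx in auto)
      then show ?thesis using push_diff[of "fst (L i)" "snd (L i)"] b(2) t[OF i] by simp
    qed
    moreover have "0 < 2 / real m" using i by simp
    ultimately show "?P (fst (L i)) < ?P (snd (L i))" by linarith
  qed
  moreover have "\<sigma> \<in> perms m" using normal_conf[OF n] by (simp add: conf_def)
  ultimately show ?thesis by (simp add: conf_def little_intervals_def moved_def)
qed

section \<open>Deformations stay in \<open>Ov1\<close>\<close>

context ov1_conf
begin

context
  fixes t :: "nat \<Rightarrow> real"
  assumes t0: "\<And>k. Suc k < nE m L \<Longrightarrow> 0 \<le> t k"
    and tsum: "\<And>i. i \<in> {1..m} \<Longrightarrow> (\<Sum>k\<in>segs m (L, \<sigma>) i. t k) = 2 / real m"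
begin

abbreviation "P \<equiv> push E t"

lemma push_hi: "v \<in> A \<Longrightarrow> P (h v) = P (l v) + 2 / real m * real (alpha A v)"
proof -
  assume v: "v \<in> A"
  have "lab i \<in> {1..m}" if "i \<in> whites A" for i using tree_lab[OF tree] that bij_betwE by blast
  then show ?thesis using push_vertex[OF v, of t] alpha_eq_card[OF tree v] tsum by (simp add: mult.commute)
qed

text \<open>A block boundary is reached from the left end of \<open>v\<close> by adding complete
  child intervals, whose lengths are preserved by \<open>push_hi\<close>. So all block boundaries of
  \<open>v\<close> are translated by the same amount.\<close>

lemma push_off:
  assumes "v \<in> A" "even (length v)" "K \<le> nch A v"
  shows "P (xb v + off m A v K) = P (xb v) + off m A v K"
  using assms(3)
proof (induction K)
  case (Suc K)
  have c: "v @ [K] \<in> A" using Suc.prems child_iff[OF tree] by auto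
  show ?case using push_hi[OF c] Suc assms by (simp add: lo_def hi_def off_Suc[OF tree])
qed (simp add: off_0[OF tree])

lemma lo_push: "v \<in> A \<Longrightarrow> lo m A (\<lambda>v. P (xb v)) v = P (l v)"
proof (cases v rule: rev_exhaust)
  case (snoc w k)
  assume v: "v \<in> A"
  then have w: "w \<in> A" "k < nch A w" using snoc parent child_iff[OF tree] by auto
  show ?thesis using snoc push_off[OF w(1), of k] w by (simp add: lo_def)
qed (simp add: lo_def)

lemma hi_push: "v \<in> A \<Longrightarrow> hi m A (\<lambda>v. P (xb v)) v = P (h v)"
proof (cases "even (length v)")
  case False
  assume v: "v \<in> A"
  obtain w k where vw: "v = w @ [k]" "even (length w)" using odd_length_snocE[OF False] by blast
  then have w: "w \<in> A" "Suc k \<le> nch A w" using v parent child_iff[OF tree] by auto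
  show ?thesis using vw push_off[OF w(1) _ w(2)] by (simp add: hi_def)
next
  case True
  assume v: "v \<in> A"
  show ?thesis using True push_off[OF v True order_refl] by (simp add: hi_def)
qed

text \<open>Every condition is an inequality between endpoints of little intervals, block boundaries
  and ends of black intervals. The map \<open>push\<close> is monotone and takes these points of the
  old data to those of the new.\<close>

lemma moved_tree: "ov1_tree m \<sigma> A lab (moved m L t) (\<lambda>v. P (xb v))"
proof
  have mono: "x \<le> y \<Longrightarrow> P x \<le> P y" for x y by (rule push_mono[OF t0])
  have M: "moved m L t (lab w) = (P (fst (L (lab w))), P (snd (L (lab w))))" if "w \<in> whites A" for w
    using that tree_lab[OF tree] bij_betwE by (fastforce simp: moved_def)
  show "1 \<le> m" "bw_tree m A lab" "compatible A lab \<sigma>" by (fact m1, fact tree, fact comp)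
  show "P (xb []) = -1" using push_first[OF normal] root by simp
  fix v n
  assume a: "v @ [n] \<in> A"
  then have v: "v \<in> A" "Suc n \<le> nch A v" using parent child_iff[OF tree] by auto
  { assume ev: "even (length v)"
    then have w: "v @ [n] \<in> whites A" using a by (simp add: whites_def)
    note kr = kr_props[OF tree a, where \<sigma> = \<sigma>] and kl = kl_le[OF tree, of \<sigma> v n]
    have kl': "kl \<sigma> lab v n \<le> nch A v" "n \<le> nch A v" using kl v by auto
    note po = push_off[OF v(1) ev]
    show "P (xb v) + off m A v (kl \<sigma> lab v n) \<le> fst (moved m L t (lab (v @ [n]))) \<and>
          fst (moved m L t (lab (v @ [n]))) \<le> P (xb v) + off m A v n"
      using white_fst[OF a ev] mono[of "xb v + off m A v (kl \<sigma> lab v n)"] mono[of _ "xb v + off m A v n"]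
      by (simp add: M[OF w] po[OF kl'(1)] po[OF kl'(2)])
    show "P (xb v) + off m A v (Suc n) \<le> snd (moved m L t (lab (v @ [n]))) \<and>
          snd (moved m L t (lab (v @ [n]))) \<le> P (xb v) + off m A v (kr A \<sigma> lab v n)"
      using white_snd[OF a ev] mono[of "xb v + off m A v (Suc n)"] mono[of _ "xb v + off m A v (kr A \<sigma> lab v n)"]
      by (simp add: M[OF w] po[OF v(2)] po[OF kr(2)]) }
  { assume od: "odd (length v)"
    show "lo m A (\<lambda>v. P (xb v)) v \<le> lo m A (\<lambda>v. P (xb v)) (v @ [n]) \<and>
        hi m A (\<lambda>v. P (xb v)) (v @ [n]) \<le> hi m A (\<lambda>v. P (xb v)) v"
      using black_in[OF a od] by (simp add: lo_push hi_push a v mono) }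
next
  fix i k assume a: "i @ [Suc k] \<in> A" "odd (length i)"
  then have b: "i @ [k] \<in> A" using child_iff[OF tree] by auto
  show "hi m A (\<lambda>v. P (xb v)) (i @ [k]) \<le> lo m A (\<lambda>v. P (xb v)) (i @ [Suc k])"
    using black_ord[OF a] by (simp add: lo_push hi_push a b push_mono t0)
qed

lemma moved_Ov1: "ov_class m (moved m L t, \<sigma>) \<in> Ov1 m"
proof -
  have "ov1_cond m \<sigma> A lab (moved m L t)"
    by (rule ov1_tree.ov1_cond[OF moved_tree])
  moreover have "(moved m L t, \<sigma>) \<in> conf m"
    by (rule moved_conf[OF normal tsum t0])
  ultimately show ?thesis using tree comp unfolding Ov1_def by blast
qed

end

end

section \<open>Order types as invariants of classes\<close>

definition idx :: "nat \<Rightarrow> (nat \<times> bool) set" where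
  "idx m = {1..m} \<times> UNIV"

text \<open>Only overlapping pairs are compared, as in \<open>ov_rel\<close>; this part of the
  permutation is common to all representatives of a class.\<close>

definition hrel :: "nat \<Rightarrow> ((nat \<Rightarrow> real \<times> real) \<times> (nat \<Rightarrow> nat)) \<Rightarrow> (nat \<times> nat) set" where
  "hrel m c = {(i, j). i \<in> {1..m} \<and> j \<in> {1..m} \<and> interiors_meet (fst c i) (fst c j) \<and>
      height (snd c) i < height (snd c) j}"

definition otype :: "nat \<Rightarrow> ((nat \<Rightarrow> real \<times> real) \<times> (nat \<Rightarrow> nat)) \<Rightarrow>
    ((nat \<times> bool) \<times> (nat \<times> bool)) set \<times> (nat \<times> nat) set" where
  "otype m c = ({(a, b). a \<in> idx m \<and> b \<in> idx m \<and> coord (fst c) a \<le> coord (fst c) b}, hrel m c)"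

text \<open>Two endpoints have the same row in the preorder exactly if they coincide, so the number
  of rows is the number of distinct endpoints (\<open>cell_dim_typ\<close>). One less is the number
  of segments, and \<open>m\<close> is the number of constraints on their lengths.\<close>

definition cell_dim :: "nat \<Rightarrow> ((nat \<times> bool) \<times> (nat \<times> bool)) set \<times> (nat \<times> nat) set \<Rightarrow> nat" where
  "cell_dim m \<tau> = card ((\<lambda>a. fst \<tau> `` {a}) ` idx m) - 1 - m"

lemma ends_idx: "ends m L = coord L ` idx m"
  by (simp add: ends_def idx_def)

lemma finite_otype_range: "finite (range (otype m))"
proof (rule finite_subset)
  show "range (otype m) \<subseteq> Pow (idx m \<times> idx m) \<times> Pow ({1..m} \<times> {1..m})"
    by (auto simp: otype_def hrel_def)
qed (simp add: idx_def)

lemma otype_coord: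
  assumes "otype m c = otype m c'" "a \<in> idx m" "b \<in> idx m"
  shows "coord (fst c) a \<le> coord (fst c) b \<longleftrightarrow> coord (fst c') a \<le> coord (fst c') b"
proof -
  have "(a, b) \<in> fst (otype m c) \<longleftrightarrow> (a, b) \<in> fst (otype m c')" using assms(1) by simp
  then show ?thesis using assms(2,3) by (simp add: otype_def)
qed

lemma otype_coord_less:
  assumes "otype m c = otype m c'" "a \<in> idx m" "b \<in> idx m"
  shows "coord (fst c) a < coord (fst c) b \<longleftrightarrow> coord (fst c') a < coord (fst c') b"
  using otype_coord[OF assms(1,3,2)] by auto

lemma cell_dim_typ: "cell_dim m (otype m c) = nE m (fst c) - 1 - m"
proof -
  let ?U = "\<lambda>x. {b \<in> idx m. x \<le> coord (fst c) b}"
  have "(\<lambda>a. fst (otype m c) `` {a}) ` idx m = ?U ` ends m (fst c)"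
    by (auto simp: otype_def ends_idx Image_def image_iff)
  moreover have "inj_on ?U (ends m (fst c))"
  proof (rule inj_onI)
    fix x y assume xy: "x \<in> ends m (fst c)" "y \<in> ends m (fst c)" "?U x = ?U y"
    then obtain a b where ab: "a \<in> idx m" "x = coord (fst c) a" "b \<in> idx m" "y = coord (fst c) b"
      by (auto simp: ends_idx)
    have "a \<in> ?U y" "b \<in> ?U x" using ab xy(3) by blast+
    then show "x = y" using ab by simp
  qed
  ultimately show ?thesis by (simp add: cell_dim_def card_image)
qed

lemma meet_coord: "interiors_meet (L i) (L j) \<longleftrightarrow> coord L (i, False) < coord L (j, True) \<and> coord L (j, False) < coord L (i, True)"
  by (simp add: interiors_meet_def coord_def)

lemma height_inj:
  assumes "c \<in> conf m" "height (snd c) i = height (snd c) j" shows "i = j"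
proof -
  have "snd c permutes {1..m}" using assms(1) by (auto simp: conf_def perms_def)
  then have "bij (inv (snd c))" by (intro bij_imp_bij_inv permutes_bij)
  then show ?thesis using assms(2) by (auto simp: height_def bij_def inj_def)
qed

lemma ov_rel_otype:
  assumes "fst c = fst c'"
  shows "ov_rel m c c' \<longleftrightarrow> otype m c = otype m c'"
  using assms unfolding ov_rel_def otype_def hrel_def by auto

lemma ov_class_eq:
  assumes "c \<in> conf m" "c' \<in> conf m"
  shows "ov_class m c = ov_class m c' \<longleftrightarrow> fst c = fst c' \<and> otype m c = otype m c'"
proof
  assume "ov_class m c = ov_class m c'"
  moreover have "c' \<in> ov_class m c'" using assms by (simp add: ov_class_def ov_rel_def)
  ultimately have "ov_rel m c c'" by (auto simp: ov_class_def)
  then show "fst c = fst c' \<and> otype m c = otype m c'"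
    using ov_rel_otype ov_rel_def by metis
next
  assume "fst c = fst c' \<and> otype m c = otype m c'"
  then have "ov_rel m c d \<longleftrightarrow> ov_rel m c' d" for d
    using ov_rel_otype[of c d] ov_rel_otype[of c' d] by (metis ov_rel_def)
  then show "ov_class m c = ov_class m c'" by (simp add: ov_class_def)
qed

text \<open>The same choice as in \<open>p_map\<close>, so that facts about \<open>rep\<close> apply
  to the cactus of a class.\<close>

definition rep :: "((nat \<Rightarrow> real \<times> real) \<times> (nat \<Rightarrow> nat)) set \<Rightarrow> (nat \<Rightarrow> real \<times> real) \<times> (nat \<Rightarrow> nat)" where
  "rep q = (SOME c. c \<in> q)"

lemma rep_ov_class:
  assumes "c \<in> conf m"
  shows "rep (ov_class m c) \<in> conf m" "fst (rep (ov_class m c)) = fst c" "otype m (rep (ov_class m c)) = otype m c"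
    "ov_class m (rep (ov_class m c)) = ov_class m c"
proof -
  have "c \<in> ov_class m c" using assms by (simp add: ov_class_def ov_rel_def)
  then have *: "rep (ov_class m c) \<in> ov_class m c" unfolding rep_def by (rule someI)
  then show 1: "rep (ov_class m c) \<in> conf m" by (simp add: ov_class_def)
  have "ov_rel m c (rep (ov_class m c))" using * by (simp add: ov_class_def)
  then show 2: "fst (rep (ov_class m c)) = fst c" "otype m (rep (ov_class m c)) = otype m c"
    using ov_rel_otype[of c] by (auto simp: ov_rel_def)
  then show "ov_class m (rep (ov_class m c)) = ov_class m c"
    using ov_class_eq[OF 1 assms] by simp
qed

text \<open>Closed intervals over a point that is no endpoint contain it in their interiors, so
  \<open>hrel\<close> compares them. Off \<open>ends\<close>, visibility is therefore independent of
  the representative.\<close>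

lemma vis_hrel:
  assumes "c \<in> conf m" "z \<notin> ends m (fst c)"
  shows "visible m c i z \<longleftrightarrow> i \<in> {1..m} \<and> z \<in> {fst (fst c i)..snd (fst c i)} \<and>
    (\<forall>j\<in>{1..m}. z \<in> {fst (fst c j)..snd (fst c j)} \<longrightarrow> (i, j) \<notin> hrel m c)"
proof -
  have strict: "fst (fst c j) < z \<and> z < snd (fst c j)" if "j \<in> {1..m}" "z \<in> {fst (fst c j)..snd (fst c j)}" for j
    using that assms(2) ends_I[OF that(1), of "fst c"] by (auto simp: less_le)
  have "height (snd c) j \<le> height (snd c) i \<longleftrightarrow> (i, j) \<notin> hrel m c"
    if "i \<in> {1..m}" "z \<in> {fst (fst c i)..snd (fst c i)}" "j \<in> {1..m}" "z \<in> {fst (fst c j)..snd (fst c j)}" for j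
    using strict[OF that(1,2)] strict[OF that(3,4)] that by (auto simp: hrel_def interiors_meet_def)
  then show ?thesis unfolding visible_def by blast
qed

lemma otype_hrel: "otype m c = otype m c' \<Longrightarrow> hrel m c = hrel m c'"
  by (simp add: otype_def)

lemma vis_otype_cong:
  assumes "c \<in> conf m" "c' \<in> conf m" "fst c = fst c'" "otype m c = otype m c'" "z \<notin> ends m (fst c)"
  shows "visible m c i z \<longleftrightarrow> visible m c' i z"
  using vis_hrel[OF assms(1,5), of i] vis_hrel[OF assms(2), of z i] assms(3,5) otype_hrel[OF assms(4)] by simp

text \<open>Choose an index for each endpoint of \<open>c\<close>. Equality of the order types makes
  the coordinates of these indices in \<open>c'\<close> the increasing enumeration of the endpoints
  there.\<close>

lemma otype_enum:
  assumes "otype m c = otype m c'"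
  shows "nE m (fst c') = nE m (fst c)"
    "k < nE m (fst c) \<Longrightarrow> a \<in> idx m \<Longrightarrow> coord (fst c) a = endpt m (fst c) k \<Longrightarrow> coord (fst c') a = endpt m (fst c') k"
proof -
  let ?N = "nE m (fst c)"
  have "\<exists>a\<in>idx m. coord (fst c) a = endpt m (fst c) k" if "k < ?N" for k
    using en_in[OF finite_ends that] by (auto simp: ends_idx)
  then obtain a where a: "\<And>k. k < ?N \<Longrightarrow> a k \<in> idx m \<and> coord (fst c) (a k) = endpt m (fst c) k"
    by metis
  let ?f = "\<lambda>k. coord (fst c') (a k)"
  have 1: "?f i < ?f j" if "i < j" "j < ?N" for i j
    using otype_coord_less[OF assms, of "a i" "a j"] a[of i] a[of j] en_less[OF finite_ends that] that by simp
  have eq: "coord (fst c') b = ?f k" if "b \<in> idx m" "k < ?N" "coord (fst c) b = endpt m (fst c) k" for b k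
    using otype_coord[OF assms, of b "a k"] otype_coord[OF assms, of "a k" b] a[of k] that by auto
  have 2: "?f ` {..<?N} = ends m (fst c')"
  proof
    show "?f ` {..<?N} \<subseteq> ends m (fst c')" using a by (auto simp: ends_idx)
    show "ends m (fst c') \<subseteq> ?f ` {..<?N}"
    proof
      fix x assume "x \<in> ends m (fst c')"
      then obtain b where b: "b \<in> idx m" "x = coord (fst c') b" by (auto simp: ends_idx)
      then have "coord (fst c) b \<in> ends m (fst c)" by (auto simp: ends_idx)
      then obtain k where "k < ?N" "coord (fst c) b = endpt m (fst c) k" using en_obtain finite_ends by metis
      then show "x \<in> ?f ` {..<?N}" using eq b by auto
    qed
  qed
  show "nE m (fst c') = ?N" using en_unique(1)[OF 1 2] .
  show "k < nE m (fst c) \<Longrightarrow> a' \<in> idx m \<Longrightarrow> coord (fst c) a' = endpt m (fst c) k \<Longrightarrow> coord (fst c') a' = endpt m (fst c') k" for a'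
    using en_unique(2)[OF 1 2] eq by simp
qed

lemma otype_e_le:
  assumes "otype m c = otype m c'" "k < nE m (fst c)" "a \<in> idx m"
  shows "coord (fst c) a \<le> endpt m (fst c) k \<longleftrightarrow> coord (fst c') a \<le> endpt m (fst c') k"
    "endpt m (fst c) k \<le> coord (fst c) a \<longleftrightarrow> endpt m (fst c') k \<le> coord (fst c') a"
proof -
  obtain b where b: "b \<in> idx m" "coord (fst c) b = endpt m (fst c) k"
    using en_in[OF finite_ends assms(2)] by (metis ends_idx imageE)
  have "coord (fst c') b = endpt m (fst c') k" using otype_enum(2)[OF assms(1,2) b] .
  then show "coord (fst c) a \<le> endpt m (fst c) k \<longleftrightarrow> coord (fst c') a \<le> endpt m (fst c') k"
    "endpt m (fst c) k \<le> coord (fst c) a \<longleftrightarrow> endpt m (fst c') k \<le> coord (fst c') a"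
    using otype_coord[OF assms(1,3) b(1)] otype_coord[OF assms(1) b(1) assms(3)] b(2) by auto
qed

lemma otype_segs:
  assumes t: "otype m c = otype m c'" and c: "c \<in> conf m" "c' \<in> conf m"
  shows "segs m c i = segs m c' i"
proof -
  have "visible m c i (mid m (fst c) k) \<longleftrightarrow> visible m c' i (mid m (fst c') k)" if k: "Suc k < nE m (fst c)" for k
  proof -
    have k': "Suc k < nE m (fst c')" using k otype_enum(1)[OF t] by simp
    have kk: "k < nE m (fst c)" using k by simp
    note mb = mid_between[OF k] and mb' = mid_between[OF k']
    have "mid m (fst c) k \<in> {fst (fst c j)..snd (fst c j)} \<longleftrightarrow> mid m (fst c') k \<in> {fst (fst c' j)..snd (fst c' j)}"
      if j: "j \<in> {1..m}" for j
    proof -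
      have "(j, False) \<in> idx m" "(j, True) \<in> idx m" using j by (auto simp: idx_def)
      then show ?thesis
        unfolding seg_mem[OF k mb j] seg_mem[OF k' mb' j]
        using otype_e_le(1)[OF t kk, of "(j, False)"] otype_e_le(2)[OF t k, of "(j, True)"]
        by (simp add: coord_def)
    qed
    then show ?thesis
      unfolding vis_hrel[OF c(1) seg_not_end[OF k mb]] vis_hrel[OF c(2) seg_not_end[OF k' mb']] otype_hrel[OF t]
      by blast
  qed
  then show ?thesis using otype_enum(1)[OF t] by (auto simp: segs_def)
qed

lemma normal_otype_cong:
  assumes n: "normal m c" and c': "c' \<in> conf m" "fst c = fst c'" "otype m c = otype m c'"
  shows "normal m c'"
proof -
  note v = vis_otype_cong[OF normal_conf[OF n] c'] and s = otype_segs[OF c'(3) normal_conf[OF n] c'(1)]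
  show ?thesis unfolding normal_def
  proof (intro conjI allI impI ballI)
    fix i j z1 z2 z3 z4
    assume *: "z1 < z2 \<and> z2 < z3 \<and> z3 < z4 \<and> {z1, z2, z3, z4} \<inter> ends m (fst c') = {} \<and>
        visible m c' i z1 \<and> visible m c' j z2 \<and> visible m c' i z3 \<and> visible m c' j z4"
    then have "z1 < z2 \<and> z2 < z3 \<and> z3 < z4 \<and> {z1, z2, z3, z4} \<inter> ends m (fst c) = {} \<and>
        visible m c i z1 \<and> visible m c j z2 \<and> visible m c i z3 \<and> visible m c j z4"
      using v c'(2) by auto
    then show "i = j" using n unfolding normal_def by blast
  qed (use n v s c' in \<open>auto simp: normal_def\<close>)
qed

text \<open>Shows that deformations exhaust an open cell: starting at -1, \<open>push\<close> forms
  partial sums of the segment lengths of \<open>c'\<close>, and these telescope to the endpoints of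
  \<open>c'\<close>.\<close>

lemma otype_moved:
  assumes t: "otype m c = otype m c'" and e0: "endpt m (fst c') 0 = -1" and c': "c' \<in> conf m"
  shows "moved m (fst c) (\<lambda>k. endpt m (fst c') (Suc k) - endpt m (fst c') k) = fst c'"
proof -
  let ?P = "push (ends m (fst c)) (\<lambda>k. endpt m (fst c') (Suc k) - endpt m (fst c') k)"
  have P: "?P (coord (fst c) a) = coord (fst c') a" if a: "a \<in> idx m" for a
  proof -
    obtain k where k: "k < nE m (fst c)" "coord (fst c) a = endpt m (fst c) k"
      using en_obtain[OF finite_ends, of "coord (fst c) a" m "fst c"] a by (auto simp: ends_idx)
    show ?thesis using otype_enum(2)[OF t k(1) a k(2)] e0
      by (simp add: k(2) push_en[OF finite_ends k(1)] sum_lessThan_telescope)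
  qed
  have "fst c' \<in> extensional {1..m}" using c' by (auto simp: conf_def little_intervals_def PiE_def)
  then show ?thesis
    using P[of "(_, False)"] P[of "(_, True)"]
    by (intro ext) (auto simp: moved_def coord_def idx_def extensional_def prod_eq_iff)
qed

lemma coord_moved: "a \<in> idx m \<Longrightarrow> coord (moved m L t) a = push (ends m L) t (coord L a)"
  by (auto simp: coord_def moved_def idx_def)

lemma push_en_less:
  assumes "finite E" "i < j" "j < card E" "\<And>k. Suc k < card E \<Longrightarrow> 0 < t k"
  shows "push E t (en E i) < push E t (en E j)"
proof -
  have "{..<j} = {..<i} \<union> {i..<j}" using assms(2) by auto
  then have "(\<Sum>k<j. t k) = (\<Sum>k<i. t k) + (\<Sum>k\<in>{i..<j}. t k)"
    by (metis finite_atLeastLessThan finite_lessThan ivl_disj_int_one(2) sum.union_disjoint)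
  moreover have "0 < (\<Sum>k\<in>{i..<j}. t k)"
    using assms by (intro sum_pos) auto
  ultimately show ?thesis using assms(1-3) by (simp add: push_en)
qed

lemma moved_otype:
  assumes t: "\<And>k. Suc k < nE m L \<Longrightarrow> 0 < t k"
  shows "otype m (moved m L t, \<sigma>) = otype m (L, \<sigma>)"
proof -
  let ?P = "push (ends m L) t"
  have less: "?P x < ?P y" if xy: "x < y" "x \<in> ends m L" "y \<in> ends m L" for x y
  proof -
    obtain i where i: "i < nE m L" "x = endpt m L i" using en_obtain[OF finite_ends xy(2)] by metis
    obtain j where j: "j < nE m L" "y = endpt m L j" using en_obtain[OF finite_ends xy(3)] by metis
    have "i < j" using en_mono[OF finite_ends, of j i m L] i j xy(1) by (cases "i < j") auto
    then show ?thesis using push_en_less[OF finite_ends _ j(1) t] i j by simp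
  qed
  have P: "?P (coord L a) \<le> ?P (coord L b) \<longleftrightarrow> coord L a \<le> coord L b" if "a \<in> idx m" "b \<in> idx m" for a b
    using less[of "coord L a" "coord L b"] less[of "coord L b" "coord L a"] that
    by (cases "coord L a" "coord L b" rule: linorder_cases) (auto simp: ends_idx)
  have P': "?P (coord L a) < ?P (coord L b) \<longleftrightarrow> coord L a < coord L b" if "a \<in> idx m" "b \<in> idx m" for a b
    using P[OF that(2,1)] by auto
  have "interiors_meet (moved m L t i) (moved m L t j) \<longleftrightarrow> interiors_meet (L i) (L j)"
    if "i \<in> {1..m}" "j \<in> {1..m}" for i j
  proof -
    have "(i, b) \<in> idx m" "(j, b) \<in> idx m" for b using that by (auto simp: idx_def)
    then show ?thesis by (simp add: meet_coord coord_moved P')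
  qed
  then show ?thesis
    by (auto simp: otype_def hrel_def coord_moved P)
qed

text \<open>A vanishing length identifies two neighbouring endpoints; this is what lowers the
  dimension on the boundary of a cell.\<close>

lemma moved_otype_degenerate:
  assumes t: "\<And>k. Suc k < nE m L \<Longrightarrow> 0 \<le> t k" and k: "Suc k < nE m L" "t k = 0"
  shows "nE m (moved m L t) < nE m L"
proof -
  let ?P = "push (ends m L) t"
  have "ends m (moved m L t) = ?P ` ends m L"
    by (auto simp: ends_idx coord_moved image_iff)
  moreover have "\<not> inj_on ?P (ends m L)"
  proof
    assume inj: "inj_on ?P (ends m L)"
    have "?P (endpt m L k) = ?P (endpt m L (Suc k))" using k by (simp add: push_en finite_ends)
    then have "endpt m L k = endpt m L (Suc k)"
      using inj k en_in[OF finite_ends, of k m L] en_in[OF finite_ends k(1)] by (auto dest: inj_onD)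
    then show False using en_less[OF finite_ends, of k "Suc k" m L] k by simp
  qed
  ultimately show ?thesis
    using card_image_le[OF finite_ends, of ?P m L] eq_card_imp_inj_on[OF finite_ends, of ?P m L] by fastforce
qed

lemma moved_inj:
  assumes n: "normal m (L, \<sigma>)" and eq: "moved m L t = moved m L t'" and k: "Suc k < nE m L"
  shows "t k = t' k"
proof -
  have P: "push (ends m L) t x = push (ends m L) t' x" if x: "x \<in> ends m L" for x
  proof -
    obtain a where "a \<in> idx m" "x = coord L a" using x by (auto simp: ends_idx)
    then show ?thesis using coord_moved eq by metis
  qed
  show ?thesis
    using P[OF en_in[OF finite_ends k]] P[OF en_in[OF finite_ends, of k]] k by (simp add: push_en finite_ends)
qed

lemma Ov1_rep:
  assumes m: "1 \<le> m" and q: "q \<in> Ov1 m"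
  obtains L \<sigma> A lab xb where "ov1_conf m \<sigma> A lab L xb" "q = ov_class m (L, \<sigma>)"
proof -
  obtain L \<sigma> A lab where *: "q = ov_class m (L, \<sigma>)" "(L, \<sigma>) \<in> conf m" "bw_tree m A lab"
    "compatible A lab \<sigma>" "ov1_cond m \<sigma> A lab L"
    using q by (auto simp: Ov1_def)
  obtain xb where "ov1_tree m \<sigma> A lab L xb" using ov1_cond_imp_tree[OF m *(3,4,5)] by blast
  then have "ov1_conf m \<sigma> A lab L xb" using *(2) by (simp add: ov1_conf_def ov1_conf_axioms_def)
  with * that show thesis by blast
qed

section \<open>The cell structure\<close>

definition interval_top :: "nat \<Rightarrow> (nat \<Rightarrow> real \<times> real) topology" where
  "interval_top m = subtopology (product_topology (\<lambda>_. euclidean) {1..m}) (little_intervals m)"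

lemma topspace_interval_top: "topspace (interval_top m) = little_intervals m"
  by (auto simp: little_intervals_def interval_top_def)

lemma conf_top_eq: "conf_top m = prod_topology (interval_top m) (discrete_topology (perms m))"
  by (simp add: conf_top_def interval_top_def)

lemma topspace_conf_top: "topspace (conf_top m) = conf m"
  by (simp add: conf_top_eq conf_def topspace_interval_top)

lemma topspace_Ov_top: "topspace (Ov_top m) = ov_class m ` conf m"
  by (simp add: Ov_top_def topspace_quotient_topology topspace_conf_top)

lemma continuous_map_interval:
  "i \<in> {1..m} \<Longrightarrow> continuous_map (interval_top m) euclidean (\<lambda>L. L i)"
  unfolding interval_top_def
  by (rule continuous_map_from_subtopology) (rule continuous_map_product_projection)

lemma continuous_map_fst_snd:
  "continuous_map X euclidean (f :: _ \<Rightarrow> real \<times> real) \<Longrightarrow> continuous_map X euclideanreal (\<lambda>x. fst (f x))"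
  "continuous_map X euclidean (f :: _ \<Rightarrow> real \<times> real) \<Longrightarrow> continuous_map X euclideanreal (\<lambda>x. snd (f x))"
  using continuous_map_compose[of X euclidean f euclideanreal fst]
    continuous_map_compose[of X euclidean f euclideanreal snd]
  by (simp_all add: o_def continuous_on_fst continuous_on_snd continuous_on_id)

lemma continuous_map_coord:
  "a \<in> idx m \<Longrightarrow> continuous_map (interval_top m) euclideanreal (\<lambda>L. coord L a)"
  unfolding coord_def idx_def
  by (cases "snd a") (auto intro!: continuous_map_fst_snd continuous_map_interval)

lemma openin_coord_less:
  assumes "a \<in> idx m" "b \<in> idx m"
  shows "openin (interval_top m) {L \<in> little_intervals m. coord L a < coord L b}"
proof -
  have "continuous_map (interval_top m) euclideanreal (\<lambda>L. coord L b - coord L a)"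
    using assms by (intro continuous_map_diff continuous_map_coord)
  from openin_continuous_map_preimage[OF this, of "{0<..}"] show ?thesis
    by (simp add: topspace_interval_top)
qed

lemma openin_conf_top:
  assumes "W \<subseteq> conf m" "\<And>\<sigma>. \<sigma> \<in> perms m \<Longrightarrow> openin (interval_top m) {L \<in> little_intervals m. (L, \<sigma>) \<in> W}"
  shows "openin (conf_top m) W"
  unfolding conf_top_eq using assms
  by (intro openin_prod_discrete) (simp_all add: topspace_interval_top conf_def)

text \<open>The permutation factor is discrete, so openness of a set of classes is tested on the
  intervals alone, one permutation at a time.\<close>

lemma openin_Ov_top:
  assumes "\<And>\<sigma>. \<sigma> \<in> perms m \<Longrightarrow> openin (interval_top m) {L \<in> little_intervals m. P (ov_class m (L, \<sigma>))}"
  shows "openin (Ov_top m) {q \<in> ov_class m ` conf m. P q}"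
proof -
  have "openin (conf_top m) {c \<in> conf m. ov_class m c \<in> {q \<in> ov_class m ` conf m. P q}}"
    using assms by (intro openin_conf_top) (auto simp: conf_def cong: conj_cong)
  then show ?thesis by (simp add: Ov_top_def openin_quotient_topology topspace_conf_top)
qed

lemma hrel_rep: "c \<in> conf m \<Longrightarrow> hrel m (rep (ov_class m c)) = hrel m c"
  using rep_ov_class(3) otype_hrel by blast

text \<open>Overlap is a strict inequality between endpoints. So a height comparison persists near a
  class, while intervals that only touch may begin to overlap; \<open>vis_near\<close> has to live
  with this one-sidedness.\<close>

lemma openin_Ov_hrel:
  assumes "i \<in> {1..m}" "j \<in> {1..m}"
  shows "openin (Ov_top m) {q \<in> ov_class m ` conf m. (i, j) \<in> hrel m (rep q)}"
proof (rule openin_Ov_top)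
  fix \<sigma> assume s: "\<sigma> \<in> perms m"
  have ij: "(i, b) \<in> idx m" "(j, b) \<in> idx m" for b using assms by (auto simp: idx_def)
  have "{L \<in> little_intervals m. (i, j) \<in> hrel m (rep (ov_class m (L, \<sigma>)))} =
    (if height \<sigma> i < height \<sigma> j then {L \<in> little_intervals m. coord L (i, False) < coord L (j, True)} \<inter>
      {L \<in> little_intervals m. coord L (j, False) < coord L (i, True)} else {})"
  proof -
    have "(i, j) \<in> hrel m (rep (ov_class m (L, \<sigma>))) \<longleftrightarrow> height \<sigma> i < height \<sigma> j \<and>
      coord L (i, False) < coord L (j, True) \<and> coord L (j, False) < coord L (i, True)"
      if "L \<in> little_intervals m" for L
    proof -
      have "(L, \<sigma>) \<in> conf m" using that s by (simp add: conf_def)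
      have "hrel m (rep (ov_class m (L, \<sigma>))) = hrel m (L, \<sigma>)" by (rule hrel_rep) fact
      show ?thesis unfolding \<open>hrel m (rep (ov_class m (L, \<sigma>))) = hrel m (L, \<sigma>)\<close> using assms by (auto simp: hrel_def meet_coord)
    qed
    then show ?thesis by auto
  qed
  then show "openin (interval_top m) {L \<in> little_intervals m. (i, j) \<in> hrel m (rep (ov_class m (L, \<sigma>)))}"
    using openin_coord_less[OF ij] openin_coord_less[OF ij(2,1)] by auto
qed

lemma openin_Ov_coord:
  assumes "i \<in> {1..m}" "open U"
  shows "openin (Ov_top m) {q \<in> ov_class m ` conf m. fst (rep q) i \<in> U}"
proof (rule openin_Ov_top)
  fix \<sigma> assume s: "\<sigma> \<in> perms m"
  have "{L \<in> little_intervals m. fst (rep (ov_class m (L, \<sigma>))) i \<in> U} = {L \<in> little_intervals m. L i \<in> U}"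
    using s by (auto simp: rep_ov_class(2) conf_def)
  moreover have "openin (interval_top m) {L \<in> little_intervals m. L i \<in> U}"
    using openin_continuous_map_preimage[OF continuous_map_interval[OF assms(1)], of U] assms(2)
    by (simp add: topspace_interval_top)
  ultimately show "openin (interval_top m) {L \<in> little_intervals m. fst (rep (ov_class m (L, \<sigma>))) i \<in> U}" by simp
qed

lemma hrel_total:
  assumes "c \<in> conf m" "c' \<in> conf m" "fst c = fst c'" "(i, j) \<in> hrel m c" "(i, j) \<notin> hrel m c'"
  shows "(j, i) \<in> hrel m c'"
proof -
  have "i \<noteq> j" using assms(4) by (auto simp: hrel_def)
  then have "height (snd c') i \<noteq> height (snd c') j" using height_inj[OF assms(2)] by blast
  with assms show ?thesis by (auto simp: hrel_def interiors_meet_def)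
qed

text \<open>Classes with the same intervals differ in the order of some overlapping pair; the two
  orders exclude each other and both are open conditions. Otherwise some interval differs, and its
  position separates the classes.\<close>

lemma Hausdorff_Ov_top: "Hausdorff_space (Ov_top m)"
  unfolding Hausdorff_space_def topspace_Ov_top
proof (intro allI impI)
  fix q q' assume qq: "q \<in> ov_class m ` conf m \<and> q' \<in> ov_class m ` conf m \<and> q \<noteq> q'"
  then obtain c c' where c: "c \<in> conf m" "q = ov_class m c" "c' \<in> conf m" "q' = ov_class m c'" by auto
  note r = rep_ov_class(2)[OF c(1)] rep_ov_class(2)[OF c(3)] hrel_rep[OF c(1)] hrel_rep[OF c(3)]
  have sep: "\<exists>U V. openin (Ov_top m) U \<and> openin (Ov_top m) V \<and> q \<in> U \<and> q' \<in> V \<and> disjnt U V"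
    if ij: "(i, j) \<in> hrel m c" "(j, i) \<in> hrel m c'" for i j
  proof -
    have i: "i \<in> {1..m}" "j \<in> {1..m}" using ij by (auto simp: hrel_def)
    let ?U = "{q \<in> ov_class m ` conf m. (i, j) \<in> hrel m (rep q)}"
    let ?V = "{q \<in> ov_class m ` conf m. (j, i) \<in> hrel m (rep q)}"
    have "\<not> ((i, j) \<in> hrel m d \<and> (j, i) \<in> hrel m d)" for d by (auto simp: hrel_def)
    then have "disjnt ?U ?V" unfolding disjnt_iff by blast
    moreover have "q \<in> ?U" "q' \<in> ?V" using ij c r by simp_all
    ultimately show ?thesis using openin_Ov_hrel[OF i] openin_Ov_hrel[OF i(2,1)] by blast
  qed
  show "\<exists>U V. openin (Ov_top m) U \<and> openin (Ov_top m) V \<and> q \<in> U \<and> q' \<in> V \<and> disjnt U V"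
  proof (cases "fst c = fst c'")
    case True
    then have "otype m c \<noteq> otype m c'" using ov_class_eq c qq by blast
    then have "hrel m c \<noteq> hrel m c'" using True by (simp add: otype_def)
    then obtain i j where ij: "(i, j) \<in> hrel m c \<longleftrightarrow> (i, j) \<notin> hrel m c'" by auto
    show ?thesis
    proof (cases "(i, j) \<in> hrel m c")
      case True
      then show ?thesis using sep[of i j] hrel_total[OF c(1,3) \<open>fst c = fst c'\<close>] ij by blast
    next
      case False
      then show ?thesis using sep[of j i] hrel_total[OF c(3,1) \<open>fst c = fst c'\<close>[symmetric]] ij by blast
    qed
  next
    case False
    have "fst c \<in> extensional {1..m}" "fst c' \<in> extensional {1..m}"
      using c by (auto simp: conf_def little_intervals_def PiE_def)
    then obtain i where i: "i \<in> {1..m}" "fst c i \<noteq> fst c' i" using False extensionalityI by metis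
    obtain U V where "open U" "open V" "fst c i \<in> U" "fst c' i \<in> V" "U \<inter> V = {}"
      using hausdorff[OF i(2)] by blast
    then show ?thesis
      using openin_Ov_coord[OF i(1), of U] openin_Ov_coord[OF i(1), of V] c r
      by (intro exI[of _ "{q \<in> ov_class m ` conf m. fst (rep q) i \<in> U}"]
          exI[of _ "{q \<in> ov_class m ` conf m. fst (rep q) i \<in> V}"]) (auto simp: disjnt_def)
  qed
qed

lemma Ov1_subset: "Ov1 m \<subseteq> ov_class m ` conf m"
  by (auto simp: Ov1_def)

lemma topspace_Ov1_top: "topspace (Ov1_top m) = Ov1 m"
  using Ov1_subset by (auto simp: Ov1_top_def topspace_Ov_top)

lemma Hausdorff_Ov1_top: "Hausdorff_space (Ov1_top m)"
  unfolding Ov1_top_def by (intro Hausdorff_space_subtopology Hausdorff_Ov_top)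

text \<open>The tree may belong to another representative of the class; the order type carries
  \<open>normal\<close> over to \<open>c\<close>.\<close>

lemma Ov1_normal:
  assumes "1 \<le> m" "c \<in> conf m" "ov_class m c \<in> Ov1 m"
  shows "normal m c"
proof -
  obtain L \<sigma> A lab xb where *: "ov1_conf m \<sigma> A lab L xb" "ov_class m c = ov_class m (L, \<sigma>)"
    by (rule Ov1_rep[OF assms(1,3)])
  have "(L, \<sigma>) \<in> conf m" by (rule ov1_conf.conf[OF *(1)])
  then have "fst (L, \<sigma>) = fst c" "otype m (L, \<sigma>) = otype m c"
    using ov_class_eq[OF assms(2), of "(L, \<sigma>)"] *(2) by auto
  then show ?thesis by (rule normal_otype_cong[OF ov1_conf.normal[OF *(1)] assms(2)])
qed

definition cell_of :: "nat \<Rightarrow> ((nat \<times> bool) \<times> (nat \<times> bool)) set \<times> (nat \<times> nat) set \<Rightarrow>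
    ((nat \<Rightarrow> real \<times> real) \<times> (nat \<Rightarrow> nat)) set set" where
  "cell_of m \<tau> = {q \<in> Ov1 m. otype m (rep q) = \<tau>}"

text \<open>Ranging over points instead of order types, so that only types occurring in
  \<open>Ov1\<close> contribute and no cell is empty.\<close>

definition cells :: "nat \<Rightarrow> (((nat \<Rightarrow> real \<times> real) \<times> (nat \<Rightarrow> nat)) set set \<times> nat) set" where
  "cells m = (\<lambda>q. (cell_of m (otype m (rep q)), cell_dim m (otype m (rep q)))) ` Ov1 m"

section \<open>Characteristic maps\<close>

lemma continuous_map_moved:
  assumes T: "\<And>k. Suc k < nE m L \<Longrightarrow> continuous_map X euclideanreal (\<lambda>s. T s k)"
    and conf: "\<And>s. s \<in> topspace X \<Longrightarrow> (moved m L (T s), \<sigma>) \<in> conf m"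
    and \<sigma>: "\<sigma> \<in> perms m"
    and Ov1: "\<And>s. s \<in> topspace X \<Longrightarrow> ov_class m (moved m L (T s), \<sigma>) \<in> Ov1 m"
  shows "continuous_map X (Ov1_top m) (\<lambda>s. ov_class m (moved m L (T s), \<sigma>))"
proof -
  have P: "continuous_map X euclideanreal (\<lambda>s. push (ends m L) (T s) x)" for x
    unfolding push_def using T
    by (intro continuous_map_add continuous_map_sum finite_push_idx) auto
  have "continuous_map X euclidean (\<lambda>s. moved m L (T s) i)" if "i \<in> {1..m}" for i
  proof -
    have "continuous_map X (prod_topology euclideanreal euclideanreal) (\<lambda>s. moved m L (T s) i)"
      using that P by (simp add: moved_def continuous_map_pairedI del: prod_topology_euclidean)
    then show ?thesis by simp
  qed
  then have "continuous_map X (product_topology (\<lambda>_. euclidean) {1..m}) (\<lambda>s. moved m L (T s))"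
    unfolding continuous_map_componentwise by (auto simp: moved_def)
  then have "continuous_map X (interval_top m) (\<lambda>s. moved m L (T s))"
    using conf by (auto simp: continuous_map_in_subtopology conf_def interval_top_def)
  then have "continuous_map X (conf_top m) (\<lambda>s. (moved m L (T s), \<sigma>))"
    unfolding conf_top_eq using \<sigma> by (intro continuous_map_pairedI) auto
  from continuous_map_compose[OF this continuous_map_into_quotient[of _ "ov_class m"]]
  have "continuous_map X (Ov_top m) (\<lambda>s. ov_class m (moved m L (T s), \<sigma>))"
    by (simp add: Ov_top_def o_def)
  then show ?thesis using Ov1 by (auto simp: Ov1_top_def continuous_map_in_subtopology)
qed

lemma disc_subsets: "odisc n \<subseteq> disc n" "sphere_bd n \<subseteq> disc n"
  unfolding odisc_def disc_def sphere_bd_def by (rule subsetI, simp)+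

lemma moved_cong: "(\<And>k. Suc k < nE m L \<Longrightarrow> t k = t' k) \<Longrightarrow> moved m L t = moved m L t'"
  unfolding moved_def push_def by (intro ext) (auto intro!: sum.cong simp: restrict_def)

context ov1_conf
begin

text \<open>The actual segment lengths are the base point of the product of simplices, and
  \<open>\<Phi>\<close> deforms the configuration to the lengths given by \<open>T\<close>. Over the
  open disc all lengths are positive and the order type is kept; on the sphere some length is 0 and
  endpoints merge.\<close>

lemma char_map:
  defines "n \<equiv> nE m L - 1 - m"
  shows "\<exists>\<Phi>. embedding_map (disc_top n) (Ov1_top m) \<Phi> \<and> \<Phi> ` odisc n = cell_of m (otype m (L, \<sigma>)) \<and>
     (\<forall>s\<in>sphere_bd n. \<Phi> s \<in> Ov1 m \<and> cell_dim m (otype m (rep (\<Phi> s))) < n)"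
proof -
  let ?S = "segs m (L, \<sigma>)" and ?K = "{k. Suc k < nE m L}" and ?w = "\<lambda>k. endpt m L (Suc k) - endpt m L k"
  have K: "?K = (\<Union>i\<in>{1..m}. ?S i)" using segs_Union[OF normal] by simp
  have "?K = {..<nE m L - 1}" by auto
  then have n: "n = card ?K - card {1..m}" by (simp add: n_def)
  have I: "finite {1..m}" "{1..m} \<noteq> {}" using m1 by auto
  have S: "finite (?S i) \<and> ?S i \<noteq> {}" if "i \<in> {1..m}" for i
    using segs_nonempty[OF normal that] finite_segs by blast
  have disj: "?S i \<inter> ?S j = {}" if "i \<in> {1..m}" "j \<in> {1..m}" "i \<noteq> j" for i j
    using segs_disjoint[OF conf that(3)] .
  have pos: "0 < ?w k" if "k \<in> ?K" for k using en_less[OF finite_ends, of k "Suc k" m L] that by simp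
  show ?thesis
  proof (rule simplex_product_disc[where base = ?w, OF I S disj K n pos])
    fix T
    assume T: "\<And>k. k \<in> ?K \<Longrightarrow> continuous_map (disc_top n) euclideanreal (\<lambda>s. T s k)"
      and Tsum: "\<And>s i. i \<in> {1..m} \<Longrightarrow> (\<Sum>k\<in>?S i. T s k) = (\<Sum>k\<in>?S i. ?w k)"
      and Tnn: "\<And>s k. s \<in> disc n \<Longrightarrow> k \<in> ?K \<Longrightarrow> 0 \<le> T s k"
      and Tpos: "\<And>s k. s \<in> odisc n \<Longrightarrow> k \<in> ?K \<Longrightarrow> 0 < T s k"
      and Tz: "\<And>s. s \<in> sphere_bd n \<Longrightarrow> \<exists>k\<in>?K. T s k = 0"
      and Tinj: "\<And>s s'. s \<in> disc n \<Longrightarrow> s' \<in> disc n \<Longrightarrow> (\<And>k. k \<in> ?K \<Longrightarrow> T s k = T s' k) \<Longrightarrow> s = s'"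
      and Tsurj: "\<And>t. (\<And>k. k \<in> ?K \<Longrightarrow> 0 < t k) \<Longrightarrow> (\<And>i. i \<in> {1..m} \<Longrightarrow> (\<Sum>k\<in>?S i. t k) = (\<Sum>k\<in>?S i. ?w k)) \<Longrightarrow>
         \<exists>s\<in>odisc n. \<forall>k\<in>?K. T s k = t k"
    have sum2: "(\<Sum>k\<in>?S i. T s k) = 2 / real m" if "i \<in> {1..m}" for s i
      using Tsum[OF that] normal_sum[OF normal that] by simp
    define \<Phi> where "\<Phi> s = ov_class m (moved m L (T s), \<sigma>)" for s
    have cf: "(moved m L (T s), \<sigma>) \<in> conf m" if "s \<in> disc n" for s
      using moved_conf[OF normal sum2] Tnn[OF that] by simp
    have O1: "\<Phi> s \<in> Ov1 m" if "s \<in> disc n" for s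
      unfolding \<Phi>_def using moved_Ov1[of "T s", OF _ sum2] Tnn[OF that] by simp
    have "\<sigma> \<in> perms m" using conf by (simp add: conf_def)
    then have cont: "continuous_map (disc_top n) (Ov1_top m) \<Phi>"
      unfolding \<Phi>_def using T cf O1 by (intro continuous_map_moved) (auto simp: topspace_disc_top \<Phi>_def)
    have "inj_on \<Phi> (disc n)"
    proof (rule inj_onI)
      fix s s' assume s: "s \<in> disc n" "s' \<in> disc n" "\<Phi> s = \<Phi> s'"
      have "moved m L (T s) = moved m L (T s')"
        using s(3) ov_class_eq[OF cf[OF s(1)] cf[OF s(2)]] by (simp add: \<Phi>_def)
      then show "s = s'" using s moved_inj[OF normal] by (intro Tinj) auto
    qed
    then have emb: "embedding_map (disc_top n) (Ov1_top m) \<Phi>"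
      using injective_closed_imp_embedding_map[OF cont continuous_imp_closed_map[OF cont compact_disc_top Hausdorff_Ov1_top]]
      by (simp add: topspace_disc_top)
    have op: "\<Phi> ` odisc n = cell_of m (otype m (L, \<sigma>))"
    proof
      show "\<Phi> ` odisc n \<subseteq> cell_of m (otype m (L, \<sigma>))"
      proof
        fix q assume "q \<in> \<Phi> ` odisc n"
        then obtain s where s: "s \<in> odisc n" "q = \<Phi> s" by blast
        then have sd: "s \<in> disc n" using disc_subsets by blast
        have "otype m (rep q) = otype m (moved m L (T s), \<sigma>)"
          unfolding s(2) \<Phi>_def by (rule rep_ov_class(3)[OF cf[OF sd]])
        also have "\<dots> = otype m (L, \<sigma>)" using Tpos[OF s(1)] by (intro moved_otype) auto
        finally show "q \<in> cell_of m (otype m (L, \<sigma>))" using O1[OF sd] s(2) by (simp add: cell_of_def)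
      qed
      show "cell_of m (otype m (L, \<sigma>)) \<subseteq> \<Phi> ` odisc n"
      proof
        fix q assume "q \<in> cell_of m (otype m (L, \<sigma>))"
        then have q: "q \<in> Ov1 m" "otype m (L, \<sigma>) = otype m (rep q)" by (auto simp: cell_of_def)
        obtain c where c: "c \<in> conf m" "q = ov_class m c" using Ov1_subset q(1) by blast
        let ?c = "rep q"
        have cc: "?c \<in> conf m" "ov_class m ?c = q" using rep_ov_class[OF c(1)] c(2) by auto
        have nc: "normal m ?c" using Ov1_normal[OF m1 cc(1)] cc(2) q(1) by simp
        have nE': "nE m (fst ?c) = nE m L" using otype_enum(1)[OF q(2)] by simp
        let ?g = "\<lambda>k. endpt m (fst ?c) (Suc k) - endpt m (fst ?c) k"
        have tpos: "0 < ?g k" if "k \<in> ?K" for k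
          using en_less[OF finite_ends, of k "Suc k" m "fst ?c"] that nE' by simp
        have "(\<Sum>k\<in>?S i. ?g k) = (\<Sum>k\<in>?S i. ?w k)" if "i \<in> {1..m}" for i
          using normal_sum[OF nc that] normal_sum[OF normal that] otype_segs[OF q(2) conf cc(1)] by simp
        then obtain s where s: "s \<in> odisc n" "\<forall>k\<in>?K. T s k = ?g k" using Tsurj[of ?g] tpos by blast
        have sd: "s \<in> disc n" using s disc_subsets by blast
        have "moved m L (T s) = moved m L ?g" using s(2) by (intro moved_cong) simp
        also have "\<dots> = fst ?c" using otype_moved[OF q(2) normal_e0[OF nc] cc(1)] by simp
        finally have m: "moved m L (T s) = fst ?c" .
        have "otype m (moved m L (T s), \<sigma>) = otype m (L, \<sigma>)"
          using Tpos[OF s(1)] by (intro moved_otype) auto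
        then have "\<Phi> s = q"
          using ov_class_eq[OF cf[OF sd] cc(1)] m q(2) cc(2) by (simp add: \<Phi>_def)
        then show "q \<in> \<Phi> ` odisc n" using s(1) by blast
      qed
    qed
    have "\<Phi> s \<in> Ov1 m \<and> cell_dim m (otype m (rep (\<Phi> s))) < n" if s: "s \<in> sphere_bd n" for s
    proof -
      have sd: "s \<in> disc n" using s disc_subsets by blast
      have nm: "normal m (moved m L (T s), \<sigma>)"
        using Ov1_normal[OF m1 cf[OF sd]] O1[OF sd] by (simp add: \<Phi>_def)
      obtain k where k: "k \<in> ?K" "T s k = 0" using Tz[OF s] by blast
      have "nE m (moved m L (T s)) < nE m L"
        using Tnn[OF sd] k by (intro moved_otype_degenerate[of m L "T s" k]) auto
      moreover have "m < nE m (moved m L (T s))" using normal_nE[OF nm] by simp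
      moreover have "otype m (rep (\<Phi> s)) = otype m (moved m L (T s), \<sigma>)"
        unfolding \<Phi>_def by (rule rep_ov_class(3)[OF cf[OF sd]])
      ultimately show ?thesis using O1[OF sd] by (simp add: cell_dim_typ n_def)
    qed
    with emb op show ?thesis by blast
  qed
qed

end

lemma regular_CW_cells:
  assumes m: "1 \<le> m"
  shows "regular_CW_complex (Ov1_top m) (cells m)"
  unfolding regular_CW_complex_def
proof (intro conjI)
  show "Hausdorff_space (Ov1_top m)" by (rule Hausdorff_Ov1_top)
  have "cells m \<subseteq> (\<lambda>\<tau>. (cell_of m \<tau>, cell_dim m \<tau>)) ` range (otype m)"
    unfolding cells_def by (rule image_subsetI) blast
  then show "finite (cells m)" by (rule finite_subset) (intro finite_imageI finite_otype_range)
  show "\<Union> (fst ` cells m) = topspace (Ov1_top m)"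
    by (auto simp: cells_def cell_of_def topspace_Ov1_top)
  show "\<forall>c\<in>cells m. \<forall>c'\<in>cells m. c \<noteq> c' \<longrightarrow> fst c \<inter> fst c' = {}"
    by (auto simp: cells_def cell_of_def)
  show "\<forall>(en, n)\<in>cells m. \<exists>\<Phi>. embedding_map (disc_top n) (Ov1_top m) \<Phi> \<and> \<Phi> ` odisc n = en \<and>
        \<Phi> ` sphere_bd n \<subseteq> \<Union> {e'. \<exists>k<n. (e', k) \<in> cells m}"
  proof safe
    fix c n assume "(c, n) \<in> cells m"
    then obtain q where q: "q \<in> Ov1 m" "c = cell_of m (otype m (rep q))" "n = cell_dim m (otype m (rep q))"
      by (auto simp: cells_def)
    obtain L \<sigma> A lab xb where *: "ov1_conf m \<sigma> A lab L xb" "q = ov_class m (L, \<sigma>)"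
      by (rule Ov1_rep[OF m q(1)])
    have r: "otype m (rep q) = otype m (L, \<sigma>)"
      unfolding *(2) by (rule rep_ov_class(3)[OF ov1_conf.conf[OF *(1)]])
    have n: "n = nE m L - 1 - m" using q(3) r by (simp add: cell_dim_typ)
    obtain \<Phi> where \<Phi>: "embedding_map (disc_top n) (Ov1_top m) \<Phi>" "\<Phi> ` odisc n = c"
      "\<forall>s\<in>sphere_bd n. \<Phi> s \<in> Ov1 m \<and> cell_dim m (otype m (rep (\<Phi> s))) < n"
      using ov1_conf.char_map[OF *(1)] q(2) r n by metis
    have "\<Phi> ` sphere_bd n \<subseteq> \<Union> {e'. \<exists>k<n. (e', k) \<in> cells m}"
    proof
      fix x assume "x \<in> \<Phi> ` sphere_bd n"
      then have x: "x \<in> Ov1 m" "cell_dim m (otype m (rep x)) < n" using \<Phi>(3) by auto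
      then have "x \<in> cell_of m (otype m (rep x))" "(cell_of m (otype m (rep x)), cell_dim m (otype m (rep x))) \<in> cells m"
        by (auto simp: cell_of_def cells_def)
      then show "x \<in> \<Union> {e'. \<exists>k<n. (e', k) \<in> cells m}" using x(2) by blast
    qed
    then show "\<exists>\<Phi>. embedding_map (disc_top n) (Ov1_top m) \<Phi> \<and> \<Phi> ` odisc n = c \<and>
        \<Phi> ` sphere_bd n \<subseteq> \<Union> {e'. \<exists>k<n. (e', k) \<in> cells m}"
      using \<Phi>(1,2) by blast
  qed
qed

section \<open>The metric on cacti\<close>

lemma circ_dist_le: "circ_dist a b \<le> \<bar>a - b - of_int k\<bar>"
  unfolding circ_dist_def using round_diff_minimal[of "a - b" k] by simp

lemma circ_dist_nonneg: "0 \<le> circ_dist a b"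
  by (simp add: circ_dist_def)

lemma circ_dist_le_half: "circ_dist a b \<le> 1 / 2"
  unfolding circ_dist_def using of_int_round_abs_le[of "a - b"] by (simp add: abs_minus_commute)

lemma circ_dist_commute: "circ_dist a b = circ_dist b a"
proof -
  have "circ_dist x y \<le> circ_dist y x" for x y
    using circ_dist_le[of x y "- round (y - x)"] by (simp add: circ_dist_def abs_minus_commute algebra_simps)
  then show ?thesis by (intro antisym) auto
qed

lemma circ_dist_triangle: "circ_dist a c \<le> circ_dist a b + circ_dist b c"
proof -
  have "circ_dist a c \<le> \<bar>a - c - of_int (round (a - b) + round (b - c))\<bar>" by (rule circ_dist_le)
  also have "\<dots> \<le> \<bar>a - b - of_int (round (a - b))\<bar> + \<bar>b - c - of_int (round (b - c))\<bar>" by simp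
  finally show ?thesis by (simp add: circ_dist_def)
qed

lemma circ_dist_frac: "circ_dist (frac a) (frac b) \<le> \<bar>a - b\<bar>"
  using circ_dist_le[of "frac a" "frac b" "\<lfloor>b\<rfloor> - \<lfloor>a\<rfloor>"] by (simp add: frac_def)

lemma circ_dist_0_frac:
  assumes "circ_dist (frac a) (frac b) = 0" shows "frac a = frac b"
proof -
  have eq: "frac a - frac b = of_int (round (frac a - frac b))" using assms by (simp add: circ_dist_def)
  have "frac a < 1" "0 \<le> frac a" "frac b < 1" "0 \<le> frac b" by (auto simp: frac_lt_1)
  then have "-1 < frac a - frac b" "frac a - frac b < 1" by linarith+
  then have "-1 < (of_int (round (frac a - frac b)) :: real)" "(of_int (round (frac a - frac b)) :: real) < 1"
    using eq by linarith+
  then have "round (frac a - frac b) = 0" by linarith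
  then show ?thesis using eq by simp
qed

lemma frac_eq_imp_int:
  assumes "frac x = frac (x + d)" "0 < d" shows "1 \<le> (d::real)"
proof -
  have "d = of_int (\<lfloor>x + d\<rfloor> - \<lfloor>x\<rfloor>)" using assms(1) by (simp add: frac_def)
  then obtain k :: int where k: "d = of_int k" by blast
  then show ?thesis using assms(2) by simp
qed

lemma frac_shift: "frac (x + of_int k) = frac x"
  by (simp add: frac_def)

section \<open>Cacti are determined by their based maps\<close>

lemma arcs_obtain:
  assumes "finite_union_of_arcs S"
  obtains F where "finite F" "\<And>p. p \<in> F \<Longrightarrow> fst p < snd p" "S = (\<Union>p\<in>F. circ_arc (fst p) (snd p))"
proof -
  obtain F where F: "finite F" "\<forall>(a, b)\<in>F. a < b \<and> b \<le> a + 1" "S = (\<Union>(a, b)\<in>F. circ_arc a b)"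
    using assms unfolding finite_union_of_arcs_def by blast
  have "S = (\<Union>p\<in>F. circ_arc (fst p) (snd p))" unfolding F(3) by (auto simp: case_prod_beta)
  with F(1,2) show thesis by (intro that[of F]) auto
qed

text \<open>Measured from \<open>a\<close>, the arc is the initial piece of the circle of length
  \<open>b - a\<close>.\<close>

lemma lift_arc_iff: "(\<exists>w\<in>{a..b}. frac u = frac w) \<longleftrightarrow> frac (u - a) \<le> b - (a::real)"
proof
  assume "\<exists>w\<in>{a..b}. frac u = frac w"
  then obtain w where w: "a \<le> w" "w \<le> b" "frac u = frac w" by auto
  then have "u - a = (w - a) + of_int (\<lfloor>u\<rfloor> - \<lfloor>w\<rfloor>)" by (simp add: frac_def)
  then have "frac (u - a) = frac (w - a)" by (metis frac_shift)
  also have "\<dots> \<le> w - a" using w by (simp add: frac_def)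
  finally show "frac (u - a) \<le> b - a" using w by simp
next
  assume *: "frac (u - a) \<le> b - a"
  have "u = (a + frac (u - a)) + of_int \<lfloor>u - a\<rfloor>" by (simp add: frac_def)
  then have "frac u = frac (a + frac (u - a))" by (metis frac_shift)
  then show "\<exists>w\<in>{a..b}. frac u = frac w" using * by (intro bexI[of _ "a + frac (u - a)"]) auto
qed

text \<open>\<open>frac\<close> takes its least value at its jumps, so it is lower semicontinuous
  and its sublevel sets are closed.\<close>

lemma closed_lift_arc: "closed {u. frac (u - a) \<le> b - (a::real)}" if "a < b"
proof -
  have "\<exists>\<epsilon>>0. \<forall>y. dist y u < \<epsilon> \<longrightarrow> \<not> frac (y - a) \<le> b - a" if u: "\<not> frac (u - a) \<le> b - a" for u
  proof -
    let ?x = "frac (u - a)"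
    \<comment> \<open>Within this distance \<open>frac\<close> moves along with its argument without
      wrapping: it stays above \<open>b - a\<close>, which is positive, and below 1.\<close>
    let ?\<epsilon> = "min (?x - (b - a)) (1 - ?x)"
    have "0 < ?\<epsilon>" using u frac_lt_1[of "u - a"] by auto
    moreover have "\<not> frac (y - a) \<le> b - a" if y: "dist y u < ?\<epsilon>" for y
    proof -
      have b: "\<bar>y - u\<bar> < ?x - (b - a)" "\<bar>y - u\<bar> < 1 - ?x" using y by (auto simp: dist_real_def)
      have "frac (y - a) = ?x + (y - u)"
      proof (rule frac_unique_iff[THEN iffD2], intro conjI)
        have "y - a - (?x + (y - u)) = of_int \<lfloor>u - a\<rfloor>" by (simp add: frac_def)
        then show "y - a - (?x + (y - u)) \<in> \<int>" by simp
      qed (use b \<open>a < b\<close> in linarith)+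
      then show ?thesis using b by linarith
    qed
    ultimately show ?thesis by blast
  qed
  then have "open (- {u. frac (u - a) \<le> b - a})" unfolding open_dist by auto
  then show ?thesis by (simp add: open_closed)
qed

text \<open>As a subset of \<open>{0..<1}\<close> an arc that runs into the basepoint from the left
  is not closed; its periodic preimage in the line is.\<close>

lemma arcs_closed_lift:
  assumes "finite_union_of_arcs S"
  shows "closed {u. frac u \<in> S}"
proof -
  obtain F where F: "finite F" "\<And>p. p \<in> F \<Longrightarrow> fst p < snd p" "S = (\<Union>p\<in>F. circ_arc (fst p) (snd p))"
    using arcs_obtain[OF assms] by blast
  have "frac u \<in> circ_arc a b \<longleftrightarrow> frac (u - a) \<le> b - a" for u a b
    unfolding lift_arc_iff[symmetric] circ_arc_def by auto
  then have "{u. frac u \<in> S} = (\<Union>p\<in>F. {u. frac (u - fst p) \<le> snd p - fst p})"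
    unfolding F(3) by auto
  moreover have "closed \<dots>" using F(1) closed_lift_arc[OF F(2)] by (rule closed_UN[OF _ ballI])
  ultimately show ?thesis by simp
qed

lemma arcs_subset: "finite_union_of_arcs S \<Longrightarrow> S \<subseteq> {0..<1}"
  unfolding finite_union_of_arcs_def circ_arc_def by (auto simp: frac_lt_1)

lemma frac_self: "0 \<le> u \<Longrightarrow> u < 1 \<Longrightarrow> frac u = (u::real)"
  by (simp add: frac_eq)

lemma arcs_measurable:
  assumes "finite_union_of_arcs S" shows "S \<in> sets lborel"
proof -
  have "S = {u. frac u \<in> S} \<inter> {0..<1}" using arcs_subset[OF assms] by (auto simp: frac_self)
  moreover have "{u. frac u \<in> S} \<in> sets borel" using arcs_closed_lift[OF assms] by (rule borel_closed)
  ultimately show ?thesis by (metis atLeastLessThan_borel sets.Int sets_lborel)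
qed

text \<open>Every arc has positive length, so it continues from each of its points on at least one
  side.\<close>

lemma arcs_one_sided:
  assumes "finite_union_of_arcs S" "t \<in> S"
  obtains \<delta> where "0 < \<delta>" "(\<forall>x. 0 < x \<and> x < \<delta> \<longrightarrow> frac (t + x) \<in> S) \<or> (\<forall>x. 0 < x \<and> x < \<delta> \<longrightarrow> frac (t - x) \<in> S)"
proof -
  obtain F where F: "finite F" "\<And>p. p \<in> F \<Longrightarrow> fst p < snd p" "S = (\<Union>p\<in>F. circ_arc (fst p) (snd p))"
    using arcs_obtain[OF assms(1)] by blast
  obtain p where p: "p \<in> F" "t \<in> circ_arc (fst p) (snd p)"
    using assms(2) unfolding F(3) by blast
  define a b where "a = fst p" and "b = snd p"
  obtain w where w: "w \<in> {a..b}" "t = frac w" using p(2) by (auto simp: circ_arc_def a_def b_def)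
  have sub: "frac x \<in> S" if "x \<in> {a..b}" for x
  proof -
    have "frac x \<in> circ_arc (fst p) (snd p)" using that by (auto simp: circ_arc_def a_def b_def)
    then show ?thesis unfolding F(3) using p(1) by blast
  qed
  have fr: "frac (t + x) = frac (w + x)" for x
  proof -
    have "w + x = (t + x) + of_int \<lfloor>w\<rfloor>" using w(2) by (simp add: frac_def)
    then show ?thesis by (metis frac_shift)
  qed
  show thesis
  proof (cases "w < b")
    case True
    then show thesis using w sub fr by (intro that[of "b - w"]) auto
  next
    case False
    then have "a < w" using F(2)[OF p(1)] w(1) by (auto simp: a_def b_def)
    moreover have "frac (t - x) = frac (w - x)" for x using fr[of "- x"] by simp
    ultimately show thesis using w sub by (intro that[of "w - a"]) auto
  qed
qed

text \<open>Beside a point of \<open>P i - Q i\<close> there is a short interval inside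
  \<open>P i\<close> and outside \<open>Q i\<close>. Along it the coordinate of \<open>P\<close>
  advances by a positive amount below a full turn, while that of \<open>Q\<close> stands
  still.\<close>

lemma Cact1_gmap_inj_aux:
  assumes m: "1 \<le> m" and P: "finite_union_of_arcs (P i)" and Q: "finite_union_of_arcs (Q i)" and i: "i \<in> {1..m}"
    and eq: "\<And>s. s \<in> {0..<1} \<Longrightarrow> gmap m P s i = gmap m Q s i"
  shows "P i \<subseteq> Q i"
proof (rule ccontr)
  assume "\<not> P i \<subseteq> Q i"
  then obtain t where t: "t \<in> P i" "t \<notin> Q i" by blast
  have t01: "0 \<le> t" "t < 1" using arcs_subset[OF P] t by auto
  have "open (- {u. frac u \<in> Q i})" by (rule open_Compl[OF arcs_closed_lift[OF Q]])
  moreover have "t \<in> - {u. frac u \<in> Q i}" using t t01 by (simp add: frac_self)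
  ultimately obtain \<epsilon> where \<epsilon>: "0 < \<epsilon>" "\<And>u. \<bar>u - t\<bar> < \<epsilon> \<Longrightarrow> frac u \<notin> Q i"
    unfolding open_dist by (auto simp: dist_real_def)
  obtain \<delta> where \<delta>: "0 < \<delta>" "(\<forall>x. 0 < x \<and> x < \<delta> \<longrightarrow> frac (t + x) \<in> P i) \<or> (\<forall>x. 0 < x \<and> x < \<delta> \<longrightarrow> frac (t - x) \<in> P i)"
    using arcs_one_sided[OF P t(1)] by blast
  have "\<exists>x y. 0 < x \<and> x < y \<and> y < 1 \<and> y - x < 1 / real m \<and> (\<forall>u\<in>{x..y}. u \<in> P i \<and> u \<notin> Q i)"
    using \<delta>(2)
  proof
    assume R: "\<forall>x. 0 < x \<and> x < \<delta> \<longrightarrow> frac (t + x) \<in> P i"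
    \<comment> \<open>These bounds keep the interval in \<open>P i\<close>, off \<open>Q i\<close>,
      left of 1, and shorter than \<open>1 / m\<close>, that is, below a full turn of lobe
      \<open>i\<close>.\<close>
    define \<eta> where "\<eta> = min (min \<delta> \<epsilon>) (min (1 - t) (1 / real m))"
    have \<eta>: "0 < \<eta>" "\<eta> \<le> \<delta>" "\<eta> \<le> \<epsilon>" "\<eta> \<le> 1 - t" "\<eta> \<le> 1 / real m" using \<delta> \<epsilon> t01 m by (auto simp: \<eta>_def)
    have "u \<in> P i \<and> u \<notin> Q i" if "u \<in> {t + \<eta> / 3..t + \<eta> / 2}" for u
    proof -
      have u: "0 < u - t" "u - t < \<eta>" using that \<eta> by auto
      then have "frac u = u" using t01 \<eta> by (intro frac_self) auto
      then show ?thesis using R[rule_format, of "u - t"] \<epsilon>(2)[of u] u \<eta> by auto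
    qed
    then show ?thesis using \<eta> t01 by (intro exI[of _ "t + \<eta> / 3"] exI[of _ "t + \<eta> / 2"]) auto
  next
    assume R: "\<forall>x. 0 < x \<and> x < \<delta> \<longrightarrow> frac (t - x) \<in> P i"
    \<comment> \<open>Left of the basepoint 0 the circle continues below 1, so \<open>t = 0\<close>
      is replaced by 1.\<close>
    define T where "T = (if t = 0 then 1 else t)"
    have T: "0 < T" "T \<le> 1" using t01 by (auto simp: T_def)
    have fr: "frac (t - x) = frac (T - x)" for x
      using frac_shift[of "t - x" 1] by (auto simp: T_def algebra_simps)
    define \<eta> where "\<eta> = min (min \<delta> \<epsilon>) (min T (1 / real m))"
    have \<eta>: "0 < \<eta>" "\<eta> \<le> \<delta>" "\<eta> \<le> \<epsilon>" "\<eta> \<le> T" "\<eta> \<le> 1 / real m" using \<delta> \<epsilon> T m by (auto simp: \<eta>_def)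
    have "u \<in> P i \<and> u \<notin> Q i" if "u \<in> {T - \<eta> / 2..T - \<eta> / 3}" for u
    proof -
      have u: "0 < T - u" "T - u < \<eta>" using that \<eta> by auto
      then have "frac u = u" using T \<eta> by (intro frac_self) auto
      then show ?thesis using R[rule_format, of "T - u"] \<epsilon>(2)[of "t - (T - u)"] fr[of "T - u"] u \<eta> by auto
    qed
    then show ?thesis using \<eta> T by (intro exI[of _ "T - \<eta> / 2"] exI[of _ "T - \<eta> / 3"]) auto
  qed
  then obtain x y where xy: "0 < x" "x < y" "y < 1" "y - x < 1 / real m" "\<And>u. u \<in> {x..y} \<Longrightarrow> u \<in> P i \<and> u \<notin> Q i"
    by blast
  have fin: "emeasure lborel (S \<inter> {0..z}) < \<infinity>" for S :: "real set" and z
    using emeasure_mono[of "S \<inter> {0..z}" "{0..z}" lborel] emeasure_lborel_Icc_eq[of 0 z]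
    by (auto simp: le_less_trans less_top[symmetric] top_unique)
  have "P i \<inter> {0..y} = (P i \<inter> {0..x}) \<union> {x<..y}" using xy by auto
  moreover have "measure lborel ((P i \<inter> {0..x}) \<union> {x<..y}) = measure lborel (P i \<inter> {0..x}) + measure lborel {x<..y}"
    using fin[of "P i" x] arcs_measurable[OF P] xy(2) by (intro measure_Union) auto
  ultimately have MP: "measure lborel (P i \<inter> {0..y}) = measure lborel (P i \<inter> {0..x}) + (y - x)" using xy by simp
  have "Q i \<inter> {x<..y} = {}" using xy(5) by fastforce
  then have "Q i \<inter> {0..y} = Q i \<inter> {0..x}" using xy(2) by fastforce
  then have MQ: "gmap m Q y i = gmap m Q x i" by (simp add: gmap_def)
  have "gmap m P x i = gmap m P y i" using eq[of x] eq[of y] MQ xy by auto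
  then have "frac (real m * measure lborel (P i \<inter> {0..x})) = frac (real m * measure lborel (P i \<inter> {0..x}) + real m * (y - x))"
    using i by (simp add: gmap_def MP distrib_left)
  then have "1 \<le> real m * (y - x)" by (rule frac_eq_imp_int) (use xy m in simp)
  then show False using xy m by (simp add: field_simps)
qed

definition cact_set :: "nat \<Rightarrow> (nat \<Rightarrow> real set) \<Rightarrow> (nat \<Rightarrow> real set) \<Rightarrow> real set" where
  "cact_set m P Q = {circ_dist (gmap m P s i) (gmap m Q s i) | s i. s \<in> {0..<1} \<and> i \<in> {1..m}}"

lemma cact_dist_eq: "cact_dist m P Q = Sup (cact_set m P Q)"
  by (simp add: cact_dist_def cact_set_def)

lemma cact_dist_least:
  assumes "1 \<le> m" "\<And>s i. s \<in> {0..<1} \<Longrightarrow> i \<in> {1..m} \<Longrightarrow> circ_dist (gmap m P s i) (gmap m Q s i) \<le> z"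
  shows "cact_dist m P Q \<le> z"
proof -
  have "circ_dist (gmap m P 0 1) (gmap m Q 0 1) \<in> cact_set m P Q"
    using assms(1) unfolding cact_set_def by force
  then have "cact_set m P Q \<noteq> {}" by blast
  then show ?thesis unfolding cact_dist_eq by (rule cSup_least) (use assms(2) in \<open>auto simp: cact_set_def\<close>)
qed

lemma cact_dist_upper:
  assumes "s \<in> {0..<1}" "i \<in> {1..m}"
  shows "circ_dist (gmap m P s i) (gmap m Q s i) \<le> cact_dist m P Q"
  unfolding cact_dist_eq
proof (rule cSup_upper)
  show "circ_dist (gmap m P s i) (gmap m Q s i) \<in> cact_set m P Q" using assms by (auto simp: cact_set_def)
  show "bdd_above (cact_set m P Q)"
    using circ_dist_le_half by (intro bdd_aboveI[of _ "1 / 2"]) (auto simp: cact_set_def)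
qed

lemma Cact1_arcs: "P \<in> Cact1 m \<Longrightarrow> i \<in> {1..m} \<Longrightarrow> finite_union_of_arcs (P i)"
  and Cact1_empty: "P \<in> Cact1 m \<Longrightarrow> i \<notin> {1..m} \<Longrightarrow> P i = {}"
  by (simp_all add: Cact1_def)

text \<open>Makes the theory of \<open>mtopology\<close> applicable to \<open>Cact_top\<close>. The
  substantial axiom is separation: the based map determines the cactus.\<close>

lemma Metric_space_Cact1:
  assumes m: "1 \<le> m"
  shows "Metric_space (Cact1 m) (cact_dist m)"
proof
  show nn: "0 \<le> cact_dist m P Q" for P Q
    using cact_dist_upper[of 0 1 m P Q] circ_dist_nonneg[of "gmap m P 0 1" "gmap m Q 0 1"] m by auto
  show "cact_dist m P Q = cact_dist m Q P" for P Q
    unfolding cact_dist_def by (simp add: circ_dist_commute)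
  show "cact_dist m P R \<le> cact_dist m P Q + cact_dist m Q R" for P Q R
  proof (rule cact_dist_least[OF m])
    fix s :: real and i assume "s \<in> {0..<1}" "i \<in> {1..m}"
    then show "circ_dist (gmap m P s i) (gmap m R s i) \<le> cact_dist m P Q + cact_dist m Q R"
      using cact_dist_upper[of s i m P Q] cact_dist_upper[of s i m Q R]
        circ_dist_triangle[of "gmap m P s i" "gmap m R s i" "gmap m Q s i"] by linarith
  qed
  show "cact_dist m P Q = 0 \<longleftrightarrow> P = Q" if P: "P \<in> Cact1 m" and Q: "Q \<in> Cact1 m" for P Q
  proof
    assume "P = Q"
    then have "cact_dist m P Q \<le> 0" using m by (intro cact_dist_least) (auto simp: circ_dist_def)
    then show "cact_dist m P Q = 0" using nn[of P Q] by simp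
  next
    assume z: "cact_dist m P Q = 0"
    have g: "gmap m P s i = gmap m Q s i" if "s \<in> {0..<1}" "i \<in> {1..m}" for s i
    proof -
      have "circ_dist (gmap m P s i) (gmap m Q s i) = 0"
        using cact_dist_upper[OF that, of P Q] z circ_dist_nonneg[of "gmap m P s i" "gmap m Q s i"] by linarith
      then have "circ_dist (frac (real m * measure lborel (P i \<inter> {0..s}))) (frac (real m * measure lborel (Q i \<inter> {0..s}))) = 0"
        using that(2) by (simp add: gmap_def)
      from circ_dist_0_frac[OF this] show ?thesis using that(2) by (simp add: gmap_def)
    qed
    show "P = Q"
    proof
      fix i
      show "P i = Q i"
      proof (cases "i \<in> {1..m}")
        case True
        then have "finite_union_of_arcs (P i)" "finite_union_of_arcs (Q i)"
          using P Q by (simp_all add: Cact1_arcs)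
        then show ?thesis
          using Cact1_gmap_inj_aux[OF m _ _ True, of P Q] Cact1_gmap_inj_aux[OF m _ _ True, of Q P] g[OF _ True]
          by auto
      next
        case False
        then show ?thesis using P Q by (simp add: Cact1_empty)
      qed
    qed
  qed
qed

lemma openin_Cact_top:
  assumes "1 \<le> m"
  shows "openin (Cact_top m) U \<longleftrightarrow>
    U \<subseteq> Cact1 m \<and> (\<forall>P\<in>U. \<exists>r>0. \<forall>Q\<in>Cact1 m. cact_dist m P Q < r \<longrightarrow> Q \<in> U)"
proof -
  interpret Metric_space "Cact1 m" "cact_dist m" by (rule Metric_space_Cact1[OF assms])
  have ball: "mball P r \<subseteq> U \<longleftrightarrow> (\<forall>Q\<in>Cact1 m. cact_dist m P Q < r \<longrightarrow> Q \<in> U)" if "P \<in> Cact1 m" for P r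
    using that by (auto simp: mball_def)
  have *: "(\<forall>P\<in>U. \<exists>r>0. \<forall>Q\<in>Cact1 m. cact_dist m P Q < r \<longrightarrow> Q \<in> U) \<longleftrightarrow>
    (\<forall>P\<in>U. \<exists>r>0. mball P r \<subseteq> U)" if "U \<subseteq> Cact1 m"
    using that ball by (intro ball_cong refl ex_cong1 conj_cong) blast
  show ?thesis unfolding Cact_top_def openin_mtopology using * by (auto simp: Ball_def)
qed

lemma topspace_Cact_top: "1 \<le> m \<Longrightarrow> topspace (Cact_top m) = Cact1 m"
  using Metric_space.topspace_mtopology[OF Metric_space_Cact1] by (simp add: Cact_top_def)

section \<open>The cactus of a configuration\<close>

text \<open>The length of the part left of \<open>s\<close> of the segments in \<open>S\<close>: for
  increasing \<open>b\<close>, each summand is the length of \<open>[b k, b (Suc k)]\<close> cut off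
  at \<open>s\<close>.\<close>

definition seg_len :: "(nat \<Rightarrow> real) \<Rightarrow> nat set \<Rightarrow> real \<Rightarrow> real" where
  "seg_len b S s = (\<Sum>k\<in>S. min s (b (Suc k)) - min s (b k))"

text \<open>\<open>X\<close> absorbs the segment ends, at which membership in \<open>A\<close> is
  left open; finite sets are null.\<close>

lemma measure_segments:
  assumes S: "finite S" and b: "\<And>k. k \<in> S \<Longrightarrow> b k < b (Suc k)"
    and disj: "\<And>k l. k \<in> S \<Longrightarrow> l \<in> S \<Longrightarrow> k < l \<Longrightarrow> b (Suc k) \<le> b l"
    and X: "finite X" "\<And>z. z \<notin> X \<Longrightarrow> z \<in> A \<longleftrightarrow> z \<le> s \<and> (\<exists>k\<in>S. b k < z \<and> z < b (Suc k))"
  shows "A \<in> fmeasurable lborel" "measure lborel A = seg_len b S s"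
proof -
  let ?I = "\<lambda>k. {b k<..<b (Suc k)} \<inter> {..s}"
  let ?D = "\<Union>k\<in>S. ?I k"
  have I: "?I k \<in> fmeasurable lborel \<and> measure lborel (?I k) = min s (b (Suc k)) - min s (b k)" if "k \<in> S" for k
  proof -
    consider "s \<le> b k" | "b k < s" "s < b (Suc k)" | "b (Suc k) \<le> s" by linarith
    then show ?thesis
    proof cases
      case 1
      then have "?I k = {}" by auto
      then show ?thesis using 1 b[OF that] by simp
    next
      case 2
      then have eq: "?I k = {b k<..s}" by auto
      show ?thesis unfolding eq using 2 b[OF that] by (auto simp: fmeasurable_def)
    next
      case 3
      then have eq: "?I k = {b k<..<b (Suc k)}" using b[OF that] by auto
      show ?thesis unfolding eq using 3 b[OF that] by (auto simp: fmeasurable_def)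
    qed
  qed
  have D: "?D \<in> fmeasurable lborel" using S I by (intro fmeasurable.finite_UN) auto
  have "disjoint_family_on ?I S"
    unfolding disjoint_family_on_def
  proof (intro ballI impI)
    fix k l assume kl: "k \<in> S" "l \<in> S" "k \<noteq> l"
    then have "b (Suc k) \<le> b l \<or> b (Suc l) \<le> b k" using disj by (cases k l rule: linorder_cases) auto
    then show "?I k \<inter> ?I l = {}" by auto
  qed
  then have mD: "measure lborel ?D = seg_len b S s"
  proof -
    have "emeasure lborel (?I k) \<noteq> \<infinity>" "?I k \<in> sets lborel" if "k \<in> S" for k
      using conjunct1[OF I[OF that]] unfolding fmeasurable_def by (simp_all add: less_top)
    then have "measure lborel ?D = (\<Sum>k\<in>S. measure lborel (?I k))"
      using S \<open>disjoint_family_on ?I S\<close> by (intro measure_finite_Union) auto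
    then show ?thesis unfolding seg_len_def using I by simp
  qed
  let ?F1 = "?D - A" and ?F2 = "A - ?D"
  have "?F1 \<union> ?F2 \<subseteq> X"
  proof
    fix z assume "z \<in> ?F1 \<union> ?F2"
    then show "z \<in> X" using X(2)[of z] by (cases "z \<in> X") auto
  qed
  then have F: "finite ?F1" "finite ?F2" using X(1) finite_subset by blast+
  have A: "A = (?D - ?F1) \<union> ?F2" by blast
  have null: "?F1 \<in> null_sets lborel" "?F2 \<in> null_sets lborel"
    using F by (auto intro: finite_imp_null_set_lborel)
  then have fm: "?F1 \<in> fmeasurable lborel" "?F2 \<in> fmeasurable lborel"
    by (auto simp: fmeasurable_def null_sets_def)
  show "A \<in> fmeasurable lborel"
    by (subst A) (intro fmeasurable.Un fmeasurable.Diff D fm)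
  have "measure lborel A = measure lborel (?D - ?F1)"
    by (subst A) (intro measure_Un_null_set null fmeasurableD fmeasurable.Diff D fm)
  also have "\<dots> = measure lborel ?D"
    by (intro measure_Diff_null_set null fmeasurableD D)
  finally show "measure lborel A = seg_len b S s" using mD by simp
qed

abbreviation bp :: "nat \<Rightarrow> (nat \<Rightarrow> real \<times> real) \<Rightarrow> nat \<Rightarrow> real" where
  "bp m L k \<equiv> (endpt m L k + 1) / 2"

lemma cact_of_vis:
  assumes "c \<in> conf m" "i \<in> {1..m}"
  shows "cact_of m c i = (\<lambda>s. frac ((s + 1) / 2)) ` closure {z. visible m c i z}"
proof -
  have "{s \<in> {-1..1}. s \<in> {fst (fst c i)..snd (fst c i)} \<and>
           (\<forall>j\<in>{1..m}. s \<in> {fst (fst c j)..snd (fst c j)} \<longrightarrow> height (snd c) j \<le> height (snd c) i)} = {z. visible m c i z}"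
    using conf_bounds[OF assms] assms(2) by (auto simp: visible_def)
  then show ?thesis using assms(2) by (simp add: cact_of_def)
qed

lemma vis_iff_segs:
  assumes c: "c \<in> conf m" and z: "z \<notin> ends m (fst c)"
  shows "visible m c i z \<longleftrightarrow> (\<exists>k\<in>segs m c i. endpt m (fst c) k < z \<and> z < endpt m (fst c) (Suc k))"
proof
  assume v: "visible m c i z"
  then have i: "i \<in> {1..m}" "z \<in> {fst (fst c i)..snd (fst c i)}" by (auto simp: visible_def)
  note E = ends_I[OF i(1), of "fst c"]
  have "z \<noteq> fst (fst c i)" "z \<noteq> snd (fst c i)" using E z by metis+
  with i(2) have "fst (fst c i) < z" "z < snd (fst c i)" by auto
  then obtain k where k: "Suc k < nE m (fst c)" "endpt m (fst c) k < z" "z < endpt m (fst c) (Suc k)"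
    using en_locate[OF finite_ends E _ _ z] by blast
  then show "\<exists>k\<in>segs m c i. endpt m (fst c) k < z \<and> z < endpt m (fst c) (Suc k)"
    using vis_segs[OF k] v by blast
next
  assume "\<exists>k\<in>segs m c i. endpt m (fst c) k < z \<and> z < endpt m (fst c) (Suc k)"
  then show "visible m c i z" using vis_segs segs_index by metis
qed

text \<open>The visible set has no isolated points. If \<open>i\<close> is highest over an endpoint
  \<open>z\<close>, every interval over an adjacent segment also contains \<open>z\<close>, so
  \<open>i\<close> is visible on each adjacent segment that its own interval covers.\<close>

lemma vis_end_seg:
  assumes c: "c \<in> conf m" and v: "visible m c i z"
  shows "\<exists>k\<in>segs m c i. endpt m (fst c) k \<le> z \<and> z \<le> endpt m (fst c) (Suc k)"
proof (cases "z \<in> ends m (fst c)")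
  case False
  then show ?thesis using vis_iff_segs[OF c False] v by force
next
  case True
  have i: "i \<in> {1..m}" "fst (fst c i) \<le> z" "z \<le> snd (fst c i)" using v by (auto simp: visible_def)
  note cb = conf_bounds[OF c i(1)]
  have key: "k \<in> segs m c i"
    if k: "Suc k < nE m (fst c)" "endpt m (fst c) k \<le> z" "z \<le> endpt m (fst c) (Suc k)"
      "fst (fst c i) \<le> endpt m (fst c) k" "endpt m (fst c) (Suc k) \<le> snd (fst c i)" for k
  proof -
    note mb = mid_between[OF k(1)]
    have "visible m c i (mid m (fst c) k)"
      unfolding visible_def
    proof (intro conjI ballI impI)
      show "mid m (fst c) k \<in> {fst (fst c i)..snd (fst c i)}" using k mb by auto
      fix j assume j: "j \<in> {1..m}" "mid m (fst c) k \<in> {fst (fst c j)..snd (fst c j)}"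
      then have "z \<in> {fst (fst c j)..snd (fst c j)}" using seg_mem[OF k(1) mb j(1)] k by auto
      then show "height (snd c) j \<le> height (snd c) i" using v j(1) by (auto simp: visible_def)
    qed (rule i(1))
    then show ?thesis using k(1) by (simp add: segs_def)
  qed
  obtain n where n: "n < nE m (fst c)" "z = endpt m (fst c) n" using en_obtain[OF finite_ends True] by metis
  obtain p where p: "p < nE m (fst c)" "snd (fst c i) = endpt m (fst c) p"
    using en_obtain[OF finite_ends ends_I(2)[OF i(1)]] by metis
  obtain o' where o: "o' < nE m (fst c)" "fst (fst c i) = endpt m (fst c) o'"
    using en_obtain[OF finite_ends ends_I(1)[OF i(1)]] by metis
  note mono = en_mono[OF finite_ends, of _ _ m "fst c"] and less = en_less[OF finite_ends, of _ _ m "fst c"]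
  show ?thesis
  \<comment> \<open>If the interval of \<open>i\<close> continues to the right of \<open>z\<close>,
    the segment starting at \<open>z\<close> serves; at its right end the preceding segment
    does.\<close>
  proof (cases "z < snd (fst c i)")
    case True
    then have "n < p" using mono[of p n] n p by (cases "n < p") auto
    then have "n \<in> segs m c i" using n p i mono[of "Suc n" p] mono[of n "Suc n"] by (intro key) auto
    then show ?thesis using n mono[of n "Suc n"] segs_index[of n m c i] by (intro bexI[of _ n]) auto
  next
    case False
    then have z: "z = snd (fst c i)" using i by simp
    then have on: "o' < n" using mono[of n o'] n o cb by (cases "o' < n") auto
    then obtain n' where n': "n = Suc n'" by (cases n) auto
    have "n' \<in> segs m c i" using n n' o on z i mono[of n' n] mono[of o' n'] by (intro key) auto
    then show ?thesis using n n' mono[of n' n] by (intro bexI[of _ n']) auto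
  qed
qed

lemma closure_vis:
  assumes c: "c \<in> conf m"
  shows "closure {z. visible m c i z} = (\<Union>k\<in>segs m c i. {endpt m (fst c) k..endpt m (fst c) (Suc k)})" (is "_ = ?R")
proof
  have "closed ?R" by (intro closed_UN finite_segs) auto
  moreover have "{z. visible m c i z} \<subseteq> ?R" using vis_end_seg[OF c] by fastforce
  ultimately show "closure {z. visible m c i z} \<subseteq> ?R" by (rule closure_minimal[rotated])
  show "?R \<subseteq> closure {z. visible m c i z}"
  proof (rule UN_least)
    fix k assume k: "k \<in> segs m c i"
    have s: "Suc k < nE m (fst c)" using segs_index[OF k] by simp
    have l: "endpt m (fst c) k < endpt m (fst c) (Suc k)" using mid_between[OF s] by linarith
    have "{endpt m (fst c) k<..<endpt m (fst c) (Suc k)} \<subseteq> {z. visible m c i z}" using vis_segs[OF s] k by auto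
    then have "closure {endpt m (fst c) k<..<endpt m (fst c) (Suc k)} \<subseteq> closure {z. visible m c i z}" by (rule closure_mono)
    then show "{endpt m (fst c) k..endpt m (fst c) (Suc k)} \<subseteq> closure {z. visible m c i z}" using l by simp
  qed
qed

lemma cact_of_arcs:
  assumes "c \<in> conf m" "i \<in> {1..m}"
  shows "cact_of m c i = (\<Union>k\<in>segs m c i. circ_arc (bp m (fst c) k) (bp m (fst c) (Suc k)))"
proof -
  have "(\<lambda>s. frac ((s + 1) / 2)) ` {x..y} = circ_arc ((x + 1) / 2) ((y + 1) / 2)" for x y :: real
  proof -
    have "(\<lambda>s. (s + 1) / 2) ` {x..y} = {(x + 1) / 2..(y + 1) / 2}"
    proof (intro set_eqI iffI)
      fix w assume "w \<in> {(x + 1) / 2..(y + 1) / 2}"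
      then show "w \<in> (\<lambda>s. (s + 1) / 2) ` {x..y}" by (intro image_eqI[of _ _ "2 * w - 1"]) auto
    qed auto
    then show ?thesis unfolding circ_arc_def by (metis (no_types) image_image)
  qed
  then show ?thesis unfolding cact_of_vis[OF assms] closure_vis[OF assms(1)] image_UN by simp
qed

lemma e_bounds:
  assumes "c \<in> conf m" "k < nE m (fst c)"
  shows "-1 \<le> endpt m (fst c) k" "endpt m (fst c) k \<le> 1"
  using ends_ge[OF assms(1) en_in[OF finite_ends assms(2)]] by auto

text \<open>The basepoint is excluded because it may also arise from the value 1, which
  \<open>frac\<close> sends to 0.\<close>

lemma mem_cact:
  assumes c: "c \<in> conf m" and i: "i \<in> {1..m}" and u: "0 < u" "u < 1"
  shows "u \<in> cact_of m c i \<longleftrightarrow> (\<exists>k\<in>segs m c i. bp m (fst c) k \<le> u \<and> u \<le> bp m (fst c) (Suc k))"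
proof
  assume "u \<in> cact_of m c i"
  then obtain k x where k: "k \<in> segs m c i" "x \<in> {bp m (fst c) k..bp m (fst c) (Suc k)}" "u = frac x"
    unfolding cact_of_arcs[OF c i] circ_arc_def by auto
  have "0 \<le> x" "x \<le> 1" using k segs_index[OF k(1)] e_bounds[OF c, of k] e_bounds[OF c, of "Suc k"] by auto
  moreover have "x \<noteq> 1" using k(3) u by auto
  ultimately have "u = x" using k(3) by (simp add: frac_self)
  then show "\<exists>k\<in>segs m c i. bp m (fst c) k \<le> u \<and> u \<le> bp m (fst c) (Suc k)" using k by auto
next
  assume "\<exists>k\<in>segs m c i. bp m (fst c) k \<le> u \<and> u \<le> bp m (fst c) (Suc k)"
  then show "u \<in> cact_of m c i"
    unfolding cact_of_arcs[OF c i] circ_arc_def using u by (auto intro!: bexI image_eqI[of _ _ u] simp: frac_self)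
qed

lemma mem_cact_vis:
  assumes c: "c \<in> conf m" and i: "i \<in> {1..m}" and u: "0 < u" "u < 1" "2 * u - 1 \<notin> ends m (fst c)"
  shows "u \<in> cact_of m c i \<longleftrightarrow> visible m c i (2 * u - 1)"
proof -
  have ne: "bp m (fst c) k \<noteq> u" if "k < nE m (fst c)" for k
  proof
    assume "bp m (fst c) k = u"
    then have "endpt m (fst c) k = 2 * u - 1" by (simp add: field_simps)
    then show False using en_in[OF finite_ends that] u(3) by metis
  qed
  have "(bp m (fst c) k \<le> u \<and> u \<le> bp m (fst c) (Suc k)) \<longleftrightarrow>
    (endpt m (fst c) k < 2 * u - 1 \<and> 2 * u - 1 < endpt m (fst c) (Suc k))" if "k \<in> segs m c i" for k
    using ne[of k] ne[of "Suc k"] segs_index[OF that] by auto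
  then show ?thesis unfolding mem_cact[OF c i u(1,2)] vis_iff_segs[OF c u(3)] by blast
qed

lemma seg_order:
  assumes "k \<in> segs m c i" "l \<in> segs m c i'" "k < l"
  shows "endpt m (fst c) (Suc k) \<le> endpt m (fst c) l"
  using assms segs_index[OF assms(2)] by (intro en_mono[OF finite_ends]) auto

lemma seg_pos:
  assumes "k \<in> segs m c i" shows "endpt m (fst c) k < endpt m (fst c) (Suc k)"
  using segs_index[OF assms] by (intro en_less[OF finite_ends]) auto

lemma measure_vis:
  assumes c: "c \<in> conf m"
  shows "{z. visible m c i z \<and> z \<le> x} \<in> fmeasurable lborel"
    "measure lborel {z. visible m c i z \<and> z \<le> x} = seg_len (endpt m (fst c)) (segs m c i) x"
proof -
  have *: "z \<in> {z. visible m c i z \<and> z \<le> x} \<longleftrightarrow> z \<le> x \<and> (\<exists>k\<in>segs m c i. endpt m (fst c) k < z \<and> z < endpt m (fst c) (Suc k))"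
    if "z \<notin> ends m (fst c)" for z using vis_iff_segs[OF c that] by auto
  show "{z. visible m c i z \<and> z \<le> x} \<in> fmeasurable lborel"
    by (rule measure_segments(1)[OF finite_segs seg_pos seg_order finite_ends *])
  show "measure lborel {z. visible m c i z \<and> z \<le> x} = seg_len (endpt m (fst c)) (segs m c i) x"
    by (rule measure_segments(2)[OF finite_segs seg_pos seg_order finite_ends *])
qed

lemma measure_cact:
  assumes c: "c \<in> conf m" and i: "i \<in> {1..m}"
  shows "measure lborel (cact_of m c i \<inter> {0..s}) = seg_len (bp m (fst c)) (segs m c i) s"
proof (rule measure_segments(2)[OF finite_segs])
  show "finite ({0, 1} \<union> (\<lambda>z. (z + 1) / 2) ` ends m (fst c))" using finite_ends by auto
  fix u assume u: "u \<notin> {0, 1} \<union> (\<lambda>z. (z + 1) / 2) ` ends m (fst c)"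
  have ne: "bp m (fst c) k \<noteq> u" if "k < nE m (fst c)" for k
  proof -
    have "bp m (fst c) k \<in> (\<lambda>z. (z + 1) / 2) ` ends m (fst c)" using en_in[OF finite_ends that] by (rule imageI)
    then show ?thesis using u by auto
  qed
  show "u \<in> cact_of m c i \<inter> {0..s} \<longleftrightarrow> u \<le> s \<and> (\<exists>k\<in>segs m c i. bp m (fst c) k < u \<and> u < bp m (fst c) (Suc k))"
  proof (cases "0 < u \<and> u < 1")
    case True
    have "(bp m (fst c) k \<le> u \<and> u \<le> bp m (fst c) (Suc k)) \<longleftrightarrow> (bp m (fst c) k < u \<and> u < bp m (fst c) (Suc k))"
      if "k \<in> segs m c i" for k
      using ne[of k] ne[of "Suc k"] segs_index[OF that] by auto
    then show ?thesis using mem_cact[OF c i, of u] True by auto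
  next
    case False
    have "u \<notin> cact_of m c i"
    proof
      assume "u \<in> cact_of m c i"
      then have "0 \<le> u" "u < 1" unfolding cact_of_arcs[OF c i] circ_arc_def by (auto simp: frac_lt_1)
      then show False using False u by auto
    qed
    moreover have "\<not> (bp m (fst c) k < u \<and> u < bp m (fst c) (Suc k))" if "k \<in> segs m c i" for k
      using False e_bounds[OF c, of k] e_bounds[OF c, of "Suc k"] segs_index[OF that] by auto
    ultimately show ?thesis by blast
  qed
next
  show "bp m (fst c) k < bp m (fst c) (Suc k)" if "k \<in> segs m c i" for k
    using seg_pos[OF that] by simp
  show "bp m (fst c) (Suc k) \<le> bp m (fst c) l" if "k \<in> segs m c i" "l \<in> segs m c i" "k < l" for k l
    using seg_order[OF that] by simp
qed

lemma seg_len_affine: "seg_len (bp m L) S s = seg_len (endpt m L) S (2 * s - 1) / 2"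
proof -
  have *: "min s ((x + 1) / 2) - min s ((y + 1) / 2) = (min (2 * s - 1) x - min (2 * s - 1) y) / 2" for x y :: real
    by (simp add: min_def field_simps)
  show ?thesis unfolding seg_len_def * by (simp add: sum_divide_distrib)
qed

text \<open>Two forms of a coordinate: by segments, for locating the black points, and by
  visibility, for continuity.\<close>

lemma gmap_cact:
  assumes c: "c \<in> conf m" and i: "i \<in> {1..m}"
  shows "gmap m (cact_of m c) s i = frac (real m * seg_len (bp m (fst c)) (segs m c i) s)"
    "gmap m (cact_of m c) s i = frac (real m / 2 * measure lborel {z. visible m c i z \<and> z \<le> 2 * s - 1})"
  using i by (simp_all add: gmap_def measure_cact[OF c i] measure_vis[OF c] seg_len_affine)

lemma seg_len_all:
  assumes "\<And>k. k \<in> S \<Longrightarrow> b k \<le> s \<and> b (Suc k) \<le> s"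
  shows "seg_len b S s = (\<Sum>k\<in>S. b (Suc k) - b k)"
  unfolding seg_len_def using assms by (intro sum.cong) auto

lemma seg_len_none:
  assumes "\<And>k. k \<in> S \<Longrightarrow> s \<le> b k \<and> s \<le> b (Suc k)"
  shows "seg_len b S s = 0"
  unfolding seg_len_def using assms by (intro sum.neutral) auto

lemma seg_len_total:
  assumes n: "normal m c" and i: "i \<in> {1..m}"
  shows "seg_len (bp m (fst c)) (segs m c i) 1 = 1 / real m"
proof -
  have "endpt m (fst c) k \<le> 1 \<and> endpt m (fst c) (Suc k) \<le> 1" if "k \<in> segs m c i" for k
    using segs_index[OF that] e_bounds(2)[OF normal_conf[OF n], of k] e_bounds(2)[OF normal_conf[OF n], of "Suc k"] by auto
  then have "seg_len (endpt m (fst c)) (segs m c i) 1 = 2 / real m"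
    using normal_sum[OF n i] by (simp add: seg_len_all)
  then show ?thesis by (simp add: seg_len_affine)
qed

lemma normal_seg:
  assumes n: "normal m c" and z: "-1 \<le> z" "z < 1"
  obtains i k where "i \<in> {1..m}" "k \<in> segs m c i" "endpt m (fst c) k \<le> z" "z < endpt m (fst c) (Suc k)"
proof -
  have "\<exists>k. Suc k < nE m (fst c) \<and> endpt m (fst c) k \<le> z \<and> z < endpt m (fst c) (Suc k)"
  proof (cases "z \<in> ends m (fst c)")
    case True
    then obtain k where k: "k < nE m (fst c)" "z = endpt m (fst c) k" using en_obtain[OF finite_ends] by metis
    have "k \<noteq> nE m (fst c) - 1" using k z normal_elast[OF n] by auto
    then have "Suc k < nE m (fst c)" using k by simp
    then show ?thesis using k en_less[OF finite_ends, of k "Suc k" m "fst c"] by auto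
  next
    case False
    have "-1 \<in> ends m (fst c)" "1 \<in> ends m (fst c)" using n by (auto simp: normal_def)
    moreover have "-1 < z" using False z \<open>-1 \<in> ends m (fst c)\<close> by (cases "z = -1") auto
    ultimately obtain k where "Suc k < nE m (fst c)" "endpt m (fst c) k < z" "z < endpt m (fst c) (Suc k)"
      using en_locate[OF finite_ends _ _ _ z(2) False] by blast
    then show ?thesis by (intro exI[of _ k]) auto
  qed
  then obtain k where k: "Suc k < nE m (fst c)" "endpt m (fst c) k \<le> z" "z < endpt m (fst c) (Suc k)" by blast
  then have "k \<in> (\<Union>i\<in>{1..m}. segs m c i)" using segs_Union[OF n] by auto
  then show thesis using that k by blast
qed

text \<open>Only points to the right of \<open>s\<close> and below 1 are considered: there
  \<open>frac\<close> changes nothing, so the basepoint is no exception.\<close>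

lemma circ_interior_vis:
  assumes c: "c \<in> conf m" and i: "i \<in> {1..m}" and s: "s \<in> circ_interior (cact_of m c i)"
  obtains \<delta> where "0 < \<delta>" "s + \<delta> \<le> 1" "0 \<le> s"
    "\<And>u. s < u \<Longrightarrow> u < s + \<delta> \<Longrightarrow> 2 * u - 1 \<notin> ends m (fst c) \<Longrightarrow> visible m c i (2 * u - 1)"
proof -
  obtain r where r: "0 < r" "\<And>u. \<bar>u - s\<bar> < r \<Longrightarrow> frac u \<in> cact_of m c i" and s01: "0 \<le> s" "s < 1"
    using s by (auto simp: circ_interior_def)
  have "visible m c i (2 * u - 1)" if "s < u" "u < s + min r (1 - s)" "2 * u - 1 \<notin> ends m (fst c)" for u
  proof -
    have u: "0 < u" "u < 1" "\<bar>u - s\<bar> < r" using that s01 by auto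
    then have "u \<in> cact_of m c i" using r(2)[OF u(3)] by (simp add: frac_self)
    then show ?thesis using mem_cact_vis[OF c i u(1,2) that(3)] by simp
  qed
  then show thesis using r s01 by (intro that[of "min r (1 - s)"]) auto
qed

text \<open>An interior point may be a segment end, where visibility is ambiguous. It is moved
  slightly to the right, staying before \<open>t\<close>, so that the order of several such points
  survives.\<close>

lemma circ_interior_point:
  assumes c: "c \<in> conf m" and i: "i \<in> {1..m}" and s: "s \<in> circ_interior (cact_of m c i)" and t: "s < t"
  obtains u where "s < u" "u < t" "2 * u - 1 \<notin> ends m (fst c)" "visible m c i (2 * u - 1)"
proof -
  obtain \<delta> where \<delta>: "0 < \<delta>" "\<And>u. s < u \<Longrightarrow> u < s + \<delta> \<Longrightarrow> 2 * u - 1 \<notin> ends m (fst c) \<Longrightarrow> visible m c i (2 * u - 1)"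
    using circ_interior_vis[OF c i s] by metis
  obtain u where u: "s < u" "u < min t (s + \<delta>)" "u \<notin> (\<lambda>z. (z + 1) / 2) ` ends m (fst c)"
    using avoid_finite[of "(\<lambda>z. (z + 1) / 2) ` ends m (fst c)" s "min t (s + \<delta>)"] finite_ends t \<delta>(1) by auto
  have "2 * u - 1 \<notin> ends m (fst c)"
  proof
    assume "2 * u - 1 \<in> ends m (fst c)"
    then have "((2 * u - 1) + 1) / 2 \<in> (\<lambda>z. (z + 1) / 2) ` ends m (fst c)" by (rule imageI)
    then show False using u(3) by simp
  qed
  then show thesis using u \<delta> that[of u] by auto
qed

lemma cact_Cact1:
  assumes n: "normal m c"
  shows "cact_of m c \<in> Cact1 m"
  unfolding Cact1_def mem_Collect_eq
proof (intro conjI ballI allI impI)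
  note c = normal_conf[OF n]
  show "cact_of m c i = {}" if "i \<notin> {1..m}" for i using that unfolding cact_of_def by (rule if_not_P)
  show "finite_union_of_arcs (cact_of m c i)" if i: "i \<in> {1..m}" for i
    unfolding finite_union_of_arcs_def
  proof (intro exI conjI)
    let ?F = "(\<lambda>k. (bp m (fst c) k, bp m (fst c) (Suc k))) ` segs m c i"
    show "finite ?F" using finite_segs by blast
    have "bp m (fst c) k < bp m (fst c) (Suc k) \<and> bp m (fst c) (Suc k) \<le> bp m (fst c) k + 1" if "k \<in> segs m c i" for k
    proof -
      have "0 \<le> bp m (fst c) k" "bp m (fst c) (Suc k) \<le> 1"
        using segs_index[OF that] e_bounds[OF c, of k] e_bounds[OF c, of "Suc k"] by auto
      moreover have "bp m (fst c) k < bp m (fst c) (Suc k)" using seg_pos[OF that] by simp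
      ultimately show ?thesis by (intro conjI) linarith+
    qed
    then show "\<forall>(a, b)\<in>?F. a < b \<and> b \<le> a + 1" by auto
    show "cact_of m c i = (\<Union>(a, b)\<in>?F. circ_arc a b)" unfolding cact_of_arcs[OF c i] by auto
  qed
  show "measure lborel (cact_of m c i) = 1 / real m" if i: "i \<in> {1..m}" for i
  proof -
    have "cact_of m c i \<inter> {0..1} = cact_of m c i"
      unfolding cact_of_arcs[OF c i] circ_arc_def by (auto simp: less_imp_le frac_lt_1)
    then show ?thesis using measure_cact[OF c i, of 1] seg_len_total[OF n i] by simp
  qed
  show "circ_interior (cact_of m c i) \<inter> circ_interior (cact_of m c j) = {}"
    if ij: "i \<in> {1..m}" "j \<in> {1..m}" "i \<noteq> j" for i j
  proof (rule ccontr)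
    assume "circ_interior (cact_of m c i) \<inter> circ_interior (cact_of m c j) \<noteq> {}"
    then obtain s where s: "s \<in> circ_interior (cact_of m c i)" "s \<in> circ_interior (cact_of m c j)" by blast
    obtain \<delta> where \<delta>: "0 < \<delta>" "\<And>u. s < u \<Longrightarrow> u < s + \<delta> \<Longrightarrow> 2 * u - 1 \<notin> ends m (fst c) \<Longrightarrow> visible m c i (2 * u - 1)"
      using circ_interior_vis[OF c ij(1) s(1)] by metis
    obtain u where "s < u" "u < s + \<delta>" "2 * u - 1 \<notin> ends m (fst c)" "visible m c j (2 * u - 1)"
      using circ_interior_point[OF c ij(2) s(2), of "s + \<delta>"] \<delta>(1) by auto
    then show False using \<delta>(2) vis_unique[OF c] ij(3) by blast
  qed
  show "(\<Union>i\<in>{1..m}. cact_of m c i) = {0..<1}"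
  proof
    show "(\<Union>i\<in>{1..m}. cact_of m c i) \<subseteq> {0..<1}"
      using cact_of_arcs[OF c] by (auto simp: circ_arc_def frac_lt_1)
    show "{0..<1} \<subseteq> (\<Union>i\<in>{1..m}. cact_of m c i)"
    proof
      fix u :: real assume u: "u \<in> {0..<1}"
      then obtain i k where ik: "i \<in> {1..m}" "k \<in> segs m c i" "endpt m (fst c) k \<le> 2 * u - 1" "2 * u - 1 < endpt m (fst c) (Suc k)"
        using normal_seg[OF n, of "2 * u - 1"] by auto
      then have "u \<in> {bp m (fst c) k..bp m (fst c) (Suc k)}" by auto
      then have "frac u \<in> circ_arc (bp m (fst c) k) (bp m (fst c) (Suc k))" unfolding circ_arc_def by (rule imageI)
      then have "u \<in> cact_of m c i" unfolding cact_of_arcs[OF c ik(1)] using ik(2) u by (auto simp: frac_self)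
      then show "u \<in> (\<Union>i\<in>{1..m}. cact_of m c i)" using ik(1) by blast
    qed
  qed
  show "\<not> (\<exists>i\<in>{1..m}. \<exists>j\<in>{1..m}. \<exists>s1 s2 s3 s4. i \<noteq> j \<and>
          0 \<le> s1 \<and> s1 < s2 \<and> s2 < s3 \<and> s3 < s4 \<and> s4 < 1 \<and>
          s1 \<in> circ_interior (cact_of m c i) \<and> s2 \<in> circ_interior (cact_of m c j) \<and>
          s3 \<in> circ_interior (cact_of m c i) \<and> s4 \<in> circ_interior (cact_of m c j))"
  proof
    assume "\<exists>i\<in>{1..m}. \<exists>j\<in>{1..m}. \<exists>s1 s2 s3 s4. i \<noteq> j \<and>
          0 \<le> s1 \<and> s1 < s2 \<and> s2 < s3 \<and> s3 < s4 \<and> s4 < 1 \<and>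
          s1 \<in> circ_interior (cact_of m c i) \<and> s2 \<in> circ_interior (cact_of m c j) \<and>
          s3 \<in> circ_interior (cact_of m c i) \<and> s4 \<in> circ_interior (cact_of m c j)"
    then obtain i j s1 s2 s3 s4 where ij: "i \<in> {1..m}" "j \<in> {1..m}" "i \<noteq> j"
      and lt: "s1 < s2" "s2 < s3" "s3 < s4" "s4 < 1"
      and s: "s1 \<in> circ_interior (cact_of m c i)" "s2 \<in> circ_interior (cact_of m c j)"
          "s3 \<in> circ_interior (cact_of m c i)" "s4 \<in> circ_interior (cact_of m c j)" by blast
    obtain u1 where u1: "s1 < u1" "u1 < s2" "2 * u1 - 1 \<notin> ends m (fst c)" "visible m c i (2 * u1 - 1)"
      by (rule circ_interior_point[OF c ij(1) s(1) lt(1)])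
    obtain u2 where u2: "s2 < u2" "u2 < s3" "2 * u2 - 1 \<notin> ends m (fst c)" "visible m c j (2 * u2 - 1)"
      by (rule circ_interior_point[OF c ij(2) s(2) lt(2)])
    obtain u3 where u3: "s3 < u3" "u3 < s4" "2 * u3 - 1 \<notin> ends m (fst c)" "visible m c i (2 * u3 - 1)"
      by (rule circ_interior_point[OF c ij(1) s(3) lt(3)])
    obtain u4 where u4: "s4 < u4" "u4 < 1" "2 * u4 - 1 \<notin> ends m (fst c)" "visible m c j (2 * u4 - 1)"
      by (rule circ_interior_point[OF c ij(2) s(4) lt(4)])
    have "2 * u1 - 1 < 2 * u2 - 1" "2 * u2 - 1 < 2 * u3 - 1" "2 * u3 - 1 < 2 * u4 - 1" using u1 u2 u3 u4 by auto
    then have "i = j" using n u1 u2 u3 u4 unfolding normal_def by blast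
    then show False using ij(3) by simp
  qed
qed

section \<open>Cellularity\<close>

lemma min_diff_mono: "b \<le> b' \<Longrightarrow> x \<le> y \<Longrightarrow> min x b' - min x b \<le> min y b' - min y (b::real)"
  by (simp add: min_def)

lemma seg_len_mono:
  assumes "\<And>k. k \<in> S \<Longrightarrow> b k \<le> b (Suc k)" "x \<le> y"
  shows "seg_len b S x \<le> seg_len b S y"
  unfolding seg_len_def using assms by (intro sum_mono min_diff_mono) auto

lemma seg_len_increase:
  assumes S: "finite S" "k \<in> S" and b: "\<And>k. k \<in> S \<Longrightarrow> b k \<le> b (Suc k)" and xy: "b k \<le> x" "x \<le> y" "y \<le> b (Suc k)"
  shows "seg_len b S x + (y - x) \<le> seg_len b S y"
proof -
  have "(\<Sum>l\<in>S - {k}. min x (b (Suc l)) - min x (b l)) \<le> (\<Sum>l\<in>S - {k}. min y (b (Suc l)) - min y (b l))"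
    using b xy(2) by (intro sum_mono min_diff_mono) auto
  moreover have "min x (b (Suc k)) - min x (b k) + (y - x) = min y (b (Suc k)) - min y (b k)"
    using xy by (simp add: min_def)
  ultimately show ?thesis unfolding seg_len_def using sum.remove[OF S, of "\<lambda>l. min x (b (Suc l)) - min x (b l)"]
      sum.remove[OF S, of "\<lambda>l. min y (b (Suc l)) - min y (b l)"] by linarith
qed

text \<open>Replacing \<open>f i\<close> by \<open>g i\<close> moves to the right, so every value of \<open>H\<close> is attained outside \<open>f ` I\<close>.\<close>

lemma card_chain:
  fixes H :: "nat \<Rightarrow> 'b"
  assumes I: "inj_on f I" "finite I" and f: "\<And>i. i \<in> I \<Longrightarrow> f i < g i \<and> g i < N \<and> H (f i) = H (g i)"
  shows "card (H ` {..<N}) \<le> N - card I"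
proof -
  have "\<exists>n'\<in>{..<N} - f ` I. H n = H n'" if "n < N" for n
    using that
  proof (induction "N - n" arbitrary: n rule: less_induct)
    case less
    show ?case
    proof (cases "n \<in> f ` I")
      case True
      then obtain i where i: "i \<in> I" "n = f i" by blast
      have "N - g i < N - n" "g i < N" using f[OF i(1)] less.prems i(2) by auto
      from less.hyps[OF this] obtain n' where "n' \<in> {..<N} - f ` I" "H (g i) = H n'" by blast
      then show ?thesis using f[OF i(1)] i(2) by auto
    qed (use less.prems in auto)
  qed
  then have "H ` {..<N} \<subseteq> H ` ({..<N} - f ` I)" by blast
  then have "card (H ` {..<N}) \<le> card (H ` ({..<N} - f ` I))" by (intro card_mono) auto
  also have "\<dots> \<le> card ({..<N} - f ` I)" by (intro card_image_le) auto
  also have "\<dots> = N - card (f ` I)"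
  proof -
    have "f ` I \<subseteq> {..<N}" using f by force
    then show ?thesis using I(2) by (subst card_Diff_subset) auto
  qed
  also have "\<dots> = N - card I" using I(1) by (simp add: card_image)
  finally show ?thesis .
qed

lemma segs_noncrossing:
  assumes n: "normal m c" and k: "k1 < k2" "k2 < k3" "k3 < k4"
    and s: "k1 \<in> segs m c i" "k2 \<in> segs m c j" "k3 \<in> segs m c i" "k4 \<in> segs m c j"
  shows "i = j"
proof -
  let ?z = "mid m (fst c)"
  have lt: "?z k < ?z l" if "k < l" "Suc l < nE m (fst c)" for k l
    using mid_between(2)[of k m "fst c"] mid_between(1)[OF that(2)] en_mono[OF finite_ends, of "Suc k" l m "fst c"] that by auto
  have ne: "?z k \<notin> ends m (fst c)" if "Suc k < nE m (fst c)" for k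
    by (rule seg_not_end[OF that mid_between[OF that]])
  have v: "visible m c i (?z k1)" "visible m c j (?z k2)" "visible m c i (?z k3)" "visible m c j (?z k4)"
    using s by (auto simp: segs_def)
  have idx: "Suc k1 < nE m (fst c)" "Suc k2 < nE m (fst c)" "Suc k3 < nE m (fst c)" "Suc k4 < nE m (fst c)"
    using segs_index s by blast+
  have "{?z k1, ?z k2, ?z k3, ?z k4} \<inter> ends m (fst c) = {}" using ne idx by auto
  moreover have "?z k1 < ?z k2" "?z k2 < ?z k3" "?z k3 < ?z k4" using lt k idx by auto
  ultimately show ?thesis using n v unfolding normal_def by blast
qed

section \<open>Black points of the cactus of a normal configuration\<close>

locale normal_config =
  fixes m c
  assumes n: "normal m c"
begin

abbreviation "N \<equiv> nE m (fst c)"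
abbreviation "a \<equiv> bp m (fst c)"
text \<open>The length of lobe \<open>i\<close> traversed up to a given parameter; \<open>m\<close>
  times it is coordinate \<open>i\<close> of the based map before reduction modulo 1.\<close>

abbreviation "G i \<equiv> seg_len a (segs m c i)"

lemma cnf: "c \<in> conf m" by (rule normal_conf[OF n])

lemma a_mono: "k \<le> l \<Longrightarrow> l < N \<Longrightarrow> a k \<le> a l"
  using en_mono[OF finite_ends, of k l m "fst c"] by simp

lemma a_seg: "k \<in> segs m c i \<Longrightarrow> a k \<le> a (Suc k)"
  using seg_pos[of k m c i] by simp

lemma a_bounds: "k < N \<Longrightarrow> 0 \<le> a k \<and> a k \<le> 1"
  using e_bounds[OF cnf, of k] by simp

lemma G_mono: "x \<le> y \<Longrightarrow> G i x \<le> G i y"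
  by (intro seg_len_mono a_seg)

lemma G_0: "G i 0 = 0"
  using a_bounds segs_index by (intro seg_len_none) (meson Suc_lessD)

lemma G_1: "i \<in> {1..m} \<Longrightarrow> G i 1 = 1 / real m"
  by (rule seg_len_total[OF n])

lemma G_bounds: "i \<in> {1..m} \<Longrightarrow> 0 \<le> s \<Longrightarrow> s \<le> 1 \<Longrightarrow> 0 \<le> real m * G i s \<and> real m * G i s \<le> 1"
proof -
  assume i: "i \<in> {1..m}" and s: "0 \<le> s" "s \<le> 1"
  have "0 \<le> G i s" "G i s \<le> 1 / real m"
    using G_mono[OF s(1), of i] G_mono[OF s(2), of i] unfolding G_0 G_1[OF i] by auto
  moreover have "0 < real m" using i by simp
  ultimately show ?thesis by (simp add: pos_le_divide_eq mult.commute)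
qed

lemma cact_in_unit: "i \<in> {1..m} \<Longrightarrow> s \<in> cact_of m c i \<Longrightarrow> 0 \<le> s \<and> s < 1"
  by (auto simp: cact_of_arcs[OF cnf] circ_arc_def frac_lt_1)

text \<open>Inside a segment of lobe \<open>i\<close>, coordinate \<open>i\<close> is strictly
  increasing and strictly between 0 and a full turn. So neither another parameter nor the
  wrap-around gives the same value.\<close>

lemma lobe_point_unique:
  assumes i: "i \<in> {1..m}" and k: "k \<in> segs m c i" "a k < s" "s < a (Suc k)"
    and s': "0 \<le> s'" "s' < 1" and eq: "gmap m (cact_of m c) s i = gmap m (cact_of m c) s' i"
  shows "s' = s"
proof -
  have idx: "Suc k < N" using segs_index[OF k(1)] by simp
  have m: "0 < real m" using i by simp
  have inc: "G i x + (y - x) \<le> G i y" if "a k \<le> x" "x \<le> y" "y \<le> a (Suc k)" for x y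
    using seg_len_increase[OF finite_segs k(1) a_seg that] .
  have s01: "0 \<le> s" "s \<le> 1" using k(2,3) a_bounds[of k] a_bounds[of "Suc k"] idx by auto
  have ab: "0 \<le> a k" "a (Suc k) \<le> 1" using a_bounds[of k] a_bounds[of "Suc k"] idx by auto
  have "0 \<le> G i (a k)" using G_mono[OF ab(1), of i] unfolding G_0 .
  moreover have "G i (a k) + (s - a k) \<le> G i s" by (rule inc[OF order_refl less_imp_le[OF k(2)] less_imp_le[OF k(3)]])
  ultimately have "0 < G i s" using k(2) by linarith
  then have p: "0 < real m * G i s" using m by simp
  have "G i (a (Suc k)) \<le> 1 / real m" using G_mono[OF ab(2), of i] unfolding G_1[OF i] .
  moreover have "G i s + (a (Suc k) - s) \<le> G i (a (Suc k))" by (rule inc[OF less_imp_le[OF k(2)] less_imp_le[OF k(3)] order_refl])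
  ultimately have "G i s < 1 / real m" using k(3) by linarith
  then have q: "real m * G i s < 1" using m by (simp add: field_simps)
  have f: "frac (real m * G i s) = frac (real m * G i s')"
    using eq by (simp add: gmap_cact(1)[OF cnf i])
  have "real m * G i s' \<noteq> 1"
  proof
    assume "real m * G i s' = 1"
    then have "frac (real m * G i s) = 0" using f by simp
    then show False using p q by (auto simp: frac_self)
  qed
  then have "real m * G i s = real m * G i s'"
    using f p q G_bounds[OF i s'(1)] s'(2) by (simp add: frac_self)
  then have eqG: "G i s = G i s'" using m by simp
  show "s' = s"
  proof (rule linorder_cases[of s' s])
    assume "s' < s"
    define x where "x = max s' (a k)"
    have x: "a k \<le> x" "x < s" "s' \<le> x" using \<open>s' < s\<close> k(2) by (auto simp: x_def)
    have "G i x + (s - x) \<le> G i s" using x k(3) by (intro inc) auto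
    moreover have "G i s' \<le> G i x" by (rule G_mono[OF x(3)])
    ultimately show ?thesis using eqG x(2) by linarith
  next
    assume "s < s'"
    define x where "x = min s' (a (Suc k))"
    have x: "x \<le> a (Suc k)" "s < x" "x \<le> s'"
      unfolding x_def using \<open>s < s'\<close> k(3) by linarith+
    have "G i s + (x - s) \<le> G i x" using x k(2) by (intro inc) auto
    moreover have "G i x \<le> G i s'" by (rule G_mono[OF x(3)])
    ultimately show ?thesis using eqG x(2) by linarith
  qed
qed

text \<open>A point on two lobes that is met inside a segment of one of them is met at no other
  parameter, by \<open>lobe_point_unique\<close>; then two labels would be visible at the same
  place.\<close>

lemma cact_blacks_subset: "cact_blacks m (cact_of m c) \<subseteq> (\<lambda>k. gmap m (cact_of m c) (a k)) ` {..<N}"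
proof
  let ?g = "gmap m (cact_of m c)"
  have end_pt: "?g s \<in> (\<lambda>k. ?g (a k)) ` {..<N}" if s: "2 * s - 1 \<in> ends m (fst c)" for s
  proof -
    obtain k where k: "k < N" "2 * s - 1 = endpt m (fst c) k" using en_obtain[OF finite_ends s] by metis
    then have "s = a k" by (simp add: field_simps)
    then show ?thesis using k(1) by blast
  qed
  have e0: "-1 \<in> ends m (fst c)" using n by (simp add: normal_def)
  fix v assume "v \<in> cact_blacks m (cact_of m c)"
  then consider "v = ?g 0" | i j where "i \<in> {1..m}" "j \<in> {1..m}" "i \<noteq> j" "v \<in> ?g ` cact_of m c i" "v \<in> ?g ` cact_of m c j"
    unfolding cact_blacks_def by blast
  then show "v \<in> (\<lambda>k. ?g (a k)) ` {..<N}"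
  proof cases
    case 1
    then show ?thesis using end_pt[of 0] e0 by simp
  next
    case 2
    then obtain s s' where s: "s \<in> cact_of m c i" "v = ?g s" "s' \<in> cact_of m c j" "v = ?g s'" by blast
    show ?thesis
    proof (cases "2 * s - 1 \<in> ends m (fst c)")
      case True
      then show ?thesis using end_pt s(2) by simp
    next
      case False
      have s01: "0 < s" "s < 1"
        using cact_in_unit[OF 2(1) s(1)] False e0 by (auto simp: less_le)
      have v: "visible m c i (2 * s - 1)" using mem_cact_vis[OF cnf 2(1) s01 False] s(1) by simp
      then obtain k where k: "k \<in> segs m c i" "endpt m (fst c) k < 2 * s - 1" "2 * s - 1 < endpt m (fst c) (Suc k)"
        using vis_iff_segs[OF cnf False] by blast
      have "a k < s" "s < a (Suc k)" using k(2,3) by simp_all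
      moreover have "0 \<le> s'" "s' < 1" using cact_in_unit[OF 2(2) s(3)] by simp_all
      moreover have "?g s i = ?g s' i" unfolding s(2)[symmetric] s(4)[symmetric] ..
      ultimately have "s' = s" by (rule lobe_point_unique[OF 2(1) k(1)])
      then have "visible m c j (2 * s - 1)" using mem_cact_vis[OF cnf 2(2) s01 False] s(3) by simp
      then show ?thesis using vis_unique[OF cnf v] 2(3) by blast
    qed
  qed
qed

text \<open>By the non-crossing condition, any other lobe lies either wholly between the first and
  the last segment of lobe \<open>i\<close> or wholly outside. On the way it is traversed completely
  or not at all, and lobe \<open>i\<close> completely, so every coordinate returns modulo 1.\<close>

lemma lobe_ends:
  assumes i: "i \<in> {1..m}"
  shows "gmap m (cact_of m c) (a (Min (segs m c i))) = gmap m (cact_of m c) (a (Suc (Max (segs m c i))))"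
proof
  fix j
  let ?f = "Min (segs m c i)" and ?l = "Max (segs m c i)"
  have ne: "segs m c i \<noteq> {}" by (rule segs_nonempty[OF n i])
  have fl: "?f \<in> segs m c i" "?l \<in> segs m c i" "\<And>k. k \<in> segs m c i \<Longrightarrow> ?f \<le> k \<and> k \<le> ?l"
    using ne finite_segs by auto
  have lN: "Suc ?l < N" using segs_index[OF fl(2)] by simp
  have whole: "G j (a ?f) = 0 \<and> G j (a (Suc ?l)) = 1 / real m"
    if j: "j \<in> {1..m}" and all: "\<And>k. k \<in> segs m c j \<Longrightarrow> ?f \<le> k \<and> k \<le> ?l" for j
  proof
    show "G j (a ?f) = 0"
    proof (rule seg_len_none)
      fix k assume k: "k \<in> segs m c j"
      have "Suc k < N" "?f \<le> k" using segs_index[OF k] all[OF k] by auto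
      then show "a ?f \<le> a k \<and> a ?f \<le> a (Suc k)" by (intro conjI a_mono) auto
    qed
    have "a k \<le> a (Suc ?l) \<and> a (Suc k) \<le> a (Suc ?l)" if "k \<in> segs m c j" for k
      using all[OF that] lN by (intro conjI a_mono) auto
    moreover have "a k \<le> 1 \<and> a (Suc k) \<le> 1" if "k \<in> segs m c j" for k
      using segs_index[OF that] a_bounds by auto
    ultimately have "G j (a (Suc ?l)) = G j 1" by (simp add: seg_len_all)
    then show "G j (a (Suc ?l)) = 1 / real m" using G_1[OF j] by simp
  qed
  have w': "frac (real m * G j (a ?f)) = frac (real m * G j (a (Suc ?l)))"
    if "j \<in> {1..m}" "\<And>k. k \<in> segs m c j \<Longrightarrow> ?f \<le> k \<and> k \<le> ?l" for j
    using whole[OF that] that(1) by simp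
  show "gmap m (cact_of m c) (a ?f) j = gmap m (cact_of m c) (a (Suc ?l)) j"
  proof (cases "j \<in> {1..m}")
    case False
    then show ?thesis unfolding gmap_def by (simp only: if_False)
  next
    case j: True
    have "frac (real m * G j (a ?f)) = frac (real m * G j (a (Suc ?l)))"
    proof (cases "j = i")
      case True
      then show ?thesis using w'[OF j] fl(3) by blast
    next
      case ji: False
      have disj: "k \<notin> segs m c i" if "k \<in> segs m c j" for k using segs_disjoint[OF cnf ji] that by blast
      show ?thesis
      proof (cases "\<exists>k\<in>segs m c j. ?f < k \<and> k < ?l")
        case True
        then obtain k where k: "k \<in> segs m c j" "?f < k" "k < ?l" by blast
        have "?f \<le> k' \<and> k' \<le> ?l" if k': "k' \<in> segs m c j" for k'
        proof (rule ccontr)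
          assume "\<not> (?f \<le> k' \<and> k' \<le> ?l)"
          then consider "k' < ?f" | "?l < k'" by linarith
          then show False
          proof cases
            case 1
            then show False using segs_noncrossing[OF n 1 k(2,3) k' fl(1) k(1) fl(2)] ji by simp
          next
            case 2
            then show False using segs_noncrossing[OF n k(2,3) 2 fl(1) k(1) fl(2) k'] ji by simp
          qed
        qed
        then show ?thesis using w'[OF j] by blast
      next
        case False
        have "min (a ?f) (a (Suc k)) - min (a ?f) (a k) = min (a (Suc ?l)) (a (Suc k)) - min (a (Suc ?l)) (a k)"
          if k: "k \<in> segs m c j" for k
        proof -
          have kN: "Suc k < N" using segs_index[OF k] by simp
          have "k \<noteq> ?f" "k \<noteq> ?l" using disj[OF k] fl by metis+
          then consider "k < ?f" | "?l < k" using False k by force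
          then show ?thesis
          proof cases
            case 1
            have "?f < N" "?f \<le> ?l" using segs_index[OF fl(1)] fl(3)[OF fl(1)] by auto
            have "a k \<le> a ?f" "a (Suc k) \<le> a ?f" "a k \<le> a (Suc ?l)" "a (Suc k) \<le> a (Suc ?l)"
              by (rule a_mono; use 1 lN \<open>?f < N\<close> \<open>?f \<le> ?l\<close> in linarith)+
            then show ?thesis by (simp only: min_absorb2)
          next
            case 2
            have "?f \<le> ?l" using fl(3)[OF fl(1)] by simp
            have "a ?f \<le> a k" "a ?f \<le> a (Suc k)" "a (Suc ?l) \<le> a k" "a (Suc ?l) \<le> a (Suc k)"
              by (rule a_mono; use 2 kN \<open>?f \<le> ?l\<close> in linarith)+
            then show ?thesis by (simp only: min_absorb1)
          qed
        qed
        then have "G j (a ?f) = G j (a (Suc ?l))" unfolding seg_len_def by (intro sum.cong) auto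
        then show ?thesis by simp
      qed
    qed
    then show ?thesis by (simp add: gmap_cact(1)[OF cnf j])
  qed
qed

lemma kaufmann_dim_le: "kaufmann_dim m (cact_of m c) \<le> N - 1 - m"
proof -
  let ?H = "\<lambda>k. gmap m (cact_of m c) (a k)"
  have fl: "Min (segs m c i) \<in> segs m c i" "Min (segs m c i) < Suc (Max (segs m c i))"
    "Suc (Max (segs m c i)) < N" if "i \<in> {1..m}" for i
  proof -
    have ne: "segs m c i \<noteq> {}" by (rule segs_nonempty[OF n that])
    then show "Min (segs m c i) \<in> segs m c i" "Min (segs m c i) < Suc (Max (segs m c i))"
      using finite_segs[of m c i] by (auto simp: less_Suc_eq_le)
    have "Max (segs m c i) \<in> segs m c i" using ne finite_segs by simp
    then show "Suc (Max (segs m c i)) < N" using segs_index by blast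
  qed
  \<comment> \<open>The left ends of the first segments are \<open>m\<close> distinct indices, each
    with the same image as a later one.\<close>
  have "inj_on (\<lambda>i. Min (segs m c i)) {1..m}"
  proof (rule inj_onI)
    fix i j assume ij: "i \<in> {1..m}" "j \<in> {1..m}" "Min (segs m c i) = Min (segs m c j)"
    then have "Min (segs m c i) \<in> segs m c i \<inter> segs m c j" using fl(1)[of i] fl(1)[of j] by simp
    then show "i = j" using segs_disjoint[OF cnf, of i j] by blast
  qed
  then have "card (?H ` {..<N}) \<le> N - card {1..m}"
    using fl lobe_ends by (intro card_chain[where g = "\<lambda>i. Suc (Max (segs m c i))"]) auto
  then have "card (cact_blacks m (cact_of m c)) \<le> N - m"
    using card_mono[OF _ cact_blacks_subset] by fastforce
  then show ?thesis by (simp add: kaufmann_dim_def)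
qed

end

section \<open>Continuity of \<open>p_map\<close> and the final assembly\<close>

lemma card_ends_le: "card (ends m L) \<le> 2 * m"
proof -
  have "card (ends m L) \<le> card (idx m)" unfolding ends_idx by (rule card_image_le) (simp add: idx_def)
  also have "\<dots> = 2 * m" by (simp add: idx_def card_cartesian_product)
  finally show ?thesis .
qed

text \<open>Farther than \<delta> from the endpoints of \<open>c\<close>, the same intervals lie
  over \<open>z\<close> in both configurations. Any two of them are already compared in
  \<open>c\<close>, and these comparisons hold in \<open>c'\<close>, so \<open>c'\<close> adds none
  among them.\<close>

lemma vis_near:
  assumes c: "c \<in> conf m" "c' \<in> conf m" and d: "\<And>j. j \<in> {1..m} \<Longrightarrow> dist (fst c j) (fst c' j) < \<delta>"
    and h: "hrel m c \<subseteq> hrel m c'" and \<delta>: "0 < \<delta>" and z: "\<And>x. x \<in> ends m (fst c) \<Longrightarrow> \<delta> < \<bar>z - x\<bar>"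
  shows "visible m c i z \<longleftrightarrow> visible m c' i z"
proof -
  have d': "\<bar>fst (fst c j) - fst (fst c' j)\<bar> < \<delta>" "\<bar>snd (fst c j) - snd (fst c' j)\<bar> < \<delta>" if "j \<in> {1..m}" for j
    using d[OF that] dist_fst_le[of "fst c j" "fst c' j"] dist_snd_le[of "fst c j" "fst c' j"] by (auto simp: dist_real_def)
  have z': "\<delta> < \<bar>z - fst (fst c j)\<bar>" "\<delta> < \<bar>z - snd (fst c j)\<bar>" if "j \<in> {1..m}" for j
    using z ends_I[OF that, of "fst c"] by auto
  have mem: "z \<in> {fst (fst c j)..snd (fst c j)} \<longleftrightarrow> z \<in> {fst (fst c' j)..snd (fst c' j)}" if "j \<in> {1..m}" for j
    using d'[OF that] z'[OF that] by auto
  have nc: "z \<notin> ends m (fst c)" using z[of z] \<delta> by auto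
  have nc': "z \<notin> ends m (fst c')"
  proof
    assume "z \<in> ends m (fst c')"
    then obtain j where "j \<in> {1..m}" "z = fst (fst c' j) \<or> z = snd (fst c' j)"
      by (auto simp: ends_def coord_def split: if_splits)
    then show False using d'[of j] z'[of j] by auto
  qed
  have rel: "(i, j) \<in> hrel m c \<longleftrightarrow> (i, j) \<in> hrel m c'"
    if ij: "i \<in> {1..m}" "j \<in> {1..m}" "z \<in> {fst (fst c i)..snd (fst c i)}" "z \<in> {fst (fst c j)..snd (fst c j)}" for i j
  proof
    assume ij': "(i, j) \<in> hrel m c'"
    then have "height (snd c') i < height (snd c') j" by (simp add: hrel_def)
    then have "i \<noteq> j" "(j, i) \<notin> hrel m c'" by (auto simp: hrel_def)
    then have "height (snd c) i \<noteq> height (snd c) j" "(j, i) \<notin> hrel m c" using h height_inj[OF c(1)] by auto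
    moreover have "z \<noteq> fst (fst c i)" "z \<noteq> snd (fst c i)" "z \<noteq> fst (fst c j)" "z \<noteq> snd (fst c j)"
      using nc ends_I[OF ij(1), of "fst c"] ends_I[OF ij(2), of "fst c"] by metis+
    then have "interiors_meet (fst c i) (fst c j)" "interiors_meet (fst c j) (fst c i)"
      using ij by (auto simp: interiors_meet_def)
    ultimately show "(i, j) \<in> hrel m c" using ij by (auto simp: hrel_def)
  qed (use h in blast)
  show ?thesis unfolding vis_hrel[OF c(1) nc] vis_hrel[OF c(2) nc'] using mem rel by blast
qed

lemma measure_vis_near:
  assumes c: "c \<in> conf m" "c' \<in> conf m" and d: "\<And>j. j \<in> {1..m} \<Longrightarrow> dist (fst c j) (fst c' j) < \<delta>"
    and h: "hrel m c \<subseteq> hrel m c'" and \<delta>: "0 < \<delta>"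
  shows "\<bar>measure lborel {z. visible m c i z \<and> z \<le> x} - measure lborel {z. visible m c' i z \<and> z \<le> x}\<bar> \<le> 4 * real m * \<delta>"
proof -
  let ?A = "{z. visible m c i z \<and> z \<le> x}" and ?B = "{z. visible m c' i z \<and> z \<le> x}"
  \<comment> \<open>Visibility can differ only within \<delta> of the endpoints of \<open>c\<close>:
    at most \<open>2 m\<close> intervals of length \<open>2 \<delta>\<close>, whence the bound
    \<open>4 m \<delta>\<close>.\<close>
  let ?X = "\<Union>y\<in>ends m (fst c). {y - \<delta>..y + \<delta>}"
  have X: "?X \<in> fmeasurable lborel" by (intro fmeasurable.finite_UN finite_ends) (auto simp: fmeasurable_def emeasure_lborel_Icc_eq)
  have "measure lborel ?X \<le> (\<Sum>y\<in>ends m (fst c). measure lborel {y - \<delta>..y + \<delta>})"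
    by (rule measure_UNION_le[OF finite_ends]) auto
  also have "\<dots> = real (card (ends m (fst c))) * (2 * \<delta>)" using \<delta> by simp
  also have "\<dots> \<le> (2 * real m) * (2 * \<delta>)"
    using card_ends_le[of m "fst c"] \<delta> by (intro mult_right_mono) auto
  finally have mX: "measure lborel ?X \<le> 4 * real m * \<delta>" by simp
  have eq: "z \<in> ?A \<longleftrightarrow> z \<in> ?B" if "z \<notin> ?X" for z
  proof -
    have "\<delta> < \<bar>z - y\<bar>" if "y \<in> ends m (fst c)" for y using \<open>z \<notin> ?X\<close> that by force
    then show ?thesis using vis_near[OF c d h \<delta>] by simp
  qed
  note A = measure_vis(1)[OF c(1), of i x] and B = measure_vis(1)[OF c(2), of i x]
  have sub: "measure lborel S \<le> measure lborel T + measure lborel ?X"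
    if "S \<in> fmeasurable lborel" "T \<in> fmeasurable lborel" "S \<subseteq> T \<union> ?X" for S T
  proof -
    have "measure lborel S \<le> measure lborel (T \<union> ?X)"
      using that X by (intro measure_mono_fmeasurable fmeasurable.Un fmeasurableD) auto
    also have "\<dots> \<le> measure lborel T + measure lborel ?X"
      using that X by (intro measure_Un_le fmeasurableD) auto
    finally show ?thesis .
  qed
  have "?A \<subseteq> ?B \<union> ?X" "?B \<subseteq> ?A \<union> ?X" using eq by blast+
  then show ?thesis using sub[OF A B] sub[OF B A] mX by linarith
qed

lemma cact_dist_near:
  assumes m: "1 \<le> m" and c: "c \<in> conf m" "c' \<in> conf m" and d: "\<And>j. j \<in> {1..m} \<Longrightarrow> dist (fst c j) (fst c' j) < \<delta>"
    and h: "hrel m c \<subseteq> hrel m c'" and \<delta>: "0 < \<delta>"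
  shows "cact_dist m (cact_of m c) (cact_of m c') \<le> 2 * (real m)\<^sup>2 * \<delta>"
proof (rule cact_dist_least[OF m])
  fix s :: real and i assume i: "i \<in> {1..m}"
  let ?M = "\<lambda>c. measure lborel {z. visible m c i z \<and> z \<le> 2 * s - 1}"
  have "circ_dist (gmap m (cact_of m c) s i) (gmap m (cact_of m c') s i) \<le> \<bar>real m / 2 * ?M c - real m / 2 * ?M c'\<bar>"
    unfolding gmap_cact(2)[OF c(1) i] gmap_cact(2)[OF c(2) i] by (rule circ_dist_frac)
  also have "\<dots> = real m / 2 * \<bar>?M c - ?M c'\<bar>"
    unfolding right_diff_distrib[symmetric] abs_mult by simp
  also have "\<dots> \<le> real m / 2 * (4 * real m * \<delta>)"
    using measure_vis_near[OF c d h \<delta>] by (intro mult_left_mono) auto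
  also have "\<dots> = 2 * (real m)\<^sup>2 * \<delta>" by (simp add: power2_eq_square)
  finally show "circ_dist (gmap m (cact_of m c) s i) (gmap m (cact_of m c') s i) \<le> 2 * (real m)\<^sup>2 * \<delta>" .
qed

lemma p_map_rep: "p_map m q = cact_of m (rep q)"
  by (simp add: p_map_def rep_def)

lemma rep_Ov1:
  assumes "1 \<le> m" "q \<in> Ov1 m"
  shows "rep q \<in> conf m" "normal m (rep q)" "q \<in> ov_class m ` conf m"
proof -
  show q: "q \<in> ov_class m ` conf m" using assms(2) Ov1_subset by blast
  then obtain c where c: "c \<in> conf m" "q = ov_class m c" by blast
  show r: "rep q \<in> conf m" using rep_ov_class(1)[OF c(1)] c(2) by simp
  have "ov_class m (rep q) = q" using rep_ov_class(4)[OF c(1)] c(2) by simp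
  then show "normal m (rep q)" using Ov1_normal[OF assms(1) r] assms(2) by simp
qed

lemma continuous_p_map:
  assumes m: "1 \<le> m"
  shows "continuous_map (Ov1_top m) (Cact_top m) (p_map m)"
  unfolding continuous_map_def topspace_Ov1_top topspace_Cact_top[OF m]
proof (intro conjI allI impI)
  show P: "p_map m \<in> Ov1 m \<rightarrow> Cact1 m"
    using cact_Cact1 rep_Ov1(2)[OF m] by (auto simp: p_map_rep)
  fix U assume U: "openin (Cact_top m) U"
  show "openin (Ov1_top m) {q \<in> Ov1 m. p_map m q \<in> U}"
  proof (subst openin_subopen, intro ballI)
    fix q0 assume q0: "q0 \<in> {q \<in> Ov1 m. p_map m q \<in> U}"
    then obtain r where r: "0 < r" "\<forall>Q\<in>Cact1 m. cact_dist m (p_map m q0) Q < r \<longrightarrow> Q \<in> U"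
      using U unfolding openin_Cact_top[OF m] by blast
    note r0 = rep_Ov1[OF m, of q0]
    \<comment> \<open>Chosen so that the bound of \<open>cact_dist_near\<close> becomes
      \<open>r / 2\<close>.\<close>
    define \<delta> where "\<delta> = r / (4 * (real m)\<^sup>2)"
    have \<delta>: "0 < \<delta>" "2 * (real m)\<^sup>2 * \<delta> < r" using r m by (auto simp: \<delta>_def)
    \<comment> \<open>The neighbourhood of \<open>q0\<close>: every interval stays within \<delta>,
      and every height comparison of \<open>q0\<close> is kept. These are finitely many open
      conditions.\<close>
    let ?W1 = "\<lambda>j. {q \<in> ov_class m ` conf m. fst (rep q) j \<in> ball (fst (rep q0) j) \<delta>}"
    let ?W2 = "\<lambda>p. {q \<in> ov_class m ` conf m. (fst p, snd p) \<in> hrel m (rep q)}"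
    let ?\<W> = "?W1 ` {1..m} \<union> ?W2 ` hrel m (rep q0)"
    let ?T = "\<Inter>?\<W> \<inter> Ov1 m"
    have fin: "finite (hrel m (rep q0))"
      by (rule finite_subset[of _ "{1..m} \<times> {1..m}"]) (auto simp: hrel_def)
    have "openin (Ov_top m) W" if "W \<in> ?\<W>" for W
      using that
    proof
      assume "W \<in> ?W1 ` {1..m}"
      then show ?thesis using openin_Ov_coord[OF _ open_ball] by blast
    next
      assume "W \<in> ?W2 ` hrel m (rep q0)"
      then obtain p where "p \<in> hrel m (rep q0)" "W = ?W2 p" by blast
      moreover from this have "fst p \<in> {1..m}" "snd p \<in> {1..m}" by (auto simp: hrel_def)
      ultimately show ?thesis using openin_Ov_hrel by blast
    qed
    moreover have "?\<W> \<noteq> {}" using m by auto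
    ultimately have "openin (Ov_top m) (\<Inter>?\<W>)" using fin by (intro openin_Inter) auto
    then have "openin (Ov1_top m) ?T" unfolding Ov1_top_def openin_subtopology by blast
    moreover have "q0 \<in> ?T" using q0 r0 \<delta>(1) by (auto simp: ball_def)
    moreover have "?T \<subseteq> {q \<in> Ov1 m. p_map m q \<in> U}"
    proof
      fix q assume q: "q \<in> ?T"
      then have qO: "q \<in> Ov1 m" and qW: "\<And>W. W \<in> ?\<W> \<Longrightarrow> q \<in> W" by (blast, blast)
      have "dist (fst (rep q0) j) (fst (rep q) j) < \<delta>" if "j \<in> {1..m}" for j
        using qW[OF UnI1[OF imageI[OF that]]] by simp
      moreover have "(i, j) \<in> hrel m (rep q)" if "(i, j) \<in> hrel m (rep q0)" for i j
        using qW[OF UnI2[OF imageI[OF that]]] by simp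
      then have "hrel m (rep q0) \<subseteq> hrel m (rep q)" by auto
      ultimately have "cact_dist m (p_map m q0) (p_map m q) \<le> 2 * (real m)\<^sup>2 * \<delta>"
        unfolding p_map_rep using r0(1) q0 rep_Ov1(1)[OF m qO] \<delta>(1) by (intro cact_dist_near m) auto
      then have "cact_dist m (p_map m q0) (p_map m q) < r" using \<delta>(2) by linarith
      moreover have "p_map m q \<in> Cact1 m" using P qO by blast
      ultimately show "q \<in> {q \<in> Ov1 m. p_map m q \<in> U}" using r(2) qO by blast
    qed
    ultimately show "\<exists>T. openin (Ov1_top m) T \<and> q0 \<in> T \<and> T \<subseteq> {q \<in> Ov1 m. p_map m q \<in> U}" by blast
  qed
qed

theorem theorem5p6:
  fixes m :: nat
  assumes "m \<ge> 1"
  shows "\<exists>C. regular_CW_complex (Ov1_top m) C \<and>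
             cellular_map (Ov1_top m) C (Cact_top m) (kaufmann_skeleton m) (p_map m)"
proof (intro exI conjI)
  show "regular_CW_complex (Ov1_top m) (cells m)" by (rule regular_CW_cells[OF assms])
  show "cellular_map (Ov1_top m) (cells m) (Cact_top m) (kaufmann_skeleton m) (p_map m)"
    unfolding cellular_map_def
  proof (intro conjI allI)
    show "continuous_map (Ov1_top m) (Cact_top m) (p_map m)" by (rule continuous_p_map[OF assms])
    fix n
    show "p_map m ` skeleton (cells m) n \<subseteq> kaufmann_skeleton m n"
    proof
      fix P assume "P \<in> p_map m ` skeleton (cells m) n"
      then obtain q q0 where q: "P = p_map m q" "q \<in> cell_of m (otype m (rep q0))" "cell_dim m (otype m (rep q0)) \<le> n"
        by (auto simp: skeleton_def cells_def)
      then have qO: "q \<in> Ov1 m" "otype m (rep q) = otype m (rep q0)" by (auto simp: cell_of_def)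
      have nr: "normal m (rep q)" by (rule rep_Ov1(2)[OF assms qO(1)])
      have "kaufmann_dim m P \<le> cell_dim m (otype m (rep q))"
        using normal_config.kaufmann_dim_le[OF normal_config.intro[OF nr]] by (simp add: q(1) p_map_rep cell_dim_typ)
      then show "P \<in> kaufmann_skeleton m n"
        using cact_Cact1[OF nr] q qO by (simp add: kaufmann_skeleton_def p_map_rep)
    qed
  qed
qed

end
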